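(* Let $0<\alpha<1$ and $\eta\ge 0$, and let $\mathcal{A}:\mathcal{D}(\mathcal{A})\subset\mathcal{H}\to\mathcal{H}$ be the operator of the augmented mixture system defined in the context. Then the $C_0$-semigroup $(e^{t\mathcal{A}})_{t\ge 0}$ generated by $\mathcal{A}$ is strongly stable in $\mathcal{H}$, i.e. $$\lim_{t\to+\infty}\left\|e^{t\mathcal{A}}\mathbb{U}_0\right\|_{\mathcal{H}}=0\qquad\text{for all }\mathbb{U}_0\in\mathcal{H}.$$
   Context: Setting. $\Omega\subset\mathbb{R}^3$ is a bounded, simply connected domain with smooth boundary. The constants satisfy $\rho_1,\rho_2>0$, $0<\alpha<1$, $\eta\ge 0$, and $a_{11},a_{12},a_{22}\in\mathbb{R}$ with $a_{11}>0$, $a_{11}a_{22}-a_{12}^2>0$ (the same constant $\alpha$ serves as coupling coefficient and as fractional order). Put $\mu(\xi)=|\xi|^{(2\alpha-1)/2}$ for $\xi\in\mathbb{R}$ and $\mathfrak{C}=\pi^{-1}\sin(\alpha\pi)$. All function spaces are over $\mathbb{C}$. Phase space: $\mathcal{H}=[H_0^1(\Omega)]^2\times[L^2(\Omega)]^2\times[L^2(\mathbb{R};L^2(\Omega))]^2$, with elements $\mathbb{U}=(u,v,U,V,\varphi_1,\varphi_2)^T$, is a Hilbert space with inner product $$\langle\mathbb{U},\widetilde{\mathbb{U}}\rangle_{\mathcal{H}}=\rho_1\langle U,\widetilde U\rangle+\rho_2\langle V,\widetilde V\rangle+a_{11}\langle\nabla u,\nabla\widetilde u\rangle+a_{22}\langle\nabla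 v,\nabla\widetilde v\rangle+a_{12}[\langle\nabla u,\nabla\widetilde v\rangle+\langle\nabla v,\nabla\widetilde u\rangle]+\alpha\langle u-v,\widetilde u-\widetilde v\rangle+\mathfrak{C}\langle\varphi_1,\widetilde\varphi_1\rangle_{L^2(\mathbb{R};L^2(\Omega))}+\mathfrak{C}\langle\varphi_2,\widetilde\varphi_2\rangle_{L^2(\mathbb{R};L^2(\Omega))},$$ where $\langle\cdot,\cdot\rangle$ is the $L^2(\Omega)$ inner product. Operator: $\mathcal{A}\mathbb{U}$ is the vector with components 1. $U$; 2. $V$; 3. $\frac1{\rho_1}\big[a_{11}\Delta u+a_{12}\Delta v-\alpha(u-v)-\mathfrak{C}\int_{\mathbb{R}}\mu(\xi)\varphi_1(\xi)\,d\xi\big]$; 4. $\frac1{\rho_2}\big[a_{12}\Delta u+a_{22}\Delta v+\alpha(u-v)-\mathfrak{C}\int_{\mathbb{R}}\mu(\xi)\varphi_2(\xi)\,d\xi\big]$; 5. $-(\xi^2+\eta)\varphi_1(\xi)+\mu(\xi)U$; 6. $-(\xi^2+\eta)\varphi_2(\xi)+\mu(\xi)V$. Its domain $\mathcal{D}(\mathcal{A})$ is the set of $\mathbb{U}\in\mathcal{H}$ such that $U,V\in H_0^1(\Omega)$; $a_{11}u+a_{12}v\in H^2(\Omega)$ and $a_{12}u+a_{22}v\in H^2(\Omega)$; $a_{11}\Delta u+a_{12}\Delta v-\mathfrak{C}\int_{\mathbb{R}}\mu\varphi_1d\xi\in L^2(\Omega)$ and $a_{12}\Delta u+a_{22}\Delta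 v-\mathfrak{C}\int_{\mathbb{R}}\mu\varphi_2d\xi\in L^2(\Omega)$; and $\xi\varphi_1,\ \xi\varphi_2,\ -(\xi^2+\eta)\varphi_1+\mu(\xi)U,\ -(\xi^2+\eta)\varphi_2+\mu(\xi)V\in L^2(\mathbb{R};L^2(\Omega))$. The operator $\mathcal{A}$ generates a $C_0$-semigroup of contractions on $\mathcal{H}$, denoted $(e^{t\mathcal{A}})_{t\ge0}$. *)

theory Defs
  imports "HOL-Analysis.Analysis"
begin

text \<open>
  Elements of the function spaces are represented by functions. Two representatives denote the same
  element of a space iff the (semi)norm of their difference is 0, and every statement about
  operators below is made modulo this relation.
\<close>

section \<open>Smooth functions and smooth boundaries\<close>

primrec Ck_on :: "nat \<Rightarrow> 'a::euclidean_space set \<Rightarrow> ('a \<Rightarrow> 'b::real_normed_vector) \<Rightarrow> bool" where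
  "Ck_on 0 S f \<longleftrightarrow> continuous_on S f"
| "Ck_on (Suc k) S f \<longleftrightarrow>
     f differentiable_on S \<and> (\<forall>b\<in>Basis. Ck_on k S (\<lambda>x. frechet_derivative f (at x) b))"

text \<open>Only used for open sets \<open>S\<close>.\<close>
definition smooth_on :: "'a::euclidean_space set \<Rightarrow> ('a \<Rightarrow> 'b::real_normed_vector) \<Rightarrow> bool" where
  "smooth_on S f \<longleftrightarrow> (\<forall>k. Ck_on k S f)"

text \<open>Near each boundary point, \<open>\<Omega>\<close> is the strict sublevel set of a smooth function with nonzero
  derivative; in particular \<open>\<Omega>\<close> lies locally on one side of its boundary.\<close>
definition smooth_boundary :: "'a::euclidean_space set \<Rightarrow> bool" where
  "smooth_boundary \<Omega> \<longleftrightarrow>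
     (\<forall>p\<in>frontier \<Omega>. \<exists>W g. open W \<and> p \<in> W \<and> smooth_on W (g :: 'a \<Rightarrow> real) \<and>
        frechet_derivative g (at p) \<noteq> (\<lambda>_. 0) \<and> \<Omega> \<inter> W = {x \<in> W. g x < 0})"


section \<open>\<open>L\<^sup>2\<close>, distributions and Sobolev spaces\<close>

type_synonym R3 = "real ^ 3"
type_synonym field = "R3 \<Rightarrow> complex"
type_synonym distribution = "field \<Rightarrow> complex"  \<comment> \<open>only evaluated at test functions\<close>

abbreviation vol :: "R3 set \<Rightarrow> R3 measure" where
  "vol \<Omega> \<equiv> restrict_space lborel \<Omega>"

definition L2 :: "R3 set \<Rightarrow> field set" where
  "L2 \<Omega> = {f \<in> borel_measurable (vol \<Omega>). integrable (vol \<Omega>) (\<lambda>x. (cmod (f x))\<^sup>2)}"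

definition L2_inner :: "R3 set \<Rightarrow> field \<Rightarrow> field \<Rightarrow> complex" where
  "L2_inner \<Omega> f g = (LINT x|vol \<Omega>. f x * cnj (g x))"

definition L2_norm :: "R3 set \<Rightarrow> field \<Rightarrow> real" where
  "L2_norm \<Omega> f = sqrt (LINT x|vol \<Omega>. (cmod (f x))\<^sup>2)"

definition partial :: "3 \<Rightarrow> field \<Rightarrow> field" where
  "partial i f = (\<lambda>x. frechet_derivative f (at x) (axis i 1))"

definition test_functions :: "R3 set \<Rightarrow> field set" where
  "test_functions \<Omega> =
     {\<psi>. smooth_on UNIV \<psi> \<and> compact (closure {x. \<psi> x \<noteq> 0}) \<and> closure {x. \<psi> x \<noteq> 0} \<subseteq> \<Omega>}"

definition distr_of :: "R3 set \<Rightarrow> field \<Rightarrow> distribution" where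
  "distr_of \<Omega> f = (\<lambda>\<psi>. LINT x|vol \<Omega>. f x * \<psi> x)"

definition distr_partial :: "3 \<Rightarrow> distribution \<Rightarrow> distribution" where
  "distr_partial i D = (\<lambda>\<psi>. - D (partial i \<psi>))"

definition distr_laplacian :: "distribution \<Rightarrow> distribution" where
  "distr_laplacian D = (\<lambda>\<psi>. \<Sum>i\<in>UNIV. distr_partial i (distr_partial i D) \<psi>)"

definition represents :: "R3 set \<Rightarrow> distribution \<Rightarrow> field \<Rightarrow> bool" where
  "represents \<Omega> D g \<longleftrightarrow> g \<in> L2 \<Omega> \<and> (\<forall>\<psi>\<in>test_functions \<Omega>. D \<psi> = distr_of \<Omega> g \<psi>)"

definition distr_in_L2 :: "R3 set \<Rightarrow> distribution \<Rightarrow> bool" where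
  "distr_in_L2 \<Omega> D \<longleftrightarrow> (\<exists>g. represents \<Omega> D g)"

text \<open>The \<open>L\<^sup>2\<close> function given by a distribution; meaningful if \<open>distr_in_L2 \<Omega> D\<close>.\<close>
definition L2_rep :: "R3 set \<Rightarrow> distribution \<Rightarrow> field" where
  "L2_rep \<Omega> D = (SOME g. represents \<Omega> D g)"

definition weak_partial :: "R3 set \<Rightarrow> 3 \<Rightarrow> field \<Rightarrow> field" where
  "weak_partial \<Omega> i u = L2_rep \<Omega> (distr_partial i (distr_of \<Omega> u))"

definition H1 :: "R3 set \<Rightarrow> field set" where
  "H1 \<Omega> = {u \<in> L2 \<Omega>. \<forall>i. distr_in_L2 \<Omega> (distr_partial i (distr_of \<Omega> u))}"

definition H1_norm :: "R3 set \<Rightarrow> field \<Rightarrow> real" where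
  "H1_norm \<Omega> u = sqrt ((L2_norm \<Omega> u)\<^sup>2 + (\<Sum>i\<in>UNIV. (L2_norm \<Omega> (weak_partial \<Omega> i u))\<^sup>2))"

text \<open>The closure of the test functions in \<open>H\<^sup>1\<close>.\<close>
definition H10 :: "R3 set \<Rightarrow> field set" where
  "H10 \<Omega> = {u \<in> H1 \<Omega>. \<forall>\<epsilon>>0. \<exists>\<psi>\<in>test_functions \<Omega>. H1_norm \<Omega> (\<lambda>x. u x - \<psi> x) < \<epsilon>}"

definition H2 :: "R3 set \<Rightarrow> field set" where
  "H2 \<Omega> = {u \<in> H1 \<Omega>. \<forall>i j. distr_in_L2 \<Omega> (distr_partial j (distr_partial i (distr_of \<Omega> u)))}"

definition grad_inner :: "R3 set \<Rightarrow> field \<Rightarrow> field \<Rightarrow> complex" where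
  "grad_inner \<Omega> u w = (\<Sum>i\<in>UNIV. L2_inner \<Omega> (weak_partial \<Omega> i u) (weak_partial \<Omega> i w))"

text \<open>\<open>L\<^sup>2(\<real>; L\<^sup>2(\<Omega>))\<close>. Every strongly measurable, square integrable map from \<open>\<real>\<close> into
  \<open>L\<^sup>2(\<Omega>)\<close> has a jointly measurable representative, unique up to null sets, so measurability is
  required of \<open>(\<xi>, x) \<mapsto> \<phi> \<xi> x\<close>. For such representatives the \<open>L\<^sup>2(\<Omega>)\<close>-valued Bochner
  integral of \<open>\<phi>\<close> is \<open>x \<mapsto> LINT \<xi>|lborel. \<phi> \<xi> x\<close>.\<close>
definition L2L2 :: "R3 set \<Rightarrow> (real \<Rightarrow> field) set" where
  "L2L2 \<Omega> = {\<phi>. case_prod \<phi> \<in> borel_measurable (lborel \<Otimes>\<^sub>M vol \<Omega>) \<and>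
     (AE \<xi> in lborel. \<phi> \<xi> \<in> L2 \<Omega>) \<and> integrable lborel (\<lambda>\<xi>. (L2_norm \<Omega> (\<phi> \<xi>))\<^sup>2)}"

definition L2L2_inner :: "R3 set \<Rightarrow> (real \<Rightarrow> field) \<Rightarrow> (real \<Rightarrow> field) \<Rightarrow> complex" where
  "L2L2_inner \<Omega> \<phi> \<theta> = (LINT \<xi>|lborel. L2_inner \<Omega> (\<phi> \<xi>) (\<theta> \<xi>))"


section \<open>The phase space\<close>

type_synonym state =
  "field \<times> field \<times> field \<times> field \<times> (real \<Rightarrow> field) \<times> (real \<Rightarrow> field)"

fun state_add :: "state \<Rightarrow> state \<Rightarrow> state" where
  "state_add (u, v, U, V, \<phi>1, \<phi>2) (u', v', U', V', \<theta>1, \<theta>2) =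
     (\<lambda>x. u x + u' x, \<lambda>x. v x + v' x, \<lambda>x. U x + U' x, \<lambda>x. V x + V' x,
      \<lambda>\<xi> x. \<phi>1 \<xi> x + \<theta>1 \<xi> x, \<lambda>\<xi> x. \<phi>2 \<xi> x + \<theta>2 \<xi> x)"

fun state_scale :: "complex \<Rightarrow> state \<Rightarrow> state" where
  "state_scale c (u, v, U, V, \<phi>1, \<phi>2) =
     (\<lambda>x. c * u x, \<lambda>x. c * v x, \<lambda>x. c * U x, \<lambda>x. c * V x,
      \<lambda>\<xi> x. c * \<phi>1 \<xi> x, \<lambda>\<xi> x. c * \<phi>2 \<xi> x)"

definition state_diff :: "state \<Rightarrow> state \<Rightarrow> state" where
  "state_diff P Q = state_add P (state_scale (-1) Q)"

definition phase_space :: "R3 set \<Rightarrow> state set" where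
  "phase_space \<Omega> = H10 \<Omega> \<times> H10 \<Omega> \<times> L2 \<Omega> \<times> L2 \<Omega> \<times> L2L2 \<Omega> \<times> L2L2 \<Omega>"

definition frak_C :: "real \<Rightarrow> real" where
  "frak_C \<alpha> = sin (\<alpha> * pi) / pi"

text \<open>The value at \<open>\<xi> = 0\<close> (here 0) is irrelevant.\<close>
definition mu :: "real \<Rightarrow> real \<Rightarrow> real" where
  "mu \<alpha> \<xi> = \<bar>\<xi>\<bar> powr ((2 * \<alpha> - 1) / 2)"

fun phase_inner ::
  "R3 set \<Rightarrow> real \<Rightarrow> real \<Rightarrow> real \<Rightarrow> real \<Rightarrow> real \<Rightarrow> real \<Rightarrow> state \<Rightarrow> state \<Rightarrow> complex" where
  "phase_inner \<Omega> \<rho>1 \<rho>2 \<alpha> a11 a12 a22 (u, v, U, V, \<phi>1, \<phi>2) (u', v', U', V', \<theta>1, \<theta>2) =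
     of_real \<rho>1 * L2_inner \<Omega> U U' + of_real \<rho>2 * L2_inner \<Omega> V V'
     + of_real a11 * grad_inner \<Omega> u u' + of_real a22 * grad_inner \<Omega> v v'
     + of_real a12 * (grad_inner \<Omega> u v' + grad_inner \<Omega> v u')
     + of_real \<alpha> * L2_inner \<Omega> (\<lambda>x. u x - v x) (\<lambda>x. u' x - v' x)
     + of_real (frak_C \<alpha>) * L2L2_inner \<Omega> \<phi>1 \<theta>1
     + of_real (frak_C \<alpha>) * L2L2_inner \<Omega> \<phi>2 \<theta>2"

definition phase_norm ::
  "R3 set \<Rightarrow> real \<Rightarrow> real \<Rightarrow> real \<Rightarrow> real \<Rightarrow> real \<Rightarrow> real \<Rightarrow> state \<Rightarrow> real" where
  "phase_norm \<Omega> \<rho>1 \<rho>2 \<alpha> a11 a12 a22 P =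
     sqrt (Re (phase_inner \<Omega> \<rho>1 \<rho>2 \<alpha> a11 a12 a22 P P))"


section \<open>The operator\<close>

definition mu_integral :: "real \<Rightarrow> (real \<Rightarrow> field) \<Rightarrow> field" where
  "mu_integral \<alpha> \<phi> = (\<lambda>x. LINT \<xi>|lborel. of_real (mu \<alpha> \<xi>) * \<phi> \<xi> x)"

definition diffusive :: "real \<Rightarrow> real \<Rightarrow> (real \<Rightarrow> field) \<Rightarrow> field \<Rightarrow> (real \<Rightarrow> field)" where
  "diffusive \<alpha> \<eta> \<phi> U =
     (\<lambda>\<xi> x. - of_real (\<xi>\<^sup>2 + \<eta>) * \<phi> \<xi> x + of_real (mu \<alpha> \<xi>) * U x)"

text \<open>\<open>b \<Delta>u + c \<Delta>v - \<CC> \<integral> \<mu> \<phi>\<close> as a distribution; the Laplacians are distributional.\<close>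
definition stress_distr ::
  "R3 set \<Rightarrow> real \<Rightarrow> real \<Rightarrow> real \<Rightarrow> field \<Rightarrow> field \<Rightarrow> (real \<Rightarrow> field) \<Rightarrow> distribution" where
  "stress_distr \<Omega> \<alpha> b c u v \<phi> = (\<lambda>\<psi>.
     of_real b * distr_laplacian (distr_of \<Omega> u) \<psi> + of_real c * distr_laplacian (distr_of \<Omega> v) \<psi>
     - of_real (frak_C \<alpha>) * distr_of \<Omega> (mu_integral \<alpha> \<phi>) \<psi>)"

fun mixture_op ::
  "R3 set \<Rightarrow> real \<Rightarrow> real \<Rightarrow> real \<Rightarrow> real \<Rightarrow> real \<Rightarrow> real \<Rightarrow> real \<Rightarrow> state \<Rightarrow> state" where
  "mixture_op \<Omega> \<rho>1 \<rho>2 \<alpha> \<eta> a11 a12 a22 (u, v, U, V, \<phi>1, \<phi>2) =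
     (U,
      V,
      \<lambda>x. of_real (1 / \<rho>1) * (L2_rep \<Omega> (stress_distr \<Omega> \<alpha> a11 a12 u v \<phi>1) x - of_real \<alpha> * (u x - v x)),
      \<lambda>x. of_real (1 / \<rho>2) * (L2_rep \<Omega> (stress_distr \<Omega> \<alpha> a12 a22 u v \<phi>2) x + of_real \<alpha> * (u x - v x)),
      diffusive \<alpha> \<eta> \<phi>1 U,
      diffusive \<alpha> \<eta> \<phi>2 V)"

definition mixture_domain ::
  "R3 set \<Rightarrow> real \<Rightarrow> real \<Rightarrow> real \<Rightarrow> real \<Rightarrow> real \<Rightarrow> state set" where
  "mixture_domain \<Omega> \<alpha> \<eta> a11 a12 a22 =
     {(u, v, U, V, \<phi>1, \<phi>2). (u, v, U, V, \<phi>1, \<phi>2) \<in> phase_space \<Omega> \<and>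
        U \<in> H10 \<Omega> \<and> V \<in> H10 \<Omega> \<and>
        (\<lambda>x. of_real a11 * u x + of_real a12 * v x) \<in> H2 \<Omega> \<and>
        (\<lambda>x. of_real a12 * u x + of_real a22 * v x) \<in> H2 \<Omega> \<and>
        distr_in_L2 \<Omega> (stress_distr \<Omega> \<alpha> a11 a12 u v \<phi>1) \<and>
        distr_in_L2 \<Omega> (stress_distr \<Omega> \<alpha> a12 a22 u v \<phi>2) \<and>
        (\<lambda>\<xi> x. of_real \<xi> * \<phi>1 \<xi> x) \<in> L2L2 \<Omega> \<and>
        (\<lambda>\<xi> x. of_real \<xi> * \<phi>2 \<xi> x) \<in> L2L2 \<Omega> \<and>
        diffusive \<alpha> \<eta> \<phi>1 U \<in> L2L2 \<Omega> \<and>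
        diffusive \<alpha> \<eta> \<phi>2 V \<in> L2L2 \<Omega>}"


section \<open>Semigroups on a space of states \<open>X\<close> with (semi)norm \<open>N\<close>\<close>

definition C0_semigroup :: "state set \<Rightarrow> (state \<Rightarrow> real) \<Rightarrow> (real \<Rightarrow> state \<Rightarrow> state) \<Rightarrow> bool" where
  "C0_semigroup X N T \<longleftrightarrow>
     (\<forall>t\<ge>0. \<forall>P\<in>X. T t P \<in> X) \<and>
     (\<forall>t\<ge>0. \<forall>P\<in>X. \<forall>Q\<in>X. N (state_diff (T t (state_add P Q)) (state_add (T t P) (T t Q))) = 0) \<and>
     (\<forall>t\<ge>0. \<forall>c. \<forall>P\<in>X. N (state_diff (T t (state_scale c P)) (state_scale c (T t P))) = 0) \<and>
     (\<forall>t\<ge>0. \<exists>B. \<forall>P\<in>X. N (T t P) \<le> B * N P) \<and>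
     (\<forall>P\<in>X. N (state_diff (T 0 P) P) = 0) \<and>
     (\<forall>s\<ge>0. \<forall>t\<ge>0. \<forall>P\<in>X. N (state_diff (T (s + t) P) (T s (T t P))) = 0) \<and>
     (\<forall>P\<in>X. ((\<lambda>t. N (state_diff (T t P) P)) \<longlongrightarrow> 0) (at_right 0))"

definition contraction_semigroup ::
  "state set \<Rightarrow> (state \<Rightarrow> real) \<Rightarrow> (real \<Rightarrow> state \<Rightarrow> state) \<Rightarrow> bool" where
  "contraction_semigroup X N T \<longleftrightarrow> C0_semigroup X N T \<and> (\<forall>t\<ge>0. \<forall>P\<in>X. N (T t P) \<le> N P)"

text \<open>The infinitesimal generator of \<open>T\<close> is exactly \<open>A\<close> with domain \<open>D\<close>: the difference quotients
  at \<open>P\<close> converge iff \<open>P \<in> D\<close>, and then the limit is \<open>A P\<close>.\<close>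
definition generates ::
  "state set \<Rightarrow> (state \<Rightarrow> real) \<Rightarrow> state set \<Rightarrow> (state \<Rightarrow> state) \<Rightarrow> (real \<Rightarrow> state \<Rightarrow> state) \<Rightarrow> bool" where
  "generates X N D A T \<longleftrightarrow>
     (\<forall>P\<in>X. \<forall>F\<in>X.
        ((\<lambda>h. N (state_diff (state_scale (of_real (1 / h)) (state_diff (T h P) P)) F)) \<longlongrightarrow> 0) (at_right 0)
        \<longleftrightarrow> P \<in> D \<and> N (state_diff F (A P)) = 0)"

definition strongly_stable ::
  "state set \<Rightarrow> (state \<Rightarrow> real) \<Rightarrow> (real \<Rightarrow> state \<Rightarrow> state) \<Rightarrow> bool" where
  "strongly_stable X N T \<longleftrightarrow> (\<forall>P\<in>X. ((\<lambda>t. N (T t P)) \<longlongrightarrow> 0) at_top)"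

end

theory Submission
  imports Defs "HOL-Library.Function_Algebras"
begin

text \<open>
  On a dense set of initial data every term of the energy is shown to vanish in the limit by a
  Lyapunov argument of Barbalat type, without spectral theory. If a bounded form \<open>c\<close> converges along
  the trajectory and decreases at the rate of a nonnegative Lipschitz form \<open>q\<close> up to a vanishing error,
  then \<open>q\<close> tends to 0. With \<open>c\<close> the energy this gives \<open>\<phi>\<^sub>i \<rightarrow> 0\<close> away from \<open>\<xi> = 0\<close>; with
  \<open>c = - Re \<integral>\<^sub>1\<^sup>2 \<mu> \<langle>\<phi>\<^sub>1, U\<rangle> d\<xi>\<close> it gives \<open>U \<rightarrow> 0\<close>, and similarly for \<open>V\<close>; with
  \<open>c = Re (\<rho>\<^sub>1 \<langle>U, u\<rangle> + \<rho>\<^sub>2 \<langle>V, v\<rangle>)\<close> it gives the decay of the potential energy.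

  What remains are the frequencies near \<open>\<xi> = 0\<close>, where for \<open>\<eta> = 0\<close> the damping degenerates. On a
  dyadic annulus \<open>a \<le> \<bar>\<xi>\<bar> < 2 a\<close>, the equation \<open>\<partial>\<^sub>t (\<phi>\<^sub>1 - \<mu> u) = - (\<xi>\<^sup>2 + \<eta>) \<phi>\<^sub>1\<close> bounds the growth of
  \<open>\<integral> \<bar>\<phi>\<^sub>1 - \<mu> u\<bar>\<^sup>2\<close> by a multiple, independent of \<open>a\<close>, of the mass of \<open>\<mu>\<^sup>2\<close> on the annulus; since \<open>\<mu>\<^sup>2\<close> is
  integrable at 0, summing over the annuli shows that low frequencies stay small uniformly in time.
\<close>

text \<open>Damping acts on the diffusive variables alone, so each Lyapunov form has to pass
  smallness on to a quantity that is not damped itself. The displacement is subtracted at low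
  frequencies because the source \<open>\<mu> U\<close> of the diffusive equation tends to 0 without
  a known rate and may fail to be integrable in time, whereas its time primitive
  \<open>\<mu> u\<close> stays bounded. The resulting bound depends on the ratio of the largest to
  the smallest damping rate; on a dyadic annulus this ratio is at most 4 for every
  \<open>\<eta> \<ge> 0\<close>, while on a full neighbourhood of 0 it may be infinite. Two
  quantities are not bounded on the phase space: the dissipation, and the integral of
  \<open>\<mu> \<phi>\<close> paired with a displacement. The dissipation is replaced by a smaller
  bounded form. The pairing is controlled along trajectories in the domain, where the energy
  identity bounds the dissipation by the norms of \<open>P\<close> and \<open>A P\<close>. Only real
  parts of inner products enter, so real linearity suffices. Elements are representatives under a
  seminorm, so semigroup laws hold up to errors of seminorm 0.\<close>

instantiation "fun" :: (type, real_vector) real_vector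
begin

text \<open>With the pointwise structure on functions, \<open>state\<close> is a real vector space
  as a nested product, and the abstract theory below applies to representatives directly.\<close>

definition scaleR_fun :: "real \<Rightarrow> ('a \<Rightarrow> 'b) \<Rightarrow> 'a \<Rightarrow> 'b" where
  "scaleR_fun r f = (\<lambda>x. r *\<^sub>R f x)"

instance
  by standard (auto simp: scaleR_fun_def plus_fun_def fun_eq_iff algebra_simps)

end

section \<open>Energy methods for contraction semigroups\<close>

text \<open>If \<open>q t\<close> were large, the Lipschitz bound would keep \<open>q\<close> large
  on a window of fixed length, and \<open>c\<close> would drop there by a fixed amount, which a
  convergent function cannot do at arbitrarily late times. It is enough that \<open>r\<close> tends
  to 0; no integrability in time is involved.\<close>

lemma barbalat:
  fixes c :: "real \<Rightarrow> real"
  assumes deriv: "\<And>t. t > 0 \<Longrightarrow> (c has_real_derivative c' t) (at t)"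
    and le: "\<And>t. t > 0 \<Longrightarrow> c' t \<le> r t - q t"
    and lim: "(c \<longlongrightarrow> l) at_top" and r: "(r \<longlongrightarrow> 0) at_top"
    and lip: "\<And>s t. 0 < s \<Longrightarrow> s \<le> t \<Longrightarrow> \<bar>q t - q s\<bar> \<le> L * (t - s)"
    and q: "\<And>t. t > 0 \<Longrightarrow> q t \<ge> 0"
  shows "(q \<longlongrightarrow> 0) at_top"
proof (rule tendstoI)
  fix e :: real assume e: "e > 0"
  have "0 \<le> \<bar>q 2 - q 1\<bar>" by simp
  also have "\<dots> \<le> L * (2 - 1)" by (rule lip) auto
  finally have L: "L \<ge> 0" by simp
  \<comment> \<open>Window length on which \<open>q\<close> varies by at most \<open>e / 4\<close>;
    the summand 1 covers \<open>L = 0\<close>.\<close>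
  define d where "d = e / (4 * (L + 1))"
  have d: "d > 0" using e L by (simp add: d_def)
  have Ld: "L * d \<le> e / 4" using e L by (simp add: d_def field_simps)
  have "eventually (\<lambda>t. dist (c t) l < e * d / 8) at_top"
    using lim e d by (intro tendstoD) auto
  then obtain t1 where t1: "\<And>t. t \<ge> t1 \<Longrightarrow> dist (c t) l < e * d / 8"
    by (auto simp: eventually_at_top_linorder)
  have "eventually (\<lambda>t. dist (r t) 0 < e / 4) at_top"
    using r e by (intro tendstoD) auto
  then obtain t2 where t2: "\<And>t. t \<ge> t2 \<Longrightarrow> dist (r t) 0 < e / 4"
    by (auto simp: eventually_at_top_linorder)
  have "dist (q t) 0 < e" if t: "t \<ge> max 1 (max t1 t2)" for t
  proof -
    \<comment> \<open>The mean value theorem replaces integration over the window, so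
      \<open>c'\<close> and \<open>q\<close> need no measurability.\<close>
    have "\<exists>z>t. z < t + d \<and> c (t + d) - c t = (t + d - t) * c' z"
      using t d by (intro MVT2 deriv) auto
    then obtain z where z: "z > t" "z < t + d" "c (t + d) - c t = d * c' z" by auto
    have "c' z \<le> r z - q z" using z t by (intro le) auto
    moreover have "\<bar>q z - q t\<bar> \<le> L * (z - t)" using z t by (intro lip) auto
    moreover have "L * (z - t) \<le> L * d" using z L by (intro mult_left_mono) auto
    moreover have "dist (r z) 0 < e / 4" using z t by (intro t2) auto
    ultimately have "c' z \<le> e / 4 - q t + e / 4" using Ld by (auto simp: dist_real_def)
    then have "d * c' z \<le> d * (e / 2 - q t)" using d by (intro mult_left_mono) auto
    moreover have "dist (c t) l < e * d / 8" "dist (c (t + d)) l < e * d / 8"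
      using t d t1[of t] t1[of "t + d"] by auto
    ultimately have "d * q t \<le> d * (e / 2) + e * d / 4"
      using z(3) unfolding dist_real_def right_diff_distrib by linarith
    also have "\<dots> < d * e" using d e by (simp add: algebra_simps)
    finally have "q t < e" using d by simp
    then show ?thesis using q[of t] t by (simp add: dist_real_def)
  qed
  then show "eventually (\<lambda>t. dist (q t) 0 < e) at_top"
    unfolding eventually_at_top_linorder by blast
qed

text \<open>The bound does not grow in time and depends on the source and the rate only through
  \<open>c / a\<close>, so it survives when both degenerate at the same speed.\<close>

lemma gronwall_dissipation:
  fixes f :: "real \<Rightarrow> real"
  assumes deriv: "\<And>t. t \<ge> 0 \<Longrightarrow> (f has_real_derivative f' t) (at t within {0..})"
    and le: "\<And>t. t \<ge> 0 \<Longrightarrow> f' t \<le> c - a * f t"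
    and "a > 0" "c \<ge> 0" "f 0 \<ge> 0" "t \<ge> 0"
  shows "f t \<le> f 0 + c / a"
proof -
  \<comment> \<open>Deviation from the equilibrium \<open>c / a\<close>, multiplied by the
    integrating factor; it is nonincreasing.\<close>
  define h where "h = (\<lambda>s. exp (a * s) * (f s - c / a))"
  have h: "(h has_real_derivative exp (a * s) * (f' s + a * f s - c)) (at s within {0..})" if "s \<ge> 0" for s
    unfolding h_def using \<open>a > 0\<close>
    by (auto intro!: derivative_eq_intros deriv that simp: field_simps)
  have le0: "exp (a * s) * (f' s + a * f s - c) \<le> 0" if "s \<ge> 0" for s
    using le[OF that] by (intro mult_nonneg_nonpos) auto
  have "h t \<le> h 0"
  proof (rule DERIV_nonpos_imp_decreasing_open[OF \<open>t \<ge> 0\<close>])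
    fix s assume s: "0 < s" "s < t"
    then have "(h has_real_derivative exp (a * s) * (f' s + a * f s - c)) (at s)"
      using h[of s] at_within_interior[of s "{0..}"] by simp
    then show "\<exists>y. (h has_real_derivative y) (at s) \<and> y \<le> 0" using le0[of s] s by auto
  next
    show "continuous_on {0..t} h"
      by (rule continuous_on_subset[OF DERIV_continuous_on[of "{0..}", OF h]]) auto
  qed
  then have *: "f t - c / a \<le> exp (- a * t) * (f 0 - c / a)"
    by (simp add: h_def exp_minus field_simps)
  have "exp (- a * t) * (f 0 - c / a) \<le> f 0"
  proof -
    have "exp (- a * t) * f 0 \<le> 1 * f 0" using assms by (intro mult_right_mono) auto
    moreover have "exp (- a * t) * (c / a) \<ge> 0" using assms by auto
    ultimately show ?thesis by (simp add: algebra_simps)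
  qed
  with * show ?thesis by simp
qed


text \<open>Definiteness is not assumed because elements are functions rather than classes modulo
  null sets. The locale is instantiated by square integrable functions, by the gradient form on
  \<open>H1 \<Omega>\<close>, and by the phase space.\<close>

locale seminormed_subspace =
  fixes X :: "'a::real_vector set" and B :: "'a \<Rightarrow> 'a \<Rightarrow> real"
  assumes subspace: "subspace X"
    and B_sym: "\<And>P Q. P \<in> X \<Longrightarrow> Q \<in> X \<Longrightarrow> B P Q = B Q P"
    and B_add: "\<And>P P' Q. P \<in> X \<Longrightarrow> P' \<in> X \<Longrightarrow> Q \<in> X \<Longrightarrow> B (P + P') Q = B P Q + B P' Q"
    and B_scale: "\<And>P Q r. P \<in> X \<Longrightarrow> Q \<in> X \<Longrightarrow> B (r *\<^sub>R P) Q = r * B P Q"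
    and B_nonneg: "\<And>P. P \<in> X \<Longrightarrow> B P P \<ge> 0"
begin

definition N :: "'a \<Rightarrow> real" where "N P = sqrt (B P P)"

lemma X_add [simp]: "P \<in> X \<Longrightarrow> Q \<in> X \<Longrightarrow> P + Q \<in> X"
  and X_diff [simp]: "P \<in> X \<Longrightarrow> Q \<in> X \<Longrightarrow> P - Q \<in> X"
  and X_scale [simp]: "P \<in> X \<Longrightarrow> r *\<^sub>R P \<in> X"
  using subspace by (auto intro: subspace_add subspace_diff subspace_scale)

lemma N_nonneg [simp]: "P \<in> X \<Longrightarrow> N P \<ge> 0"
  by (simp add: N_def B_nonneg)

lemma N_sq: "P \<in> X \<Longrightarrow> (N P)\<^sup>2 = B P P"
  by (simp add: N_def B_nonneg)

lemma B_diff: "P \<in> X \<Longrightarrow> P' \<in> X \<Longrightarrow> Q \<in> X \<Longrightarrow> B (P - P') Q = B P Q - B P' Q"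
  using B_add[of "P - P'" P' Q] by simp

lemma N_zero [simp]: "N 0 = 0"
  using B_scale[of 0 0 0] subspace_0[OF subspace] by (simp add: N_def)

lemma N_scale: "P \<in> X \<Longrightarrow> N (r *\<^sub>R P) = \<bar>r\<bar> * N P"
  using B_sym[of P "r *\<^sub>R P"] by (simp add: N_def B_scale real_sqrt_mult flip: mult.assoc)

lemma B_Cauchy_Schwarz:
  assumes P: "P \<in> X" and Q: "Q \<in> X"
  shows "\<bar>B P Q\<bar> \<le> N P * N Q"
proof -
  have *: "0 \<le> B P P + 2 * r * B P Q + r\<^sup>2 * B Q Q" for r
  proof -
    have "0 \<le> B (P + r *\<^sub>R Q) (P + r *\<^sub>R Q)" using P Q by (intro B_nonneg) auto
    also have "\<dots> = B P P + 2 * r * B P Q + r\<^sup>2 * B Q Q"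
      using P Q B_sym[of P "P + r *\<^sub>R Q"] B_sym[of Q "P + r *\<^sub>R Q"] B_sym[of P Q]
      by (simp add: B_add B_scale power2_eq_square algebra_simps)
    finally show ?thesis .
  qed
  have "(B P Q)\<^sup>2 \<le> B P P * B Q Q"
  proof (cases "B Q Q = 0")
    case True
    have "B P Q = 0"
    proof (rule ccontr)
      assume "B P Q \<noteq> 0"
      \<comment> \<open>With \<open>B Q Q = 0\<close> the polynomial in \<open>r\<close> is affine;
        this \<open>r\<close> gives it the value -1.\<close>
      then show False using *[of "- (B P P + 1) / (2 * B P Q)"] True by (simp add: field_simps)
    qed
    then show ?thesis using True by simp
  next
    case False
    then have "B Q Q > 0" using B_nonneg[OF Q] by simp
    then show ?thesis using *[of "- B P Q / B Q Q"]
      by (simp add: field_simps power2_eq_square)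
  qed
  also have "\<dots> = (N P * N Q)\<^sup>2" using P Q by (simp add: N_sq power_mult_distrib)
  finally have "\<bar>B P Q\<bar> \<le> \<bar>N P * N Q\<bar>" by (simp only: abs_le_square_iff)
  then show ?thesis using P Q by (simp add: abs_mult)
qed

lemma N_triangle: "P \<in> X \<Longrightarrow> Q \<in> X \<Longrightarrow> N (P + Q) \<le> N P + N Q"
proof -
  assume P: "P \<in> X" and Q: "Q \<in> X"
  have "(N (P + Q))\<^sup>2 = (N P)\<^sup>2 + 2 * B P Q + (N Q)\<^sup>2"
    using P Q B_sym[of P "P + Q"] B_sym[of Q "P + Q"] B_sym[of P Q] by (simp add: N_sq B_add)
  also have "\<dots> \<le> (N P + N Q)\<^sup>2"
    using B_Cauchy_Schwarz[OF P Q] by (simp add: power2_sum)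
  finally show ?thesis using P Q by (auto intro: power2_le_imp_le)
qed

lemma N_minus: "P \<in> X \<Longrightarrow> N (- P) = N P"
  using N_scale[of P "-1"] by simp

lemma N_diff_commute: "P \<in> X \<Longrightarrow> Q \<in> X \<Longrightarrow> N (P - Q) = N (Q - P)"
  using N_minus[of "P - Q"] by simp

lemma N_triangle_diff: "P \<in> X \<Longrightarrow> Q \<in> X \<Longrightarrow> R \<in> X \<Longrightarrow> N (P - R) \<le> N (P - Q) + N (Q - R)"
  using N_triangle[of "P - Q" "Q - R"] by simp

lemma N_le_add_diff: "P \<in> X \<Longrightarrow> Q \<in> X \<Longrightarrow> N P \<le> N Q + N (P - Q)"
  using N_triangle[of Q "P - Q"] by simp

text \<open>The bound by \<open>N\<close> makes the value insensitive to changes of seminorm 0 in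
  either argument. This is what allows differentiation along a semigroup whose laws hold only up to
  such changes.\<close>

definition bform :: "('a \<Rightarrow> 'a \<Rightarrow> real) \<Rightarrow> bool" where
  "bform b \<longleftrightarrow>
     (\<forall>P\<in>X. \<forall>P'\<in>X. \<forall>Q\<in>X. b (P + P') Q = b P Q + b P' Q) \<and>
     (\<forall>P\<in>X. \<forall>Q\<in>X. \<forall>Q'\<in>X. b P (Q + Q') = b P Q + b P Q') \<and>
     (\<forall>r. \<forall>P\<in>X. \<forall>Q\<in>X. b (r *\<^sub>R P) Q = r * b P Q \<and> b P (r *\<^sub>R Q) = r * b P Q) \<and>
     (\<exists>K\<ge>0. \<forall>P\<in>X. \<forall>Q\<in>X. \<bar>b P Q\<bar> \<le> K * N P * N Q)"

lemma bform_B: "bform B"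
proof -
  have "B P (Q + Q') = B P Q + B P Q'" if "P \<in> X" "Q \<in> X" "Q' \<in> X" for P Q Q'
    using that by (simp add: B_sym[of P] B_add)
  moreover have "B P (r *\<^sub>R Q) = r * B P Q" if "P \<in> X" "Q \<in> X" for P Q r
    using that by (simp add: B_sym[of P] B_scale)
  ultimately show ?thesis unfolding bform_def
    using B_Cauchy_Schwarz by (auto simp: B_add B_scale intro!: exI[of _ 1])
qed

lemma bform_add:
  assumes "bform b" "bform c"
  shows "bform (\<lambda>P Q. b P Q + c P Q)"
proof -
  obtain K where K: "K \<ge> 0" "\<And>P Q. P \<in> X \<Longrightarrow> Q \<in> X \<Longrightarrow> \<bar>b P Q\<bar> \<le> K * N P * N Q"
    using assms(1) unfolding bform_def by blast
  obtain K' where K': "K' \<ge> 0" "\<And>P Q. P \<in> X \<Longrightarrow> Q \<in> X \<Longrightarrow> \<bar>c P Q\<bar> \<le> K' * N P * N Q"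
    using assms(2) unfolding bform_def by blast
  have "\<bar>b P Q + c P Q\<bar> \<le> (K + K') * N P * N Q" if "P \<in> X" "Q \<in> X" for P Q
    using K(2)[OF that] K'(2)[OF that] by (simp add: algebra_simps)
  moreover have "K + K' \<ge> 0" using K K' by simp
  ultimately show ?thesis using assms unfolding bform_def by (auto simp: algebra_simps)
qed

lemma bform_cmult:
  assumes "bform b"
  shows "bform (\<lambda>P Q. k * b P Q)"
proof -
  obtain K where K: "K \<ge> 0" "\<And>P Q. P \<in> X \<Longrightarrow> Q \<in> X \<Longrightarrow> \<bar>b P Q\<bar> \<le> K * N P * N Q"
    using assms(1) unfolding bform_def by blast
  have "\<bar>k * b P Q\<bar> \<le> (\<bar>k\<bar> * K) * N P * N Q" if "P \<in> X" "Q \<in> X" for P Q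
    using mult_left_mono[OF K(2)[OF that], of "\<bar>k\<bar>"] by (simp add: abs_mult mult_ac)
  moreover have "\<bar>k\<bar> * K \<ge> 0" using K by simp
  ultimately show ?thesis using assms unfolding bform_def by (auto simp: algebra_simps)
qed

lemma bform_diff: "bform b \<Longrightarrow> bform c \<Longrightarrow> bform (\<lambda>P Q. b P Q - c P Q)"
  using bform_add[OF _ bform_cmult[of c "-1"]] by simp

end

text \<open>The assumption \<open>generator\<close> is an equivalence: one direction yields the
  derivative at time 0, the other puts later states \<open>T t P\<close> into \<open>D\<close>. All
  laws are stated modulo seminorm 0.\<close>

locale dissipative_semigroup = seminormed_subspace +
  fixes T :: "real \<Rightarrow> 'a \<Rightarrow> 'a" and D :: "'a set" and A :: "'a \<Rightarrow> 'a"
  assumes T_in [simp]: "\<And>t P. t \<ge> 0 \<Longrightarrow> P \<in> X \<Longrightarrow> T t P \<in> X"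
    and T_add: "\<And>t P Q. t \<ge> 0 \<Longrightarrow> P \<in> X \<Longrightarrow> Q \<in> X \<Longrightarrow> N (T t (P + Q) - (T t P + T t Q)) = 0"
    and T_scale: "\<And>t r P. t \<ge> 0 \<Longrightarrow> P \<in> X \<Longrightarrow> N (T t (r *\<^sub>R P) - r *\<^sub>R T t P) = 0"
    and T_0: "\<And>P. P \<in> X \<Longrightarrow> N (T 0 P - P) = 0"
    and T_plus: "\<And>s t P. s \<ge> 0 \<Longrightarrow> t \<ge> 0 \<Longrightarrow> P \<in> X \<Longrightarrow> N (T (s + t) P - T s (T t P)) = 0"
    and T_cont0: "\<And>P. P \<in> X \<Longrightarrow> ((\<lambda>t. N (T t P - P)) \<longlongrightarrow> 0) (at_right 0)"
    and T_contr: "\<And>t P. t \<ge> 0 \<Longrightarrow> P \<in> X \<Longrightarrow> N (T t P) \<le> N P"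
    and D_in [simp]: "\<And>P. P \<in> D \<Longrightarrow> P \<in> X"
    and A_in [simp]: "\<And>P. P \<in> D \<Longrightarrow> A P \<in> X"
    and generator: "\<And>P F. P \<in> X \<Longrightarrow> F \<in> X \<Longrightarrow>
      ((\<lambda>h. N ((1 / h) *\<^sub>R (T h P - P) - F)) \<longlongrightarrow> 0) (at_right 0) \<longleftrightarrow> P \<in> D \<and> N (F - A P) = 0"
begin

lemma N_cong: "P \<in> X \<Longrightarrow> Q \<in> X \<Longrightarrow> N (P - Q) = 0 \<Longrightarrow> N P = N Q"
  using N_le_add_diff[of P Q] N_le_add_diff[of Q P] by (simp add: N_diff_commute[of P Q])

lemma N_zero_trans: "P \<in> X \<Longrightarrow> Q \<in> X \<Longrightarrow> R \<in> X \<Longrightarrow> N (P - Q) = 0 \<Longrightarrow> N (Q - R) = 0 \<Longrightarrow> N (P - R) = 0"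
  using N_triangle_diff[of P Q R] by (intro antisym) simp_all

lemma T_diff:
  assumes "t \<ge> 0" "P \<in> X" "Q \<in> X"
  shows "N (T t (P - Q) - (T t P - T t Q)) = 0"
proof -
  have "N (T t P - (T t (P - Q) + T t Q)) = 0" using T_add[of t "P - Q" Q] assms by simp
  moreover have "T t P - (T t (P - Q) + T t Q) = - (T t (P - Q) - (T t P - T t Q))" by simp
  ultimately show ?thesis using N_minus[of "T t (P - Q) - (T t P - T t Q)"] assms by (metis T_in X_diff)
qed

lemma N_T_diff_le:
  assumes "t \<ge> 0" "P \<in> X" "Q \<in> X"
  shows "N (T t P - T t Q) \<le> N (P - Q)"
  using N_cong[OF _ _ T_diff[OF assms]] T_contr[of t "P - Q"] assms by simp

lemma N_T_shift:
  assumes "s \<ge> 0" "h \<ge> 0" "P \<in> X"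
  shows "N (T (s + h) P - T s P) \<le> N (T h P - P)"
  using N_triangle_diff[of "T (s + h) P" "T s (T h P)" "T s P"] T_plus[of s h P]
    N_T_diff_le[of s "T h P" P] assms by simp

text \<open>Up to null errors from scaling, subtraction and the semigroup law, the quotient at time
  \<open>s\<close> is \<open>T s\<close> applied to the quotient at time 0, and \<open>T s\<close>
  is a contraction.\<close>

lemma N_T_quotient:
  assumes "s \<ge> 0" "h > 0" "P \<in> X" "F \<in> X"
  shows "N ((1 / h) *\<^sub>R (T (s + h) P - T s P) - T s F) \<le> N ((1 / h) *\<^sub>R (T h P - P) - F)"
proof -
  let ?Q = "(1 / h) *\<^sub>R (T h P - P)"
  have 1: "N (T s ?Q - (1 / h) *\<^sub>R T s (T h P - P)) = 0" using assms by (intro T_scale) auto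
  have "N ((1 / h) *\<^sub>R (T s (T h P - P) - (T s (T h P) - T s P))) = 0"
    using T_diff[of s "T h P" P] assms by (subst N_scale) auto
  then have 2: "N ((1 / h) *\<^sub>R T s (T h P - P) - (1 / h) *\<^sub>R (T s (T h P) - T s P)) = 0"
    by (simp only: scaleR_diff_right)
  have "N ((1 / h) *\<^sub>R (T (s + h) P - T s (T h P))) = 0"
    using T_plus[of s h P] assms by (subst N_scale) auto
  moreover have "(1 / h) *\<^sub>R (T (s + h) P - T s (T h P))
      = (1 / h) *\<^sub>R (T (s + h) P - T s P) - (1 / h) *\<^sub>R (T s (T h P) - T s P)"
    by (simp add: scaleR_diff_right)
  ultimately have 3: "N ((1 / h) *\<^sub>R (T (s + h) P - T s P) - (1 / h) *\<^sub>R (T s (T h P) - T s P)) = 0"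
    by simp
  have 12: "N (T s ?Q - (1 / h) *\<^sub>R (T s (T h P) - T s P)) = 0"
    by (rule N_zero_trans[OF _ _ _ 1 2]) (use assms in auto)
  have "N ((1 / h) *\<^sub>R (T (s + h) P - T s P) - T s ?Q) = 0"
    by (rule N_zero_trans[OF _ _ _ 3]) (use assms 12 in \<open>auto simp: N_diff_commute[of _ "T s ?Q"]\<close>)
  then have "N ((1 / h) *\<^sub>R (T (s + h) P - T s P) - T s F) \<le> N (T s ?Q - T s F)"
    using N_triangle_diff[of "(1 / h) *\<^sub>R (T (s + h) P - T s P)" "T s ?Q" "T s F"] assms by simp
  also have "\<dots> \<le> N (?Q - F)" using assms by (intro N_T_diff_le) auto
  finally show ?thesis .
qed

lemma generator_limit:
  "P \<in> D \<Longrightarrow> ((\<lambda>h. N ((1 / h) *\<^sub>R (T h P - P) - A P)) \<longlongrightarrow> 0) (at_right 0)"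
  using generator[of P "A P"] by simp

text \<open>The difference quotients of \<open>T t P\<close>, compared with
  \<open>T t (A P)\<close>, are dominated by those of \<open>P\<close> compared with
  \<open>A P\<close>. The equivalence in \<open>generator\<close> then gives membership and value
  together.\<close>

lemma T_domain:
  assumes P: "P \<in> D" and t: "t \<ge> 0"
  shows "T t P \<in> D" and "N (A (T t P) - T t (A P)) = 0"
proof -
  have X: "T t P \<in> X" "T t (A P) \<in> X" using P t by auto
  have "((\<lambda>h. N ((1 / h) *\<^sub>R (T h (T t P) - T t P) - T t (A P))) \<longlongrightarrow> 0) (at_right 0)"
  proof (rule tendsto_sandwich[OF _ _ tendsto_const generator_limit[OF P]])
    show "\<forall>\<^sub>F h in at_right 0. 0 \<le> N ((1 / h) *\<^sub>R (T h (T t P) - T t P) - T t (A P))"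
      using X by (auto simp: eventually_at_filter)
    have "N ((1 / h) *\<^sub>R (T h (T t P) - T t P) - T t (A P)) \<le> N ((1 / h) *\<^sub>R (T h P - P) - A P)"
      if h: "h > 0" for h
    proof -
      \<comment> \<open>The quotient involves \<open>T h (T t P)\<close>, while
        \<open>N_T_quotient\<close> speaks of \<open>T (t + h) P\<close>; the two agree up to a null
        error.\<close>
      have "N (T (h + t) P - T h (T t P)) = 0" using h t P by (intro T_plus) auto
      then have "N ((1 / h) *\<^sub>R (T h (T t P) - T (t + h) P)) = 0"
        using h t P by (subst N_scale) (auto simp: N_diff_commute[of "T h (T t P)"] add.commute)
      moreover have "(1 / h) *\<^sub>R (T h (T t P) - T (t + h) P) = ((1 / h) *\<^sub>R (T h (T t P) - T t P) - T t (A P))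
           - ((1 / h) *\<^sub>R (T (t + h) P - T t P) - T t (A P))" by (simp add: scaleR_diff_right)
      ultimately have "N ((1 / h) *\<^sub>R (T h (T t P) - T t P) - T t (A P))
          = N ((1 / h) *\<^sub>R (T (t + h) P - T t P) - T t (A P))"
        using h t P by (intro N_cong) auto
      also have "\<dots> \<le> N ((1 / h) *\<^sub>R (T h P - P) - A P)"
        using h t P by (intro N_T_quotient) auto
      finally show ?thesis .
    qed
    then show "\<forall>\<^sub>F h in at_right 0. N ((1 / h) *\<^sub>R (T h (T t P) - T t P) - T t (A P))
        \<le> N ((1 / h) *\<^sub>R (T h P - P) - A P)"
      by (auto simp: eventually_at_filter)
  qed
  then have "T t P \<in> D \<and> N (T t (A P) - A (T t P)) = 0"
    using generator[of "T t P" "T t (A P)"] X by simp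
  then show "T t P \<in> D" "N (A (T t P) - T t (A P)) = 0"
    using X N_diff_commute[of "T t (A P)" "A (T t P)"] by auto
qed

lemma N_A_T_le: "P \<in> D \<Longrightarrow> t \<ge> 0 \<Longrightarrow> N (A (T t P)) \<le> N (A P)"
  using N_cong[OF _ _ T_domain(2)] T_domain(1) T_contr[of t "A P"] by simp

text \<open>By contractivity the increment between two times is bounded by the increment from time 0
  over the same length, whichever time is earlier, so right continuity at 0 gives two-sided
  continuity.\<close>

lemma T_continuous:
  assumes P: "P \<in> X" and t: "t \<ge> 0"
  shows "((\<lambda>s. N (T s P - T t P)) \<longlongrightarrow> 0) (at t within {0..})"
proof (rule tendstoI)
  fix e :: real assume "e > 0"
  then have "\<forall>\<^sub>F h in at_right 0. dist (N (T h P - P)) 0 < e"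
    using T_cont0[OF P] by (intro tendstoD) auto
  then obtain d where d: "d > 0" "\<And>h. 0 < h \<Longrightarrow> h < d \<Longrightarrow> \<bar>N (T h P - P)\<bar> < e"
    by (auto simp: eventually_at_right_field dist_real_def)
  have "dist (N (T s P - T t P)) 0 < e" if s: "s \<ge> 0" "s \<noteq> t" "dist s t < d" for s
  proof (cases "s > t")
    case True
    then show ?thesis using N_T_shift[of t "s - t" P] d(2)[of "s - t"] s P t
      by (simp add: dist_real_def)
  next
    case False
    then show ?thesis using N_T_shift[of s "t - s" P] d(2)[of "t - s"] s P t N_diff_commute[of "T s P" "T t P"]
      by (simp add: dist_real_def)
  qed
  then show "\<forall>\<^sub>F s in at t within {0..}. dist (N (T s P - T t P)) 0 < e"
    using d(1) by (auto simp: eventually_at)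
qed

text \<open>The generator gives only a right derivative at 0. A left quotient at \<open>t\<close> is
  a right quotient at the earlier time \<open>s\<close>; it is close to \<open>T s (A P)\<close>,
  and continuity of that orbit moves the limit to \<open>T t (A P)\<close>.\<close>

lemma T_derivative:
  assumes P: "P \<in> D" and t: "t \<ge> 0"
  shows "((\<lambda>s. N ((1 / (s - t)) *\<^sub>R (T s P - T t P) - A (T t P))) \<longlongrightarrow> 0) (at t within {0..})"
proof (rule tendstoI)
  fix e :: real assume e: "e > 0"
  have PX: "P \<in> X" "A P \<in> X" and TD: "T t P \<in> D" "A (T t P) \<in> X"
    using P T_domain(1)[OF P t] by auto
  have "\<forall>\<^sub>F h in at_right 0. dist (N ((1 / h) *\<^sub>R (T h P - P) - A P)) 0 < e / 2"
    using generator_limit[OF P] e by (intro tendstoD) auto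
  then obtain d where d: "d > 0"
    and d_abs: "\<And>h. 0 < h \<Longrightarrow> h < d \<Longrightarrow> \<bar>N ((1 / h) *\<^sub>R (T h P - P) - A P)\<bar> < e / 2"
    unfolding eventually_at_right_field dist_real_def by auto
  have d_less: "N ((1 / h) *\<^sub>R (T h P - P) - A P) < e / 2" if "0 < h" "h < d" for h
    using d_abs[OF that] by (rule le_less_trans[OF abs_ge_self])
  have "\<forall>\<^sub>F s in at t within {0..}. dist (N (T s (A P) - T t (A P))) 0 < e / 2"
    using T_continuous[OF PX(2) t] e by (intro tendstoD) auto
  then obtain d' where d': "d' > 0"
    and d'_abs: "\<And>s. s \<ge> 0 \<Longrightarrow> s \<noteq> t \<Longrightarrow> dist s t < d' \<Longrightarrow> \<bar>N (T s (A P) - T t (A P))\<bar> < e / 2"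
    unfolding eventually_at by (auto simp: dist_real_def)
  have d'_less: "N (T s (A P) - T t (A P)) < e / 2" if "s \<ge> 0" "s \<noteq> t" "dist s t < d'" for s
    using d'_abs[OF that] by (rule le_less_trans[OF abs_ge_self])
  have "dist (N ((1 / (s - t)) *\<^sub>R (T s P - T t P) - A (T t P))) 0 < e"
    if s: "s \<ge> 0" "s \<noteq> t" "dist s t < min d d'" for s
  proof -
    define Y where "Y = (1 / (s - t)) *\<^sub>R (T s P - T t P)"
    have Y: "Y \<in> X" using s t PX by (simp add: Y_def)
    have "N (Y - T t (A P)) < e"
    proof (cases "s > t")
      case True
      then have "N (Y - T t (A P)) \<le> N ((1 / (s - t)) *\<^sub>R (T (s - t) P - P) - A P)"
        using N_T_quotient[of t "s - t" P "A P"] t PX by (simp add: Y_def)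
      also have "\<dots> < e / 2" using True s by (intro d_less) (auto simp: dist_real_def)
      finally show ?thesis using e by simp
    next
      case False
      \<comment> \<open>Reverses both signs, so that the quotient has its base point at the earlier
        time \<open>s\<close>.\<close>
      have "Y = (1 / (t - s)) *\<^sub>R (T t P - T s P)"
      proof -
        have "1 / (s - t) = - (1 / (t - s))" by (metis minus_diff_eq minus_divide_right)
        then have "Y = - ((1 / (t - s)) *\<^sub>R (T s P - T t P))" by (simp only: Y_def scaleR_minus_left)
        then show ?thesis by (simp only: minus_diff_eq flip: scaleR_minus_right)
      qed
      then have "N (Y - T s (A P)) \<le> N ((1 / (t - s)) *\<^sub>R (T (t - s) P - P) - A P)"
        using False N_T_quotient[of s "t - s" P "A P"] s PX by simp
      also have "\<dots> < e / 2" using False s by (intro d_less) (auto simp: dist_real_def)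
      finally have "N (Y - T s (A P)) < e / 2" .
      moreover have "N (T s (A P) - T t (A P)) < e / 2" using s by (intro d'_less) auto
      ultimately show ?thesis
        using N_triangle_diff[of Y "T s (A P)" "T t (A P)"] Y PX s t by simp
    qed
    moreover have "N (Y - A (T t P)) \<le> N (Y - T t (A P)) + N (T t (A P) - A (T t P))"
      using Y PX TD t by (intro N_triangle_diff) auto
    moreover have "N (T t (A P) - A (T t P)) = 0"
      using T_domain(2)[OF P t] PX TD t by (simp add: N_diff_commute[of "T t (A P)"])
    moreover have "N (Y - A (T t P)) \<ge> 0" using Y TD by simp
    ultimately show ?thesis by (simp add: Y_def)
  qed
  then show "\<forall>\<^sub>F s in at t within {0..}. dist (N ((1 / (s - t)) *\<^sub>R (T s P - T t P) - A (T t P))) 0 < e"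
    using d d' by (auto simp: eventually_at intro!: exI[of _ "min d d'"])
qed

lemma bform_has_derivative:
  assumes b: "bform b" and P: "P \<in> D" and t: "t \<ge> 0"
  shows "((\<lambda>s. b (T s P) (T s P)) has_real_derivative
    b (A (T t P)) (T t P) + b (T t P) (A (T t P))) (at t within {0..})"
proof -
  obtain K where K: "K \<ge> 0" "\<And>P Q. P \<in> X \<Longrightarrow> Q \<in> X \<Longrightarrow> \<bar>b P Q\<bar> \<le> K * N P * N Q"
    using b unfolding bform_def by blast
  have b_add1: "\<And>P P' Q. P \<in> X \<Longrightarrow> P' \<in> X \<Longrightarrow> Q \<in> X \<Longrightarrow> b (P + P') Q = b P Q + b P' Q"
    and b_add2: "\<And>P Q Q'. P \<in> X \<Longrightarrow> Q \<in> X \<Longrightarrow> Q' \<in> X \<Longrightarrow> b P (Q + Q') = b P Q + b P Q'"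
    and b_scale: "\<And>r P Q. P \<in> X \<Longrightarrow> Q \<in> X \<Longrightarrow> b (r *\<^sub>R P) Q = r * b P Q"
    "\<And>r P Q. P \<in> X \<Longrightarrow> Q \<in> X \<Longrightarrow> b P (r *\<^sub>R Q) = r * b P Q"
    using b unfolding bform_def by auto
  have b_diff1: "b (P - P') Q = b P Q - b P' Q" and b_diff2: "b Q (P - P') = b Q P - b Q P'"
    if "P \<in> X" "P' \<in> X" "Q \<in> X" for P P' Q
    using b_add1[of "P - P'" P' Q] b_add2[of Q "P - P'" P'] that by auto
  define x a where "x = T t P" and "a = A (T t P)"
  have xa: "x \<in> X" "a \<in> X" using T_domain(1)[OF P t] P t by (auto simp: x_def a_def)
  let ?q = "\<lambda>s. (1 / (s - t)) *\<^sub>R (T s P - x)"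
  let ?F = "at t within {0..}"
  have lim1: "((\<lambda>s. N (?q s - a)) \<longlongrightarrow> 0) ?F"
    using T_derivative[OF P t] by (simp add: x_def a_def)
  have lim2: "((\<lambda>s. N (T s P - x)) \<longlongrightarrow> 0) ?F"
    using T_continuous[of P t] P t by (simp add: x_def)
  have ev: "\<forall>\<^sub>F s in ?F. s \<ge> 0 \<and> s \<noteq> t" by (auto simp: eventually_at_filter)
  have "((\<lambda>s. (b (T s P) (T s P) - b x x) / (s - t) - (b a x + b x a)) \<longlongrightarrow> 0) ?F"
  proof (rule Lim_null_comparison)
    show "((\<lambda>s. K * N (?q s - a) * (N x + N (T s P - x)) + K * N a * N (T s P - x) + K * N x * N (?q s - a)) \<longlongrightarrow> 0) ?F"
      by (auto intro!: tendsto_eq_intros lim1 lim2)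
    show "\<forall>\<^sub>F s in ?F. norm ((b (T s P) (T s P) - b x x) / (s - t) - (b a x + b x a))
        \<le> K * N (?q s - a) * (N x + N (T s P - x)) + K * N a * N (T s P - x) + K * N x * N (?q s - a)"
      using ev
    proof eventually_elim
      case (elim s)
      define y where "y = T s P"
      have y: "y \<in> X" using elim P by (simp add: y_def)
      define q where "q = (1 / (s - t)) *\<^sub>R (y - x)"
      have q: "q \<in> X" using y xa by (simp add: q_def)
      have "(b y y - b x x) / (s - t) = b q y + b x q"
        using y xa by (simp add: q_def b_scale b_diff1 b_diff2 diff_divide_distrib)
      \<comment> \<open>Product rule with three error terms, each containing one factor that tends
        to 0: \<open>q - a\<close> twice and \<open>y - x\<close> once.\<close>
      then have "(b y y - b x x) / (s - t) - (b a x + b x a) = b (q - a) y + b a (y - x) + b x (q - a)"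
        using y xa q by (simp add: b_diff1 b_diff2)
      also have "norm \<dots> \<le> \<bar>b (q - a) y\<bar> + \<bar>b a (y - x)\<bar> + \<bar>b x (q - a)\<bar>" by simp
      also have "\<dots> \<le> K * N (q - a) * N y + K * N a * N (y - x) + K * N x * N (q - a)"
        using y xa q by (intro add_mono K) auto
      also have "\<dots> \<le> K * N (q - a) * (N x + N (y - x)) + K * N a * N (y - x) + K * N x * N (q - a)"
        using y xa q N_le_add_diff[of y x] K(1) by (intro add_right_mono mult_left_mono) auto
      finally show ?case by (simp add: y_def q_def)
    qed
  qed
  then have "((\<lambda>s. (b (T s P) (T s P) - b x x) / (s - t)) \<longlongrightarrow> b a x + b x a) ?F"
    by (simp add: LIM_zero_iff)
  then show ?thesis by (simp add: has_field_derivative_iff x_def a_def)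
qed

text \<open>The derivative is bounded uniformly in time because
  \<open>N (A (T t P)) \<le> N (A P)\<close>; this is where the initial state has to lie in
  \<open>D\<close>.\<close>

lemma bform_lipschitz:
  assumes b: "bform b" and P: "P \<in> D"
  obtains L where "\<And>s t. 0 < s \<Longrightarrow> s \<le> t \<Longrightarrow> \<bar>b (T t P) (T t P) - b (T s P) (T s P)\<bar> \<le> L * (t - s)"
proof -
  obtain K where K: "K \<ge> 0" "\<And>P Q. P \<in> X \<Longrightarrow> Q \<in> X \<Longrightarrow> \<bar>b P Q\<bar> \<le> K * N P * N Q"
    using b unfolding bform_def by blast
  let ?d = "\<lambda>t. b (A (T t P)) (T t P) + b (T t P) (A (T t P))"
  have bound: "\<bar>?d t\<bar> \<le> 2 * K * N (A P) * N P" if "t \<ge> 0" for t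
  proof -
    have D: "T t P \<in> D" using T_domain(1) P that by auto
    have "\<bar>?d t\<bar> \<le> K * N (A (T t P)) * N (T t P) + K * N (T t P) * N (A (T t P))"
      using D by (intro order_trans[OF abs_triangle_ineq] add_mono K(2)) auto
    also have "\<dots> = 2 * K * (N (A (T t P)) * N (T t P))" by simp
    also have "\<dots> \<le> 2 * K * (N (A P) * N P)"
      using K(1) D P that by (intro mult_left_mono mult_mono N_A_T_le T_contr) auto
    finally show ?thesis by (simp add: mult_ac)
  qed
  show ?thesis
  proof
    fix s t :: real assume s: "0 < s" "s \<le> t"
    show "\<bar>b (T t P) (T t P) - b (T s P) (T s P)\<bar> \<le> (2 * K * N (A P) * N P) * (t - s)"
    proof (cases "s = t")
      case False
      have "\<exists>z>s. z < t \<and> b (T t P) (T t P) - b (T s P) (T s P) = (t - s) * ?d z"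
      proof (rule MVT2)
        fix z assume "s \<le> z" "z \<le> t"
        then show "((\<lambda>s. b (T s P) (T s P)) has_real_derivative ?d z) (at z)"
          using bform_has_derivative[OF b P, of z] at_within_interior[of z "{0..}"] s by simp
      qed (use s False in auto)
      then obtain z where z: "z > s" "b (T t P) (T t P) - b (T s P) (T s P) = (t - s) * ?d z" by auto
      have "\<bar>(t - s) * ?d z\<bar> \<le> (t - s) * (2 * K * N (A P) * N P)"
        unfolding abs_mult using bound[of z] z s by (intro mult_mono) auto
      then show ?thesis using z by (simp add: mult.commute)
    qed auto
  qed
qed

text \<open>The derivative along the trajectory is an algebraic expression in \<open>A\<close>, so
  each later decay proof reduces to one inequality at a single state.\<close>

lemma bform_barbalat:
  assumes c: "bform c" and q: "bform q" and P: "P \<in> D"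
    and le: "\<And>t. t > 0 \<Longrightarrow> c (A (T t P)) (T t P) + c (T t P) (A (T t P)) \<le> r t - q (T t P) (T t P)"
    and lim: "((\<lambda>t. c (T t P) (T t P)) \<longlongrightarrow> l) at_top" and r: "(r \<longlongrightarrow> 0) at_top"
    and nonneg: "\<And>Q. Q \<in> X \<Longrightarrow> q Q Q \<ge> 0"
  shows "((\<lambda>t. q (T t P) (T t P)) \<longlongrightarrow> 0) at_top"
proof -
  obtain L where L: "\<And>s t. 0 < s \<Longrightarrow> s \<le> t \<Longrightarrow> \<bar>q (T t P) (T t P) - q (T s P) (T s P)\<bar> \<le> L * (t - s)"
    using bform_lipschitz[OF q P] by blast
  show ?thesis
  proof (rule barbalat[OF _ le lim r L])
    fix t :: real assume "t > 0"
    then show "((\<lambda>s. c (T s P) (T s P)) has_real_derivative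
        c (A (T t P)) (T t P) + c (T t P) (A (T t P))) (at t)"
      using bform_has_derivative[OF c P, of t] at_within_interior[of t "{0..}"] by simp
  qed (use P nonneg in auto)
qed

lemma energy_convergent:
  assumes P: "P \<in> X"
  obtains l where "((\<lambda>t. B (T t P) (T t P)) \<longlongrightarrow> l) at_top"
proof -
  have mono: "N (T t P) \<le> N (T s P)" if "0 \<le> s" "s \<le> t" for s t
  proof -
    have "N (T ((t - s) + s) P - T (t - s) (T s P)) = 0" using that P by (intro T_plus) auto
    then have "N (T t P) = N (T (t - s) (T s P))" using that P by (intro N_cong) auto
    also have "\<dots> \<le> N (T s P)" using that P by (intro T_contr) auto
    finally show ?thesis .
  qed
  \<comment> \<open>Nothing is known about \<open>T\<close> at negative times; freezing the state
    there makes the energy antitone on the whole line.\<close>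
  let ?f = "\<lambda>t. B (T (max 0 t) P) (T (max 0 t) P)"
  have anti: "?f t \<le> ?f s" if "s \<le> t" for s t
  proof -
    have "(N (T (max 0 t) P))\<^sup>2 \<le> (N (T (max 0 s) P))\<^sup>2"
      using that P by (intro power_mono mono) auto
    then show ?thesis using P by (simp add: N_sq)
  qed
  have "\<exists>l. (?f \<longlongrightarrow> l) at_top"
  proof -
    define l where "l = Inf (range ?f)"
    have bdd: "bdd_below (range ?f)" using P by (auto intro!: bdd_belowI[of _ 0] B_nonneg)
    have "(?f \<longlongrightarrow> l) at_top"
    proof (rule order_tendstoI)
      fix a assume "a < l"
      then show "\<forall>\<^sub>F x in at_top. a < ?f x"
        using cInf_lower[OF rangeI bdd] unfolding l_def by (intro always_eventually allI) (rule less_le_trans)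
    next
      fix a assume "l < a"
      then obtain s where "?f s < a" using cInf_lessD[of "range ?f" a] by (auto simp: l_def)
      then have "\<And>t. t \<ge> s \<Longrightarrow> ?f t < a" using anti by (meson le_less_trans)
      then show "\<forall>\<^sub>F x in at_top. ?f x < a" unfolding eventually_at_top_linorder by blast
    qed
    then show ?thesis ..
  qed
  then obtain l where l: "(?f \<longlongrightarrow> l) at_top" by blast
  have "\<forall>\<^sub>F t in at_top. ?f t = B (T t P) (T t P)"
    using eventually_ge_at_top[of 0] by eventually_elim auto
  from tendsto_cong[OF this] l have "((\<lambda>t. B (T t P) (T t P)) \<longlongrightarrow> l) at_top" by simp
  then show thesis by (rule that)
qed

lemma stable_of_dense:
  assumes dense: "\<And>P e. P \<in> X \<Longrightarrow> e > 0 \<Longrightarrow> \<exists>Q\<in>D. N (P - Q) < e"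
    and D: "\<And>Q. Q \<in> D \<Longrightarrow> ((\<lambda>t. N (T t Q)) \<longlongrightarrow> 0) at_top"
    and P: "P \<in> X"
  shows "((\<lambda>t. N (T t P)) \<longlongrightarrow> 0) at_top"
proof (rule tendstoI)
  fix e :: real assume e: "e > 0"
  obtain Q where Q: "Q \<in> D" "N (P - Q) < e / 2" using dense[OF P, of "e / 2"] e by auto
  have "\<forall>\<^sub>F t in at_top. dist (N (T t Q)) 0 < e / 2" using D[OF Q(1)] e by (intro tendstoD) auto
  then show "\<forall>\<^sub>F t in at_top. dist (N (T t P)) 0 < e"
    using eventually_ge_at_top[of 0]
  proof eventually_elim
    case (elim t)
    have "N (T t P) \<le> N (T t Q) + N (T t P - T t Q)" using elim P Q by (intro N_le_add_diff) auto
    also have "N (T t P - T t Q) \<le> N (P - Q)" using elim P Q by (intro N_T_diff_le) auto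
    finally show ?case using elim Q P by simp
  qed
qed

end

section \<open>Square integrable functions\<close>

text \<open>One notion for three measures: on the domain, on the frequency line, and on their
  product.\<close>

definition l2 :: "'a measure \<Rightarrow> ('a \<Rightarrow> complex) set" where
  "l2 M = {f \<in> borel_measurable M. integrable M (\<lambda>x. (cmod (f x))\<^sup>2)}"

text \<open>\<open>\<bullet>\<close> on complex numbers is the real part of the Hermitian product,
  so \<open>ip\<close> is the real part of the usual inner product and symmetric.\<close>

definition ip :: "'a measure \<Rightarrow> ('a \<Rightarrow> complex) \<Rightarrow> ('a \<Rightarrow> complex) \<Rightarrow> real" where
  "ip M f g = (LINT x|M. f x \<bullet> g x)"

definition nrm :: "'a measure \<Rightarrow> ('a \<Rightarrow> complex) \<Rightarrow> real" where
  "nrm M f = sqrt (ip M f f)"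

lemma l2_measurable: "f \<in> l2 M \<Longrightarrow> f \<in> borel_measurable M"
  and l2_integrable_square: "f \<in> l2 M \<Longrightarrow> integrable M (\<lambda>x. (cmod (f x))\<^sup>2)"
  by (auto simp: l2_def)

lemma two_mult_le_sum_squares: "2 * (a * b) \<le> a\<^sup>2 + (b\<^sup>2 :: real)"
  using zero_le_power2[of "a - b"] by (simp add: power2_diff)

lemma l2_integrable_bilinear:
  fixes h :: "'a \<Rightarrow> 'b::{banach, second_countable_topology}"
  assumes f: "f \<in> l2 M" and g: "g \<in> l2 M" and h: "h \<in> borel_measurable M"
    and le: "\<And>x. norm (h x) \<le> cmod (f x) * cmod (g x)"
  shows "integrable M h"
proof (rule Bochner_Integration.integrable_bound[OF _ h])
  show "integrable M (\<lambda>x. (cmod (f x))\<^sup>2 + (cmod (g x))\<^sup>2)"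
    using f g by (intro Bochner_Integration.integrable_add l2_integrable_square)
  have "norm (h x) \<le> (cmod (f x))\<^sup>2 + (cmod (g x))\<^sup>2" for x
    using le[of x] two_mult_le_sum_squares[of "cmod (f x)" "cmod (g x)"]
      mult_nonneg_nonneg[of "cmod (f x)" "cmod (g x)"] by (auto simp del: mult_nonneg_nonneg)
  then show "AE x in M. norm (h x) \<le> norm ((cmod (f x))\<^sup>2 + (cmod (g x))\<^sup>2)" by auto
qed

lemma l2_integrable_inner: "f \<in> l2 M \<Longrightarrow> g \<in> l2 M \<Longrightarrow> integrable M (\<lambda>x. f x \<bullet> g x)"
  by (rule l2_integrable_bilinear[of f M g])
    (auto intro: Cauchy_Schwarz_ineq2 borel_measurable_inner dest: l2_measurable)

lemma l2_integrable_mult: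
  assumes f: "f \<in> l2 M" and g: "g \<in> l2 M"
  shows "integrable M (\<lambda>x. f x * g x)"
  using borel_measurable_times[OF l2_measurable[OF f] l2_measurable[OF g]]
  by (rule l2_integrable_bilinear[OF f g]) (simp add: norm_mult)

lemma l2_bounded_by:
  assumes "f \<in> borel_measurable M" and "g \<in> l2 M" and "AE x in M. cmod (f x) \<le> cmod (g x)"
  shows "f \<in> l2 M"
proof -
  have "integrable M (\<lambda>x. (cmod (f x))\<^sup>2)"
    by (rule Bochner_Integration.integrable_bound[OF l2_integrable_square[OF assms(2)]])
      (use assms in \<open>auto intro: power_mono\<close>)
  then show ?thesis using assms by (auto simp: l2_def)
qed

lemma l2_zero: "(\<lambda>x. 0) \<in> l2 M"
  by (simp add: l2_def)

lemma l2_add: "f \<in> l2 M \<Longrightarrow> g \<in> l2 M \<Longrightarrow> (\<lambda>x. f x + g x) \<in> l2 M"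
proof -
  assume f: "f \<in> l2 M" and g: "g \<in> l2 M"
  have "integrable M (\<lambda>x. (cmod (f x))\<^sup>2 + 2 * (f x \<bullet> g x) + (cmod (g x))\<^sup>2)"
    using f g by (intro Bochner_Integration.integrable_add integrable_mult_right l2_integrable_square
        l2_integrable_inner)
  moreover have "(cmod (f x))\<^sup>2 + 2 * (f x \<bullet> g x) + (cmod (g x))\<^sup>2 = (cmod (f x + g x))\<^sup>2" for x
    by (simp add: power2_norm_eq_inner algebra_simps inner_commute)
  ultimately show ?thesis using f g by (auto simp: l2_def)
qed

lemma l2_cmult: "f \<in> l2 M \<Longrightarrow> (\<lambda>x. c * f x) \<in> l2 M"
  by (auto simp: l2_def norm_mult power_mult_distrib)

lemma l2_scaleR: "f \<in> l2 M \<Longrightarrow> (\<lambda>x. r *\<^sub>R f x) \<in> l2 M"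
  using l2_cmult[of f M "of_real r"] by (simp add: scaleR_conv_of_real)

lemma l2_diff: "f \<in> l2 M \<Longrightarrow> g \<in> l2 M \<Longrightarrow> (\<lambda>x. f x - g x) \<in> l2 M"
  using l2_add[of f M "\<lambda>x. (-1) * g x"] l2_cmult[of g M "-1"] by simp

lemma l2_cnj: "f \<in> l2 M \<Longrightarrow> (\<lambda>x. cnj (f x)) \<in> l2 M"
  by (auto simp: l2_def intro!: borel_measurable_continuous_on[of cnj] continuous_intros)

lemma ip_self: "ip M f f = (LINT x|M. (cmod (f x))\<^sup>2)"
  by (simp add: ip_def power2_norm_eq_inner)

lemma ip_sym: "ip M f g = ip M g f"
  by (simp add: ip_def inner_commute)

global_interpretation l2: seminormed_subspace "l2 M" "ip M"
  rewrites "seminormed_subspace.N (ip M) = nrm M" for M :: "'a measure"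
proof -
  show *: "seminormed_subspace (l2 M) (ip M)"
  proof
    show "subspace (l2 M)"
      using l2_zero[of M] l2_add[of _ M] l2_scaleR[of _ M]
      by (auto simp: subspace_def plus_fun_def scaleR_fun_def zero_fun_def)
    show "ip M (f + f') g = ip M f g + ip M f' g"
      if "f \<in> l2 M" "f' \<in> l2 M" "g \<in> l2 M" for f f' g
      using that by (simp add: ip_def plus_fun_def inner_add_left l2_integrable_inner)
    show "ip M (r *\<^sub>R f) g = r * ip M f g" for f g r
      by (simp add: ip_def scaleR_fun_def)
    show "ip M f f \<ge> 0" for f
      by (simp add: ip_def)
  qed (rule ip_sym)
  show "seminormed_subspace.N (ip M) = nrm M"
    by (simp add: fun_eq_iff nrm_def seminormed_subspace.N_def[OF *])
qed

lemma nrm_nonneg [simp]: "nrm M f \<ge> 0"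
  by (simp add: nrm_def ip_self)

lemma nrm_eq: "nrm M f = sqrt (LINT x|M. (cmod (f x))\<^sup>2)"
  by (simp add: nrm_def ip_self)

lemma nrm_sq: "(nrm M f)\<^sup>2 = ip M f f"
  by (simp add: nrm_def ip_self)

lemma nrm_mono:
  assumes "f \<in> borel_measurable M" and g: "g \<in> l2 M" and le: "AE x in M. cmod (f x) \<le> cmod (g x)"
  shows "nrm M f \<le> nrm M g"
  unfolding nrm_eq
  using l2_bounded_by[OF assms] g le
  by (intro real_sqrt_le_mono integral_mono_AE l2_integrable_square) (auto intro: power_mono)

lemma nrm_cmult: "nrm M (\<lambda>x. c * f x) = cmod c * nrm M f"
  by (simp add: nrm_eq norm_mult power_mult_distrib real_sqrt_mult)

lemma ip_AE_cong:
  assumes "AE x in M. f x = f' x" "AE x in M. g x = g' x"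
    and "f \<in> borel_measurable M" "f' \<in> borel_measurable M" "g \<in> borel_measurable M" "g' \<in> borel_measurable M"
  shows "ip M f g = ip M f' g'"
  unfolding ip_def using assms
  by (intro integral_cong_AE borel_measurable_inner) (auto elim: eventually_elim2)

lemma nrm_AE_cong:
  assumes "AE x in M. f x = f' x" "f \<in> borel_measurable M" "f' \<in> borel_measurable M"
  shows "nrm M f = nrm M f'"
  unfolding nrm_def by (simp add: ip_AE_cong[OF assms(1,1,2,3,2,3)])

lemma l2_bounded_mult:
  assumes f: "f \<in> l2 M" and h: "h \<in> borel_measurable M" and b: "\<And>x. cmod (h x) \<le> C"
  shows "(\<lambda>x. h x * f x) \<in> l2 M" "nrm M (\<lambda>x. h x * f x) \<le> C * nrm M f"
proof -
  have C: "C \<ge> 0" using b[of undefined] norm_ge_zero[of "h undefined"] by linarith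
  have m: "(\<lambda>x. h x * f x) \<in> borel_measurable M" by (rule borel_measurable_times[OF h l2_measurable[OF f]])
  have le: "AE x in M. cmod (h x * f x) \<le> cmod (of_real C * f x)"
    using b C by (auto simp: norm_mult intro!: mult_right_mono)
  show "(\<lambda>x. h x * f x) \<in> l2 M" by (rule l2_bounded_by[OF m l2_cmult[OF f] le])
  show "nrm M (\<lambda>x. h x * f x) \<le> C * nrm M f"
    using nrm_mono[OF m l2_cmult[OF f] le] C by (simp add: nrm_cmult)
qed

text \<open>The limit inherits the domination, so the squared difference is at most
  \<open>(2 * cmod (g x))\<^sup>2\<close>, an integrable majorant.\<close>

lemma nrm_dominated_convergence:
  assumes f: "f \<in> borel_measurable M" and g: "g \<in> l2 M" and fn: "\<And>n. fn n \<in> borel_measurable M"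
    and le: "\<And>n. AE x in M. cmod (fn n x) \<le> cmod (g x)"
    and lim: "AE x in M. (\<lambda>n. fn n x) \<longlonglongrightarrow> f x"
  shows "(\<lambda>n. nrm M (\<lambda>x. f x - fn n x)) \<longlonglongrightarrow> 0"
proof -
  have "AE x in M. \<forall>n. cmod (fn n x) \<le> cmod (g x)" using le by (simp add: AE_all_countable)
  then have f_le: "AE x in M. cmod (f x) \<le> cmod (g x)"
    using lim by eventually_elim (rule Lim_norm_ubound[OF sequentially_bot], auto)
  have "(\<lambda>n. LINT x|M. (cmod (f x - fn n x))\<^sup>2) \<longlonglongrightarrow> (LINT x|M. 0)"
  proof (rule integral_dominated_convergence[where w = "\<lambda>x. 4 * (cmod (g x))\<^sup>2"])
    show "integrable M (\<lambda>x. 4 * (cmod (g x))\<^sup>2)" by (intro integrable_mult_right l2_integrable_square g)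
    show "AE x in M. (\<lambda>n. (cmod (f x - fn n x))\<^sup>2) \<longlonglongrightarrow> 0"
      using lim
    proof eventually_elim
      case (elim x)
      have "(\<lambda>n. (cmod (f x - fn n x))\<^sup>2) \<longlonglongrightarrow> (cmod (f x - f x))\<^sup>2"
        by (intro tendsto_intros elim)
      then show ?case by simp
    qed
    show "AE x in M. norm ((cmod (f x - fn n x))\<^sup>2) \<le> 4 * (cmod (g x))\<^sup>2" for n
      using le[of n] f_le
    proof eventually_elim
      case (elim x)
      have "cmod (f x - fn n x) \<le> 2 * cmod (g x)"
        using norm_triangle_ineq4[of "f x" "fn n x"] elim by linarith
      then have "(cmod (f x - fn n x))\<^sup>2 \<le> (2 * cmod (g x))\<^sup>2" by (intro power_mono) auto
      then show ?case by (simp add: power_mult_distrib)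
    qed
  qed (use f fn in auto)
  then show ?thesis using tendsto_real_sqrt by (fastforce simp: nrm_eq)
qed

lemma L2_eq_l2: "L2 \<Omega> = l2 (vol \<Omega>)"
  by (simp add: L2_def l2_def)

lemma L2_norm_eq_nrm: "L2_norm \<Omega> = nrm (vol \<Omega>)"
  by (simp add: fun_eq_iff L2_norm_def nrm_eq)

lemma inner_eq_Re_mult_cnj: "z \<bullet> w = Re (z * cnj w)"
  by (simp add: inner_complex_def)

lemma l2_integrable_mult_cnj: "f \<in> l2 M \<Longrightarrow> g \<in> l2 M \<Longrightarrow> integrable M (\<lambda>x. f x * cnj (g x))"
  by (intro l2_integrable_mult l2_cnj)

lemma Re_L2_inner:
  assumes "f \<in> L2 \<Omega>" "g \<in> L2 \<Omega>"
  shows "Re (L2_inner \<Omega> f g) = ip (vol \<Omega>) f g"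
  using assms unfolding L2_eq_l2
  by (simp add: L2_inner_def ip_def inner_eq_Re_mult_cnj l2_integrable_mult_cnj del: times_complex.sel complex_cnj)


section \<open>Diffusive variables as square integrable functions on the product of frequency line
  and domain\<close>

lemma pair_sigma_finite_lborel_vol:
  assumes "\<Omega> \<in> sets borel"
  shows "pair_sigma_finite lborel (vol \<Omega>)"
proof -
  have "sigma_finite_measure (vol \<Omega>)"
    using assms by (intro sigma_finite_measure_restrict_space) (auto intro: lborel.sigma_finite_measure_axioms)
  then show ?thesis
    by (simp add: pair_sigma_finite_def lborel.sigma_finite_measure_axioms)
qed

abbreviation cyl :: "R3 set \<Rightarrow> (real \<times> R3) measure" where
  "cyl \<Omega> \<equiv> lborel \<Otimes>\<^sub>M vol \<Omega>"

text \<open>Tonelli in one direction, Fubini in the other. From here on the diffusive variables obey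
  the same rules as scalar functions, with no vector-valued integration.\<close>

lemma L2L2_iff:
  assumes \<Omega>: "\<Omega> \<in> sets borel"
  shows "\<phi> \<in> L2L2 \<Omega> \<longleftrightarrow> case_prod \<phi> \<in> l2 (cyl \<Omega>)"
proof
  interpret pair_sigma_finite lborel "vol \<Omega>" by (rule pair_sigma_finite_lborel_vol[OF \<Omega>])
  have norm_sq: "(L2_norm \<Omega> (\<phi> \<xi>))\<^sup>2 = (LINT x|vol \<Omega>. (cmod (\<phi> \<xi> x))\<^sup>2)" for \<xi>
    by (simp add: L2_norm_def)
  {
    assume \<phi>: "\<phi> \<in> L2L2 \<Omega>"
    then have m: "case_prod \<phi> \<in> borel_measurable (cyl \<Omega>)" by (simp add: L2L2_def)
    have "integrable (cyl \<Omega>) (\<lambda>z. (cmod (case_prod \<phi> z))\<^sup>2)"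
    proof (rule Fubini_integrable)
      show "(\<lambda>z. (cmod (case_prod \<phi> z))\<^sup>2) \<in> borel_measurable (cyl \<Omega>)" using m by measurable
      show "integrable lborel (\<lambda>\<xi>. LINT x|vol \<Omega>. norm ((cmod (case_prod \<phi> (\<xi>, x)))\<^sup>2))"
        using \<phi> by (simp add: L2L2_def norm_sq)
      show "AE \<xi> in lborel. integrable (vol \<Omega>) (\<lambda>x. (cmod (case_prod \<phi> (\<xi>, x)))\<^sup>2)"
        using \<phi> by (simp add: L2L2_def L2_def)
    qed
    then show "case_prod \<phi> \<in> l2 (cyl \<Omega>)" using m by (simp add: l2_def)
  next
    assume \<phi>: "case_prod \<phi> \<in> l2 (cyl \<Omega>)"
    then have m: "case_prod \<phi> \<in> borel_measurable (cyl \<Omega>)"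
      and i: "integrable (cyl \<Omega>) (\<lambda>z. (cmod (case_prod \<phi> z))\<^sup>2)" by (auto simp: l2_def)
    have "\<phi> \<xi> \<in> borel_measurable (vol \<Omega>)" for \<xi>
      using measurable_Pair2[OF m, of \<xi>] by simp
    then have "AE \<xi> in lborel. \<phi> \<xi> \<in> L2 \<Omega>"
      using AE_integrable_fst'[OF i] by (simp add: L2_def)
    moreover have "integrable lborel (\<lambda>\<xi>. (L2_norm \<Omega> (\<phi> \<xi>))\<^sup>2)"
      using integrable_fst'[OF i] by (simp add: norm_sq)
    ultimately show "\<phi> \<in> L2L2 \<Omega>" using m by (simp add: L2L2_def)
  }
qed

lemma Re_L2L2_inner:
  assumes \<Omega>: "\<Omega> \<in> sets borel" and "\<phi> \<in> L2L2 \<Omega>" "\<theta> \<in> L2L2 \<Omega>"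
  shows "Re (L2L2_inner \<Omega> \<phi> \<theta>) = ip (cyl \<Omega>) (case_prod \<phi>) (case_prod \<theta>)"
proof -
  interpret pair_sigma_finite lborel "vol \<Omega>" by (rule pair_sigma_finite_lborel_vol[OF \<Omega>])
  have i: "integrable (cyl \<Omega>) (\<lambda>z. case_prod \<phi> z * cnj (case_prod \<theta> z))"
    using assms by (intro l2_integrable_mult_cnj) (auto simp: L2L2_iff[OF \<Omega>])
  have "L2L2_inner \<Omega> \<phi> \<theta> = (LINT z|cyl \<Omega>. case_prod \<phi> z * cnj (case_prod \<theta> z))"
    using integral_fst'[OF i] by (simp add: L2L2_inner_def L2_inner_def)
  then show ?thesis using i
    by (simp add: ip_def inner_eq_Re_mult_cnj del: times_complex.sel complex_cnj)
qed

lemma tensor_l2: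
  fixes a :: "real \<Rightarrow> real"
  assumes \<Omega>: "\<Omega> \<in> sets borel" and a: "a \<in> borel_measurable borel" "integrable lborel (\<lambda>\<xi>. (a \<xi>)\<^sup>2)"
    and f: "f \<in> l2 (vol \<Omega>)"
  shows "(\<lambda>(\<xi>, x). of_real (a \<xi>) * f x) \<in> l2 (cyl \<Omega>)"
    "ip (cyl \<Omega>) (\<lambda>(\<xi>, x). of_real (a \<xi>) * f x) (\<lambda>(\<xi>, x). of_real (a \<xi>) * f x)
       = (LINT \<xi>|lborel. (a \<xi>)\<^sup>2) * ip (vol \<Omega>) f f"
proof -
  interpret pair_sigma_finite lborel "vol \<Omega>" by (rule pair_sigma_finite_lborel_vol[OF \<Omega>])
  have [measurable]: "f \<in> borel_measurable (vol \<Omega>)" "a \<in> borel_measurable borel"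
    using a l2_measurable[OF f] by auto
  have m: "(\<lambda>(\<xi>, x). of_real (a \<xi>) * f x) \<in> borel_measurable (cyl \<Omega>)" by measurable
  have i: "integrable (cyl \<Omega>) (\<lambda>(\<xi>, x). (a \<xi>)\<^sup>2 * (cmod (f x))\<^sup>2)"
  proof (rule Fubini_integrable)
    show "integrable lborel (\<lambda>\<xi>. LINT x|vol \<Omega>. norm (case (\<xi>, x) of (\<xi>, x) \<Rightarrow> (a \<xi>)\<^sup>2 * (cmod (f x))\<^sup>2))"
      using a by (simp add: abs_mult)
  qed (use l2_integrable_square[OF f] in auto)
  have eq: "(cmod (case z of (\<xi>, x) \<Rightarrow> of_real (a \<xi>) * f x))\<^sup>2 = (case z of (\<xi>, x) \<Rightarrow> (a \<xi>)\<^sup>2 * (cmod (f x))\<^sup>2)" for z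
    by (auto simp: norm_mult power_mult_distrib split: prod.split)
  show "(\<lambda>(\<xi>, x). of_real (a \<xi>) * f x) \<in> l2 (cyl \<Omega>)"
    unfolding l2_def mem_Collect_eq eq using m i by blast
  show "ip (cyl \<Omega>) (\<lambda>(\<xi>, x). of_real (a \<xi>) * f x) (\<lambda>(\<xi>, x). of_real (a \<xi>) * f x)
       = (LINT \<xi>|lborel. (a \<xi>)\<^sup>2) * ip (vol \<Omega>) f f"
    unfolding ip_self eq using integral_fst'[OF i] by simp
qed

section \<open>Test functions\<close>

lemma frechet_derivative_eqI: "(f has_derivative f') (at x) \<Longrightarrow> frechet_derivative f (at x) = f'"
  by (rule frechet_derivative_at[symmetric])

lemma smooth_on_differentiable: "smooth_on UNIV f \<Longrightarrow> f differentiable (at x)"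
  unfolding smooth_on_def by (drule spec[of _ "Suc 0"]) (simp add: differentiable_on_def)

lemma smooth_on_derivative:
  "smooth_on UNIV f \<Longrightarrow> b \<in> Basis \<Longrightarrow> smooth_on UNIV (\<lambda>x. frechet_derivative f (at x) b)"
  unfolding smooth_on_def by (metis Ck_on.simps(2))

text \<open>Smoothness is obtained from a family closed under partial derivatives, so no formulas
  for higher derivatives of products or compositions are required.\<close>

lemma smooth_on_coinduct:
  assumes f: "f \<in> F"
    and step: "\<And>f. f \<in> F \<Longrightarrow> \<exists>f'. (\<forall>x. (f has_derivative f' x) (at x)) \<and> (\<forall>b\<in>Basis. (\<lambda>x. f' x b) \<in> F)"
  shows "smooth_on UNIV f"
proof -
  have "\<forall>f\<in>F. Ck_on k UNIV f" for k
  proof (induction k)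
    case 0
    show ?case
    proof
      fix f assume "f \<in> F"
      then obtain f' where "\<And>x. (f has_derivative f' x) (at x)" using step by blast
      then show "Ck_on 0 UNIV f" by (auto intro: has_derivative_continuous_on)
    qed
  next
    case (Suc k)
    show ?case
    proof
      fix f assume "f \<in> F"
      then obtain f' where f': "\<And>x. (f has_derivative f' x) (at x)" "\<forall>b\<in>Basis. (\<lambda>x. f' x b) \<in> F"
        using step by blast
      have "frechet_derivative f (at x) = f' x" for x by (rule frechet_derivative_eqI[OF f'(1)])
      then show "Ck_on (Suc k) UNIV f"
        using f' Suc by (auto simp: differentiable_on_def intro: differentiableI)
    qed
  qed
  then show ?thesis using f by (simp add: smooth_on_def)
qed

text \<open>\<open>s\<^sup>-\<^sup>k exp (-1/s)\<close> for \<open>s > 0\<close>; this family, unlike the single function \<open>exp (-1/s)\<close>, has its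
  derivatives in its span.\<close>
definition bump :: "nat \<Rightarrow> real \<Rightarrow> real" where
  "bump k s = (if s > 0 then (1 / s) ^ k / exp (1 / s) else 0)"

lemma bump_tendsto_0: "(bump k \<longlongrightarrow> 0) (at_right 0)"
proof -
  have "((\<lambda>s. inverse s ^ k / exp (inverse s)) \<longlongrightarrow> (0::real)) (at_right 0)"
    by (rule filterlim_compose[OF tendsto_power_div_exp_0 filterlim_inverse_at_top_right])
  moreover have "\<forall>\<^sub>F s in at_right 0. inverse s ^ k / exp (inverse s) = bump k s"
    by (auto simp: eventually_at_filter bump_def inverse_eq_divide)
  ultimately show ?thesis using tendsto_cong by fast
qed

lemma bump_has_derivative:
  "(bump k has_real_derivative bump (k + 2) s - real k * bump (k + 1) s) (at s)"
proof -
  consider "s > 0" | "s < 0" | "s = 0" by linarith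
  then show ?thesis
  proof cases
    case 1
    define y where "y = inverse s"
    have "((\<lambda>s. inverse s ^ k * exp (- inverse s)) has_real_derivative
        real k * y ^ (k - 1) * (- y\<^sup>2) * exp (- y) + y ^ k * (exp (- y) * y\<^sup>2)) (at s)"
      using 1 by (auto intro!: derivative_eq_intros simp: y_def power2_eq_square)
    also have "real k * y ^ (k - 1) * (- y\<^sup>2) * exp (- y) + y ^ k * (exp (- y) * y\<^sup>2)
        = bump (k + 2) s - real k * bump (k + 1) s"
      using 1 by (cases k) (simp_all add: bump_def y_def divide_inverse exp_minus power2_eq_square algebra_simps)
    finally have "((\<lambda>s. inverse s ^ k / exp (inverse s)) has_real_derivative
        bump (k + 2) s - real k * bump (k + 1) s) (at s)"
      by (simp add: exp_minus divide_inverse)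
    moreover have "\<forall>\<^sub>F s in nhds s. inverse s ^ k / exp (inverse s) = bump k s"
      using 1 eventually_nhds_in_open[of "{0<..}" s]
      by (auto simp: bump_def inverse_eq_divide elim: eventually_mono)
    ultimately show ?thesis by (subst DERIV_cong_ev[OF refl _ refl, symmetric])
  next
    case 2
    have "\<forall>\<^sub>F s in nhds s. bump k s = 0"
      using 2 eventually_nhds_in_open[of "{..<0}" s] by (auto simp: bump_def elim: eventually_mono)
    then show ?thesis using 2 by (subst DERIV_cong_ev[OF refl _ refl]) (auto simp: bump_def)
  next
    case 3
    have "(bump (k + 1) \<longlongrightarrow> 0) (at_left 0)"
      by (rule tendsto_eventually) (auto simp: eventually_at_filter bump_def)
    then have "(bump (k + 1) \<longlongrightarrow> 0) (at 0)"
      using bump_tendsto_0 by (intro filterlim_split_at) auto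
    \<comment> \<open>At the origin the difference quotient is the next member of the family:
      division by \<open>h\<close> raises the exponent by one for \<open>h > 0\<close>, and both
      sides vanish for \<open>h < 0\<close>.\<close>
    moreover have "\<forall>\<^sub>F h in at 0. (bump k (0 + h) - bump k 0) / h = bump (k + 1) h"
      by (auto simp: eventually_at_filter bump_def)
    ultimately have "((\<lambda>h. (bump k (0 + h) - bump k 0) / h) \<longlongrightarrow> 0) (at 0)"
      using tendsto_cong by fast
    then show ?thesis using 3 by (simp add: DERIV_def bump_def)
  qed
qed

lemma bump_0_bounds: "0 \<le> bump 0 s" "bump 0 s \<le> 1"
  by (auto simp: bump_def field_simps)

lemma bump_0_limit: "(\<lambda>n. bump 0 (real (Suc n) * s)) \<longlonglongrightarrow> (if s > 0 then 1 else 0)"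
proof (cases "s > 0")
  case True
  have "(\<lambda>n. 1 / exp (inverse (real (Suc n)) * (1 / s))) \<longlonglongrightarrow> 1 / exp (0 * (1 / s))"
    by (intro tendsto_intros LIMSEQ_inverse_real_of_nat) auto
  then show ?thesis using True by (simp add: bump_def divide_inverse)
next
  case False
  then have "\<not> real (Suc n) * s > 0" for n by (simp add: zero_less_mult_iff)
  then show ?thesis using False by (simp add: bump_def)
qed

text \<open>A family closed under differentiation, to be fed to \<open>smooth_on_coinduct\<close>.
  All \<open>bump k\<close> are included because differentiation raises \<open>k\<close>, and they
  are composed with affine functions of a coordinate because cut-offs of boxes have this
  form.\<close>

inductive_set smooth_algebra :: "field set" where
  base: "smooth_on UNIV f \<Longrightarrow> f \<in> smooth_algebra"
| const: "(\<lambda>x. c) \<in> smooth_algebra"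
| coord: "(\<lambda>x. of_real (x $ i)) \<in> smooth_algebra"
| bump: "(\<lambda>x. of_real (bump k (c * x $ i + d))) \<in> smooth_algebra"
| cnj: "f \<in> smooth_algebra \<Longrightarrow> (\<lambda>x. cnj (f x)) \<in> smooth_algebra"
| add: "f \<in> smooth_algebra \<Longrightarrow> g \<in> smooth_algebra \<Longrightarrow> (\<lambda>x. f x + g x) \<in> smooth_algebra"
| mult: "f \<in> smooth_algebra \<Longrightarrow> g \<in> smooth_algebra \<Longrightarrow> (\<lambda>x. f x * g x) \<in> smooth_algebra"

lemma smooth_algebra_smooth:
  assumes "f \<in> smooth_algebra"
  shows "smooth_on UNIV f"
proof (rule smooth_on_coinduct[OF assms])
  fix f :: field assume "f \<in> smooth_algebra"
  then show "\<exists>f'. (\<forall>x. (f has_derivative f' x) (at x)) \<and> (\<forall>b\<in>Basis. (\<lambda>x. f' x b) \<in> smooth_algebra)"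
  proof induction
    case (base f)
    have "(f has_derivative frechet_derivative f (at x)) (at x)" for x
      using smooth_on_differentiable[OF base] by (simp add: frechet_derivative_works)
    then show ?case using smooth_on_derivative[OF base] smooth_algebra.base
      by (intro exI[of _ "\<lambda>x. frechet_derivative f (at x)"]) auto
  next
    case (const c)
    have "((\<lambda>x::R3. c) has_derivative (\<lambda>_. 0)) (at x)" for x by simp
    then show ?case using smooth_algebra.const[of 0]
      by (intro exI[of _ "\<lambda>_ _. 0"]) auto
  next
    case (coord i)
    have "((\<lambda>x::R3. of_real (x $ i) :: complex) has_derivative (\<lambda>h. of_real (h $ i))) (at x)" for x
      by (auto intro!: derivative_eq_intros bounded_linear.has_derivative[OF bounded_linear_vec_nth])
    then show ?case using smooth_algebra.const
      by (intro exI[of _ "\<lambda>_ h. of_real (h $ i)"]) auto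
  next
    case (bump k c i d)
    let ?b = "\<lambda>x::R3. bump (k + 2) (c * x $ i + d) - real k * bump (k + 1) (c * x $ i + d)"
    have "((\<lambda>x::R3. of_real (bump k (c * x $ i + d)) :: complex) has_derivative
        (\<lambda>h. of_real (c * h $ i * ?b x))) (at x)" for x
    proof -
      have 1: "(bump k has_derivative (\<lambda>h. h * ?b x)) (at (c * x $ i + d))"
        using bump_has_derivative[of k "c * x $ i + d"]
        by (simp only: has_field_derivative_def mult_commute_abs)
      have "((\<lambda>x::R3. c * x $ i + d) has_derivative (\<lambda>h. c * h $ i)) (at x)"
        by (auto intro!: derivative_eq_intros bounded_linear.has_derivative[OF bounded_linear_vec_nth])
      from has_derivative_compose[OF this 1] show ?thesis
        by (intro has_derivative_of_real) auto
    qed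
    moreover have "(\<lambda>x. of_real (c * h $ i * ?b x)) \<in> smooth_algebra" for h :: R3
    proof -
      have "(\<lambda>x. of_real (c * h $ i) * (of_real (bump (k + 2) (c * x $ i + d))
          + (- of_real (real k)) * of_real (bump (k + 1) (c * x $ i + d)))) \<in> smooth_algebra"
        by (intro smooth_algebra.mult smooth_algebra.add smooth_algebra.const smooth_algebra.bump)
      then show ?thesis by simp
    qed
    ultimately show ?case
      by (intro exI[of _ "\<lambda>x h. of_real (c * h $ i * ?b x)"]) blast
  next
    case (cnj f)
    then obtain f' where f': "\<And>x. (f has_derivative f' x) (at x)" "\<And>b. b \<in> Basis \<Longrightarrow> (\<lambda>x. f' x b) \<in> smooth_algebra"
      by blast
    then show ?case using smooth_algebra.cnj
      by (intro exI[of _ "\<lambda>x h. cnj (f' x h)"]) (auto intro: bounded_linear.has_derivative[OF bounded_linear_cnj])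
  next
    case (add f g)
    then obtain f' g' where f': "\<And>x. (f has_derivative f' x) (at x)" "\<And>b. b \<in> Basis \<Longrightarrow> (\<lambda>x. f' x b) \<in> smooth_algebra"
      and g': "\<And>x. (g has_derivative g' x) (at x)" "\<And>b. b \<in> Basis \<Longrightarrow> (\<lambda>x. g' x b) \<in> smooth_algebra"
      by blast
    then show ?case using smooth_algebra.add
      by (intro exI[of _ "\<lambda>x h. f' x h + g' x h"]) (auto intro: has_derivative_add)
  next
    case (mult f g)
    then obtain f' g' where f': "\<And>x. (f has_derivative f' x) (at x)" "\<And>b. b \<in> Basis \<Longrightarrow> (\<lambda>x. f' x b) \<in> smooth_algebra"
      and g': "\<And>x. (g has_derivative g' x) (at x)" "\<And>b. b \<in> Basis \<Longrightarrow> (\<lambda>x. g' x b) \<in> smooth_algebra"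
      by blast
    have "((\<lambda>x. f x * g x) has_derivative (\<lambda>h. f x * g' x h + f' x h * g x)) (at x)" for x
      by (rule has_derivative_mult[OF f'(1) g'(1)])
    moreover have "(\<lambda>x. f x * g' x b + f' x b * g x) \<in> smooth_algebra" if "b \<in> Basis" for b
      using that f' g' mult.hyps by (intro smooth_algebra.add smooth_algebra.mult) auto
    ultimately show ?case
      by (intro exI[of _ "\<lambda>x h. f x * g' x h + f' x h * g x"]) blast
  qed
qed

lemma smooth_mult: "smooth_on UNIV f \<Longrightarrow> smooth_on UNIV g \<Longrightarrow> smooth_on UNIV (\<lambda>x. f x * g x)"
  for f g :: field
  by (rule smooth_algebra_smooth, rule smooth_algebra.mult; rule smooth_algebra.base)

lemma smooth_add: "smooth_on UNIV f \<Longrightarrow> smooth_on UNIV g \<Longrightarrow> smooth_on UNIV (\<lambda>x. f x + g x)"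
  for f g :: field
  by (rule smooth_algebra_smooth, rule smooth_algebra.add; rule smooth_algebra.base)

lemma smooth_cnj: "smooth_on UNIV f \<Longrightarrow> smooth_on UNIV (\<lambda>x. cnj (f x))" for f :: field
  by (rule smooth_algebra_smooth, rule smooth_algebra.cnj; rule smooth_algebra.base)

lemma smooth_const: "smooth_on UNIV ((\<lambda>x. c) :: field)"
  by (rule smooth_algebra_smooth, rule smooth_algebra.const)

lemma smooth_continuous: "smooth_on UNIV f \<Longrightarrow> continuous_on UNIV f"
  unfolding smooth_on_def by (drule spec[of _ 0]) simp

lemma smooth_has_derivative:
  "smooth_on UNIV f \<Longrightarrow> (f has_derivative frechet_derivative f (at x)) (at x)"
  using smooth_on_differentiable by (simp add: frechet_derivative_works)

lemma smooth_partial: "smooth_on UNIV f \<Longrightarrow> smooth_on UNIV (partial i f)"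
  unfolding partial_def by (rule smooth_on_derivative) (auto simp: axis_in_Basis_iff)

lemma partial_mult:
  assumes "smooth_on UNIV f" "smooth_on UNIV g"
  shows "partial i (\<lambda>x. f x * g x) = (\<lambda>x. f x * partial i g x + partial i f x * g x)"
  using frechet_derivative_eqI[OF has_derivative_mult[OF smooth_has_derivative[OF assms(1)]
      smooth_has_derivative[OF assms(2)]]]
  by (simp add: partial_def fun_eq_iff)

lemma partial_cnj:
  assumes "smooth_on UNIV f"
  shows "partial i (\<lambda>x. cnj (f x)) = (\<lambda>x. cnj (partial i f x))"
  using frechet_derivative_eqI[OF bounded_linear.has_derivative[OF bounded_linear_cnj
      smooth_has_derivative[OF assms]]]
  by (simp add: partial_def fun_eq_iff)

lemma partial_coord: "partial i (\<lambda>x. of_real (x $ i)) = (\<lambda>x. 1)"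
proof -
  have "((\<lambda>x::R3. of_real (x $ i) :: complex) has_derivative (\<lambda>h. of_real (h $ i))) (at x)" for x
    by (auto intro!: derivative_eq_intros bounded_linear.has_derivative[OF bounded_linear_vec_nth])
  from frechet_derivative_eqI[OF this] show ?thesis
    by (simp add: partial_def fun_eq_iff axis_def)
qed

lemma smooth_coord: "smooth_on UNIV ((\<lambda>x. of_real (x $ i)) :: field)"
  by (rule smooth_algebra_smooth, rule smooth_algebra.coord)

text \<open>Any compact set outside which the function vanishes may stand in for the support, which
  avoids computing closures for sums, products and derivatives.\<close>

lemma test_functions_iff:
  "\<psi> \<in> test_functions \<Omega> \<longleftrightarrow> smooth_on UNIV \<psi> \<and> (\<exists>K. compact K \<and> K \<subseteq> \<Omega> \<and> (\<forall>x. x \<notin> K \<longrightarrow> \<psi> x = 0))"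
proof
  assume "\<psi> \<in> test_functions \<Omega>"
  then show "smooth_on UNIV \<psi> \<and> (\<exists>K. compact K \<and> K \<subseteq> \<Omega> \<and> (\<forall>x. x \<notin> K \<longrightarrow> \<psi> x = 0))"
    using closure_subset[of "{x. \<psi> x \<noteq> 0}"]
    by (auto simp: test_functions_def intro!: exI[of _ "closure {x. \<psi> x \<noteq> 0}"])
next
  assume "smooth_on UNIV \<psi> \<and> (\<exists>K. compact K \<and> K \<subseteq> \<Omega> \<and> (\<forall>x. x \<notin> K \<longrightarrow> \<psi> x = 0))"
  then obtain K where s: "smooth_on UNIV \<psi>" and K: "compact K" "K \<subseteq> \<Omega>" "\<forall>x. x \<notin> K \<longrightarrow> \<psi> x = 0" by blast
  have sub: "closure {x. \<psi> x \<noteq> 0} \<subseteq> K"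
    using K by (intro closure_minimal) (auto intro: compact_imp_closed)
  then have "compact (closure {x. \<psi> x \<noteq> 0})"
    using compact_Int_closed[OF K(1), of "closure {x. \<psi> x \<noteq> 0}"] by (simp add: inf.absorb2)
  then show "\<psi> \<in> test_functions \<Omega>" using s sub K by (auto simp: test_functions_def)
qed

lemma test_smooth: "\<psi> \<in> test_functions \<Omega> \<Longrightarrow> smooth_on UNIV \<psi>"
  by (simp add: test_functions_def)

lemma test_smooth_mult:
  "\<psi> \<in> test_functions \<Omega> \<Longrightarrow> smooth_on UNIV f \<Longrightarrow> (\<lambda>x. f x * \<psi> x) \<in> test_functions \<Omega>"
  unfolding test_functions_iff by (elim conjE exE, intro conjI exI smooth_mult) auto

lemma test_cmult: "\<psi> \<in> test_functions \<Omega> \<Longrightarrow> (\<lambda>x. c * \<psi> x) \<in> test_functions \<Omega>"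
  by (rule test_smooth_mult[OF _ smooth_const])

lemma test_scaleR: "\<psi> \<in> test_functions \<Omega> \<Longrightarrow> (\<lambda>x. r *\<^sub>R \<psi> x) \<in> test_functions \<Omega>"
  using test_cmult[of \<psi> \<Omega> "of_real r"] by (simp add: scaleR_conv_of_real)

lemma test_cnj: "\<psi> \<in> test_functions \<Omega> \<Longrightarrow> (\<lambda>x. cnj (\<psi> x)) \<in> test_functions \<Omega>"
  unfolding test_functions_iff by (elim conjE exE, intro conjI exI smooth_cnj) auto

lemma test_zero: "(\<lambda>x. 0) \<in> test_functions \<Omega>"
  unfolding test_functions_iff by (auto intro: smooth_const)

lemma test_add:
  assumes "\<psi> \<in> test_functions \<Omega>" "\<theta> \<in> test_functions \<Omega>"
  shows "(\<lambda>x. \<psi> x + \<theta> x) \<in> test_functions \<Omega>"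
proof -
  obtain K L where "compact K" "K \<subseteq> \<Omega>" "\<forall>x. x \<notin> K \<longrightarrow> \<psi> x = 0" "compact L" "L \<subseteq> \<Omega>" "\<forall>x. x \<notin> L \<longrightarrow> \<theta> x = 0"
    using assms unfolding test_functions_iff by blast
  then show ?thesis unfolding test_functions_iff
    using assms by (auto intro!: smooth_add exI[of _ "K \<union> L"] dest: test_smooth)
qed

lemma test_partial:
  assumes "\<psi> \<in> test_functions \<Omega>"
  shows "partial i \<psi> \<in> test_functions \<Omega>"
proof -
  obtain K where K: "compact K" "K \<subseteq> \<Omega>" "\<And>x. x \<notin> K \<Longrightarrow> \<psi> x = 0"
    using assms unfolding test_functions_iff by blast
  have "partial i \<psi> x = 0" if "x \<notin> K" for x
  proof -
    have "(\<psi> has_derivative (\<lambda>_. 0)) (at x)"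
      by (rule has_derivative_transform_within_open[OF has_derivative_const, of "- K" _ 0])
        (use K that in \<open>auto intro: compact_imp_closed\<close>)
    from frechet_derivative_eqI[OF this] show ?thesis by (simp add: partial_def)
  qed
  then show ?thesis
    using K smooth_partial[OF test_smooth[OF assms]] unfolding test_functions_iff by blast
qed

section \<open>Integration of test functions\<close>

lemma test_integrable:
  assumes "\<psi> \<in> test_functions \<Omega>"
  shows "integrable lborel \<psi>"
proof -
  obtain K where K: "compact K" "\<And>x. x \<notin> K \<Longrightarrow> \<psi> x = 0"
    using assms unfolding test_functions_iff by blast
  have "integrable lborel (\<lambda>x. indicator K x *\<^sub>R \<psi> x)"
    using K(1) smooth_continuous[OF test_smooth[OF assms]]
    by (intro borel_integrable_compact) (auto intro: continuous_on_subset)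
  moreover have "indicator K x *\<^sub>R \<psi> x = \<psi> x" for x using K(2)[of x] by (auto simp: indicator_def)
  ultimately show ?thesis by simp
qed

lemma test_vanishes: "\<psi> \<in> test_functions \<Omega> \<Longrightarrow> x \<notin> \<Omega> \<Longrightarrow> \<psi> x = 0"
  unfolding test_functions_iff by blast

lemma vanishing_integral:
  fixes f :: field
  assumes "\<Omega> \<in> sets borel" "\<And>x. x \<notin> \<Omega> \<Longrightarrow> f x = 0"
  shows "integrable (vol \<Omega>) f \<longleftrightarrow> integrable lborel f" "(LINT x|vol \<Omega>. f x) = (LINT x|lborel. f x)"
proof -
  have "indicator \<Omega> x *\<^sub>R f x = f x" for x using assms(2)[of x] by (auto simp: indicator_def)
  then show "integrable (vol \<Omega>) f \<longleftrightarrow> integrable lborel f" "(LINT x|vol \<Omega>. f x) = (LINT x|lborel. f x)"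
    using assms(1) by (simp_all add: integrable_restrict_space integral_restrict_space)
qed

lemma test_l2:
  assumes \<Omega>: "\<Omega> \<in> sets borel" and \<psi>: "\<psi> \<in> test_functions \<Omega>"
  shows "\<psi> \<in> l2 (vol \<Omega>)"
proof -
  have "\<psi> \<in> borel_measurable (vol \<Omega>)"
    using smooth_continuous[OF test_smooth[OF \<psi>]]
    by (intro measurable_restrict_space1) (simp add: borel_measurable_continuous_onI)
  moreover have "integrable (vol \<Omega>) (\<lambda>x. (cmod (\<psi> x))\<^sup>2)"
  proof -
    have t: "(\<lambda>x. cnj (\<psi> x) * \<psi> x) \<in> test_functions \<Omega>"
      using \<psi> by (intro test_smooth_mult smooth_cnj test_smooth)
    have "integrable (vol \<Omega>) (\<lambda>x. cnj (\<psi> x) * \<psi> x)"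
      using vanishing_integral(1)[OF \<Omega>, of "\<lambda>x. cnj (\<psi> x) * \<psi> x"] test_integrable[OF t] test_vanishes[OF \<psi>]
      by simp
    then have "integrable (vol \<Omega>) (\<lambda>x. cmod (cnj (\<psi> x) * \<psi> x))" by (rule integrable_norm)
    then show ?thesis by (simp add: norm_mult power2_eq_square)
  qed
  ultimately show ?thesis by (simp add: l2_def)
qed

text \<open>By translation invariance of Lebesgue measure every difference quotient in direction
  \<open>i\<close> has integral 0; dominated convergence passes this to the derivative. Extended to
  products, this is integration by parts with no boundary term.\<close>

lemma integral_partial_zero:
  assumes \<psi>: "\<psi> \<in> test_functions \<Omega>"
  shows "(LINT x|lborel. partial i \<psi> x) = 0"
proof -
  define e :: R3 where "e = axis i 1"
  have norm_e: "norm e = 1" by (simp add: e_def)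
  obtain K where K: "compact K" "\<And>x. x \<notin> K \<Longrightarrow> \<psi> x = 0"
    using \<psi> unfolding test_functions_iff by blast
  have p: "partial i \<psi> \<in> test_functions \<Omega>" by (rule test_partial[OF \<psi>])
  obtain K' where K': "compact K'" "\<And>x. x \<notin> K' \<Longrightarrow> partial i \<psi> x = 0"
    using p unfolding test_functions_iff by blast
  have "compact (partial i \<psi> ` K')"
    using K' smooth_continuous[OF test_smooth[OF p]] by (intro compact_continuous_image) (auto intro: continuous_on_subset)
  then obtain M where M: "M > 0" "\<And>x. x \<in> K' \<Longrightarrow> norm (partial i \<psi> x) \<le> M"
    using compact_imp_bounded bounded_pos by (metis imageI)
  have M': "norm (partial i \<psi> x) \<le> M" for x using M K'(2)[of x] by (cases "x \<in> K'") auto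
  have bound: "norm (\<psi> (x + h *\<^sub>R e) - \<psi> x) \<le> M * h" if "h \<ge> 0" for x h
  proof -
    have "norm ((\<lambda>s. \<psi> (x + s *\<^sub>R e)) h - (\<lambda>s. \<psi> (x + s *\<^sub>R e)) 0) \<le> M * norm (h - 0)"
    proof (rule differentiable_bound[OF convex_UNIV])
      fix s :: real
      show "((\<lambda>s. \<psi> (x + s *\<^sub>R e)) has_derivative (\<lambda>r. frechet_derivative \<psi> (at (x + s *\<^sub>R e)) (r *\<^sub>R e))) (at s)"
        by (rule has_derivative_compose[OF _ smooth_has_derivative[OF test_smooth[OF \<psi>]]])
          (auto intro!: derivative_eq_intros)
      have "linear (frechet_derivative \<psi> (at (x + s *\<^sub>R e)))"
        by (intro linear_frechet_derivative smooth_on_differentiable test_smooth[OF \<psi>])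
      then have "frechet_derivative \<psi> (at (x + s *\<^sub>R e)) (r *\<^sub>R e) = r *\<^sub>R partial i \<psi> (x + s *\<^sub>R e)" for r
        by (simp add: linear_cmul partial_def e_def)
      then show "onorm (\<lambda>r. frechet_derivative \<psi> (at (x + s *\<^sub>R e)) (r *\<^sub>R e)) \<le> M"
        using M mult_left_mono[OF M'[of "x + s *\<^sub>R e"] abs_ge_zero]
        by (intro onorm_bound) (auto simp: mult.commute)
    qed auto
    then show ?thesis using that by simp
  qed
  define h where "h n = inverse (real (Suc n))" for n
  have h: "0 < h n" "h n \<le> 1" for n by (auto simp: h_def field_simps)
  have h_lim: "h \<longlonglongrightarrow> 0" unfolding h_def by (rule LIMSEQ_inverse_real_of_nat)
  \<comment> \<open>The points that a shift by at most 1 in direction \<open>e\<close> can carry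
    into \<open>K\<close>; outside \<open>K \<union> L\<close> every quotient \<open>q n\<close>
    vanishes.\<close>
  define L where "L = (\<lambda>(s, x). x - s *\<^sub>R e) ` ({0..1} \<times> K)"
  have L: "compact L" unfolding L_def
    by (intro compact_continuous_image compact_Times K compact_Icc)
      (auto intro!: continuous_intros simp: split_beta)
  define q where "q n x = (1 / h n) *\<^sub>R (\<psi> (x + h n *\<^sub>R e) - \<psi> x)" for n x
  have int: "integrable lborel (\<lambda>x. \<psi> (x + a))" "(LINT x|lborel. \<psi> (x + a)) = (LINT x|lborel. \<psi> x)" for a
  proof -
    have m: "\<psi> \<in> borel_measurable borel"
      using smooth_continuous[OF test_smooth[OF \<psi>]] by (rule borel_measurable_continuous_onI)
    have d: "distr lborel borel (\<lambda>x. x + a) = lborel"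
    proof -
      have "(\<lambda>x. x + a) = (+) a" by (simp add: fun_eq_iff add.commute)
      then show ?thesis by (simp only: lborel_distr_plus)
    qed
    have "integrable (distr lborel borel (\<lambda>x. x + a)) \<psi>" unfolding d by (rule test_integrable[OF \<psi>])
    then show "integrable lborel (\<lambda>x. \<psi> (x + a))"
      using integrable_distr[of "\<lambda>x. x + a" lborel borel \<psi>] by simp
    have "(LINT x|distr lborel borel (\<lambda>x. x + a). \<psi> x) = (LINT x|lborel. \<psi> (x + a))"
      using m by (intro integral_distr) auto
    then show "(LINT x|lborel. \<psi> (x + a)) = (LINT x|lborel. \<psi> x)" unfolding d by simp
  qed
  have q0: "(LINT x|lborel. q n x) = 0" for n
    unfolding q_def using int[of "h n *\<^sub>R e"] test_integrable[OF \<psi>] by simp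
  have "(\<lambda>n. LINT x|lborel. q n x) \<longlonglongrightarrow> (LINT x|lborel. partial i \<psi> x)"
  proof (rule integral_dominated_convergence[where w = "\<lambda>x. M * indicator (K \<union> L) x"])
    show "partial i \<psi> \<in> borel_measurable lborel" using test_integrable[OF p] by auto
    show "q n \<in> borel_measurable lborel" for n
      unfolding q_def using int(1)[of "h n *\<^sub>R e"] test_integrable[OF \<psi>] by auto
    have "integrable lborel (indicator (K \<union> L) :: R3 \<Rightarrow> real)"
      using K L by (intro integrable_real_indicator emeasure_compact_finite) (auto intro: borel_compact)
    then show "integrable lborel (\<lambda>x. M * indicator (K \<union> L) x)" by simp
    show "AE x in lborel. norm (q n x) \<le> M * indicator (K \<union> L) x" for n
    proof (rule AE_I2)
      fix x
      show "norm (q n x) \<le> M * indicator (K \<union> L) x"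
      proof (cases "x \<in> K \<union> L")
        case True
        then show ?thesis using bound[of "h n" x] h(1)[of n]
            unfolding q_def norm_scaleR by (auto simp: divide_le_eq)
      next
        case False
        have "x + h n *\<^sub>R e \<notin> K"
        proof
          assume "x + h n *\<^sub>R e \<in> K"
          then have "x \<in> L" unfolding L_def using h[of n]
            by (intro image_eqI[of _ _ "(h n, x + h n *\<^sub>R e)"]) auto
          then show False using False by simp
        qed
        then show ?thesis using False K(2) by (simp add: q_def)
      qed
    qed
    have "(\<lambda>n. q n x) \<longlonglongrightarrow> partial i \<psi> x" for x
    proof -
      have "((\<lambda>s. \<psi> (x + s *\<^sub>R e)) has_derivative (\<lambda>r. frechet_derivative \<psi> (at (x + 0 *\<^sub>R e)) (r *\<^sub>R e))) (at 0)"
        by (rule has_derivative_compose[OF _ smooth_has_derivative[OF test_smooth[OF \<psi>]]])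
          (auto intro!: derivative_eq_intros)
      moreover have "frechet_derivative \<psi> (at x) (r *\<^sub>R e) = r *\<^sub>R partial i \<psi> x" for r
        using linear_frechet_derivative[OF smooth_on_differentiable[OF test_smooth[OF \<psi>]], of x]
        by (simp add: linear_cmul partial_def e_def)
      ultimately have "((\<lambda>s. \<psi> (x + s *\<^sub>R e)) has_vector_derivative partial i \<psi> x) (at 0)"
        by (simp add: has_vector_derivative_def)
      then have "((\<lambda>s. norm (\<psi> (x + s *\<^sub>R e) - \<psi> x - s *\<^sub>R partial i \<psi> x) / norm s) \<longlongrightarrow> 0) (at 0)"
        by (simp add: has_vector_derivative_def has_derivative_at)
      moreover have "\<forall>\<^sub>F s in at 0. norm (\<psi> (x + s *\<^sub>R e) - \<psi> x - s *\<^sub>R partial i \<psi> x) / norm s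
          = norm ((1 / s) *\<^sub>R (\<psi> (x + s *\<^sub>R e) - \<psi> x) - partial i \<psi> x)"
      proof -
        have "norm (a - s *\<^sub>R p) / norm s = norm ((1 / s) *\<^sub>R a - p)" if "s \<noteq> 0" for a p :: complex and s :: real
        proof -
          have "(1 / s) *\<^sub>R a - p = (1 / s) *\<^sub>R (a - s *\<^sub>R p)" using that by (simp add: scaleR_diff_right)
          then show ?thesis by simp
        qed
        then show ?thesis by (simp add: eventually_at_filter)
      qed
      ultimately have "((\<lambda>s. norm ((1 / s) *\<^sub>R (\<psi> (x + s *\<^sub>R e) - \<psi> x) - partial i \<psi> x)) \<longlongrightarrow> 0) (at 0)"
        using tendsto_cong by fast
      then have lim: "((\<lambda>s. (1 / s) *\<^sub>R (\<psi> (x + s *\<^sub>R e) - \<psi> x)) \<longlongrightarrow> partial i \<psi> x) (at 0)"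
        by (simp only: tendsto_norm_zero_iff LIM_zero_iff)
      have "filterlim h (at 0) sequentially"
        using h_lim h(1) by (auto simp: filterlim_at less_imp_neq[symmetric])
      from filterlim_compose[OF lim this] show ?thesis by (simp add: q_def)
    qed
    then show "AE x in lborel. (\<lambda>n. q n x) \<longlonglongrightarrow> partial i \<psi> x" by simp
  qed
  then have "(\<lambda>n. 0) \<longlonglongrightarrow> (LINT x|lborel. partial i \<psi> x)" unfolding q0 .
  then show ?thesis by (simp add: LIMSEQ_const_iff)
qed

section \<open>Density of test functions in \<open>L2 \<Omega>\<close>\<close>

definition test_closure :: "R3 set \<Rightarrow> field set" where
  "test_closure \<Omega> = {f \<in> l2 (vol \<Omega>). \<forall>e>0. \<exists>\<psi>\<in>test_functions \<Omega>. nrm (vol \<Omega>) (f - \<psi>) < e}"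

lemma test_closureE:
  assumes "f \<in> test_closure \<Omega>" "e > 0"
  obtains \<psi> where "\<psi> \<in> test_functions \<Omega>" "nrm (vol \<Omega>) (f - \<psi>) < e"
  using assms unfolding test_closure_def by blast

lemma test_closureI:
  assumes \<Omega>: "\<Omega> \<in> sets borel" and f: "f \<in> l2 (vol \<Omega>)"
    and approx: "\<And>e. e > 0 \<Longrightarrow> \<exists>g\<in>test_closure \<Omega>. nrm (vol \<Omega>) (f - g) < e"
  shows "f \<in> test_closure \<Omega>"
  unfolding test_closure_def
proof (intro CollectI conjI f allI impI)
  fix e :: real assume "e > 0"
  then obtain g where g: "g \<in> test_closure \<Omega>" "nrm (vol \<Omega>) (f - g) < e / 2"
    using approx[of "e / 2"] by auto
  then obtain \<psi> where \<psi>: "\<psi> \<in> test_functions \<Omega>" "nrm (vol \<Omega>) (g - \<psi>) < e / 2"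
    using test_closureE[OF g(1), of "e / 2"] \<open>e > 0\<close> by auto
  have "nrm (vol \<Omega>) (f - \<psi>) \<le> nrm (vol \<Omega>) (f - g) + nrm (vol \<Omega>) (g - \<psi>)"
    using f g \<psi> test_l2[OF \<Omega>] by (intro l2.N_triangle_diff) (auto simp: test_closure_def)
  then show "\<exists>\<psi>\<in>test_functions \<Omega>. nrm (vol \<Omega>) (f - \<psi>) < e" using g \<psi> by (intro bexI[of _ \<psi>]) auto
qed

lemma test_closure_test: "\<Omega> \<in> sets borel \<Longrightarrow> \<psi> \<in> test_functions \<Omega> \<Longrightarrow> \<psi> \<in> test_closure \<Omega>"
  unfolding test_closure_def using test_l2[of \<Omega> \<psi>] by (auto intro!: bexI[of _ \<psi>])

lemma test_closure_add:
  assumes \<Omega>: "\<Omega> \<in> sets borel" and f: "f \<in> test_closure \<Omega>" and g: "g \<in> test_closure \<Omega>"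
  shows "f + g \<in> test_closure \<Omega>"
  unfolding test_closure_def
proof (intro CollectI conjI allI impI)
  show "f + g \<in> l2 (vol \<Omega>)" using f g by (auto simp: test_closure_def)
  fix e :: real assume "e > 0"
  then have e: "e / 2 > 0" by simp
  obtain \<psi> where \<psi>: "\<psi> \<in> test_functions \<Omega>" "nrm (vol \<Omega>) (f - \<psi>) < e / 2"
    by (rule test_closureE[OF f e])
  obtain \<theta> where \<theta>: "\<theta> \<in> test_functions \<Omega>" "nrm (vol \<Omega>) (g - \<theta>) < e / 2"
    by (rule test_closureE[OF g e])
  have "f + g - (\<psi> + \<theta>) = (f - \<psi>) + (g - \<theta>)" by simp
  moreover have "nrm (vol \<Omega>) ((f - \<psi>) + (g - \<theta>)) \<le> nrm (vol \<Omega>) (f - \<psi>) + nrm (vol \<Omega>) (g - \<theta>)"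
    using f g \<psi> \<theta> test_l2[OF \<Omega>] by (intro l2.N_triangle) (auto simp: test_closure_def)
  ultimately show "\<exists>\<psi>\<in>test_functions \<Omega>. nrm (vol \<Omega>) (f + g - \<psi>) < e"
    using \<psi> \<theta> test_add[of \<psi> \<Omega> \<theta>] by (intro bexI[of _ "\<psi> + \<theta>"]) (auto simp: plus_fun_def)
qed

lemma test_closure_cmult:
  assumes \<Omega>: "\<Omega> \<in> sets borel" and f: "f \<in> test_closure \<Omega>"
  shows "(\<lambda>x. c * f x) \<in> test_closure \<Omega>"
  unfolding test_closure_def
proof (intro CollectI conjI allI impI)
  show "(\<lambda>x. c * f x) \<in> l2 (vol \<Omega>)" using f by (auto simp: test_closure_def intro: l2_cmult)
  fix e :: real assume e: "e > 0"
  have c: "cmod c + 1 > 0" using norm_ge_zero[of c] by linarith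
  obtain \<psi> where \<psi>: "\<psi> \<in> test_functions \<Omega>" "nrm (vol \<Omega>) (f - \<psi>) < e / (cmod c + 1)"
    by (rule test_closureE[OF f divide_pos_pos[OF e c]])
  have "(\<lambda>x. c * f x) - (\<lambda>x. c * \<psi> x) = (\<lambda>x. c * (f - \<psi>) x)" by (simp add: fun_eq_iff algebra_simps)
  then have "nrm (vol \<Omega>) ((\<lambda>x. c * f x) - (\<lambda>x. c * \<psi> x)) = cmod c * nrm (vol \<Omega>) (f - \<psi>)"
    by (simp only: nrm_cmult)
  also have "\<dots> \<le> (cmod c + 1) * nrm (vol \<Omega>) (f - \<psi>)" by (intro mult_right_mono) auto
  also have "\<dots> < e" using \<psi>(2) c by (simp add: field_simps)
  finally show "\<exists>\<psi>\<in>test_functions \<Omega>. nrm (vol \<Omega>) ((\<lambda>x. c * f x) - \<psi>) < e"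
    using test_cmult[OF \<psi>(1)] by blast
qed

lemma test_closure_diff:
  "\<Omega> \<in> sets borel \<Longrightarrow> f \<in> test_closure \<Omega> \<Longrightarrow> g \<in> test_closure \<Omega> \<Longrightarrow> f - g \<in> test_closure \<Omega>"
  using test_closure_add[of \<Omega> f "\<lambda>x. (-1) * g x"] test_closure_cmult[of \<Omega> g "-1"]
  by (simp add: plus_fun_def fun_diff_def)

text \<open>The closure is stable under dominated pointwise limits; this carries indicators of boxes
  to Borel sets and simple functions to arbitrary ones.\<close>

lemma test_closure_dominated:
  assumes \<Omega>: "\<Omega> \<in> sets borel" and f: "f \<in> borel_measurable (vol \<Omega>)" and g: "g \<in> l2 (vol \<Omega>)"
    and fn: "\<And>n. fn n \<in> test_closure \<Omega>"
    and le: "\<And>n x. x \<in> \<Omega> \<Longrightarrow> cmod (fn n x) \<le> cmod (g x)"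
    and lim: "\<And>x. x \<in> \<Omega> \<Longrightarrow> (\<lambda>n. fn n x) \<longlonglongrightarrow> f x"
  shows "f \<in> test_closure \<Omega>"
proof (rule test_closureI[OF \<Omega>])
  have [simp]: "space (vol \<Omega>) = \<Omega>" by (simp add: space_restrict_space)
  have fl: "cmod (f x) \<le> cmod (g x)" if "x \<in> \<Omega>" for x
    using Lim_norm_ubound[OF sequentially_bot lim[OF that]] le[OF that] by auto
  show "f \<in> l2 (vol \<Omega>)" by (rule l2_bounded_by[OF f g]) (auto intro!: AE_I2 fl)
  have "(\<lambda>n. nrm (vol \<Omega>) (\<lambda>x. f x - fn n x)) \<longlonglongrightarrow> 0"
    using fn by (intro nrm_dominated_convergence[OF f g]) (auto simp: test_closure_def le lim intro!: AE_I2 dest: l2_measurable)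
  then show "\<exists>h\<in>test_closure \<Omega>. nrm (vol \<Omega>) (f - h) < e" if "e > 0" for e
  proof -
    have "\<forall>\<^sub>F n in sequentially. nrm (vol \<Omega>) (\<lambda>x. f x - fn n x) < e"
      using \<open>(\<lambda>n. nrm (vol \<Omega>) (\<lambda>x. f x - fn n x)) \<longlonglongrightarrow> 0\<close> that by (rule order_tendstoD)
    then obtain n where "nrm (vol \<Omega>) (\<lambda>x. f x - fn n x) < e"
      by (auto dest!: eventually_happens'[OF sequentially_bot])
    then show ?thesis using fn[of n] by (intro bexI[of _ "fn n"]) (simp_all add: fun_diff_def)
  qed
qed

text \<open>\<open>s \<mapsto> exp (-1/(ns))\<close> approximates the indicator of the half line, hence products of these
  functions approximate indicators of boxes.\<close>

lemma box_in_test_closure: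
  assumes \<Omega>: "open \<Omega>" "emeasure lborel \<Omega> < \<infinity>" and box: "cbox a b \<subseteq> \<Omega>"
  shows "(\<lambda>x. indicator (box a b) x) \<in> test_closure \<Omega>"
proof -
  have \<Omega>b: "\<Omega> \<in> sets borel" using \<Omega> by simp
  define fn :: "nat \<Rightarrow> field" where "fn n x = (\<Prod>i\<in>(UNIV :: 3 set).
      of_real (bump 0 (real (Suc n) * (x $ i - a $ i))) * of_real (bump 0 (real (Suc n) * (b $ i - x $ i))))" for n x
  have nz: "x \<in> box a b" if "fn n x \<noteq> 0" for n x
  proof -
    have "bump 0 (real (Suc n) * (x $ i - a $ i)) \<noteq> 0 \<and> bump 0 (real (Suc n) * (b $ i - x $ i)) \<noteq> 0" for i
      using that by (simp add: fn_def)
    then have "real (Suc n) * (x $ i - a $ i) > 0 \<and> real (Suc n) * (b $ i - x $ i) > 0" for i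
      unfolding bump_def by (meson)
    then show ?thesis by (simp add: mem_box_cart zero_less_mult_iff)
  qed
  have test: "fn n \<in> test_functions \<Omega>" for n
  proof -
    have 1: "(\<lambda>x::R3. \<Prod>i\<in>I. of_real (bump 0 (real (Suc n) * (x $ i - a $ i)))
        * of_real (bump 0 (real (Suc n) * (b $ i - x $ i)))) \<in> smooth_algebra" if "finite I" for I :: "3 set"
      using that
    proof induction
      case empty
      then show ?case by (simp add: smooth_algebra.const)
    next
      case (insert i I)
      have "(\<lambda>x. of_real (bump 0 (real (Suc n) * x $ i + (- real (Suc n) * a $ i)))
        * of_real (bump 0 ((- real (Suc n)) * x $ i + real (Suc n) * b $ i))) \<in> smooth_algebra"
        by (intro smooth_algebra.mult smooth_algebra.bump)
      then have "(\<lambda>x. of_real (bump 0 (real (Suc n) * (x $ i - a $ i)))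
        * of_real (bump 0 (real (Suc n) * (b $ i - x $ i)))) \<in> smooth_algebra"
        by (simp add: algebra_simps)
      from smooth_algebra.mult[OF this insert.IH] show ?case using insert.hyps by simp
    qed
    have "smooth_on UNIV (fn n)" using smooth_algebra_smooth[OF 1[of UNIV]] by (simp add: fn_def[abs_def])
    moreover have "fn n x = 0" if "x \<notin> cbox a b" for x
      using nz[of n x] that box_subset_cbox[of a b] by blast
    ultimately show ?thesis unfolding test_functions_iff using box compact_cbox by blast
  qed
  have lim: "(\<lambda>n. fn n x) \<longlonglongrightarrow> indicator (box a b) x" for x
  proof (cases "x \<in> box a b")
    case True
    then have "0 < x $ i - a $ i" "0 < b $ i - x $ i" for i by (simp_all add: mem_box_cart)
    then have "(\<lambda>n. fn n x) \<longlonglongrightarrow> (\<Prod>i\<in>(UNIV :: 3 set). of_real 1 * of_real 1)"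
      unfolding fn_def using bump_0_limit[of "x $ i - a $ i" for i] bump_0_limit[of "b $ i - x $ i" for i]
      by (intro tendsto_intros) (simp_all del: of_nat_Suc)
    then show ?thesis using True by simp
  next
    case False
    then have "fn n x = 0" for n using nz by blast
    then show ?thesis using False by simp
  qed
  have le: "cmod (fn n x) \<le> cmod 1" for n x
    unfolding fn_def prod_norm[symmetric]
    by (auto simp: norm_mult bump_0_bounds intro!: prod_le_1 mult_le_one)
  have "(\<lambda>x. 1) \<in> l2 (vol \<Omega>)"
    using \<Omega> \<Omega>b by (auto simp: l2_def integrable_iff_bounded emeasure_restrict_space space_restrict_space)
  moreover have "(\<lambda>x. indicator (box a b) x) \<in> borel_measurable (vol \<Omega>)"
    by (intro measurable_restrict_space1) auto
  ultimately show ?thesis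
    by (intro test_closure_dominated[OF \<Omega>b _ _ test_closure_test[OF \<Omega>b test] le lim])
qed

text \<open>A Dynkin system argument in \<open>A\<close>, with the open boxes as intersection-stable
  generator. Intersecting with a fixed box whose closure lies in \<open>\<Omega>\<close> localises
  complements and countable unions to a region where indicators can be approximated.\<close>

lemma box_section_in_test_closure:
  assumes \<Omega>: "open \<Omega>" "emeasure lborel \<Omega> < \<infinity>" and box: "cbox a b \<subseteq> \<Omega>" and A: "A \<in> sets borel"
  shows "(\<lambda>x. indicator (A \<inter> box a b) x) \<in> test_closure \<Omega>"
proof -
  have \<Omega>b: "\<Omega> \<in> sets borel" using \<Omega> by simp
  have one: "(\<lambda>x. 1) \<in> l2 (vol \<Omega>)"
    using \<Omega> \<Omega>b by (auto simp: l2_def integrable_iff_bounded emeasure_restrict_space space_restrict_space)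
  let ?G = "range (\<lambda>(a, b). box a b :: R3 set)"
  have "Int_stable ?G" "?G \<subseteq> Pow UNIV" by (auto simp: Int_stable_def box_Int_box)
  moreover have "A \<in> sigma_sets UNIV ?G" using A by (simp add: borel_eq_box)
  ultimately show ?thesis
  proof (induction rule: sigma_sets_induct_disjoint)
    case (basic A)
    then obtain c d where A: "A = box c d" by auto
    obtain c' d' where cd: "A \<inter> box a b = box c' d'" unfolding A by (auto simp: box_Int_box)
    show ?case
    proof (cases "box c' d' = {}")
      case True
      then show ?thesis using cd test_closure_test[OF \<Omega>b test_zero] by simp
    next
      case False
      have "cbox c' d' = closure (box c' d')" using False by simp
      also have "\<dots> \<subseteq> closure (box a b)" using cd by (intro closure_mono) auto
      also have "\<dots> \<subseteq> cbox a b" by (intro closure_minimal box_subset_cbox closed_cbox)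
      finally show ?thesis unfolding cd using box by (intro box_in_test_closure[OF \<Omega>]) auto
    qed
  next
    case empty
    then show ?case using test_closure_test[OF \<Omega>b test_zero] by simp
  next
    case (compl A)
    have "(\<lambda>x. indicator (box a b) x) - (\<lambda>x. indicator (A \<inter> box a b) x)
        = ((\<lambda>x. indicator ((UNIV - A) \<inter> box a b) x) :: field)"
      by (auto simp: fun_eq_iff indicator_def)
    then show ?case
      using test_closure_diff[OF \<Omega>b box_in_test_closure[OF \<Omega> box] compl.IH] by simp
  next
    case (union A)
    define fn :: "nat \<Rightarrow> field" where "fn n x = (\<Sum>i<n. indicator (A i \<inter> box a b) x)" for n x
    have disj: "disjoint_family (\<lambda>i. A i \<inter> box a b)"
      using union(1) by (auto simp: disjoint_family_on_def)
    have fn_eq: "fn n x = indicator (\<Union>i<n. A i \<inter> box a b) x" for n x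
      unfolding fn_def using disj
      by (subst indicator_UN_disjoint) (auto simp: disjoint_family_on_def)
    have fn: "fn n \<in> test_closure \<Omega>" for n
    proof (induction n)
      case 0
      then show ?case using test_closure_test[OF \<Omega>b test_zero] by (simp add: fn_def[abs_def])
    next
      case (Suc n)
      have eq: "fn (Suc n) = fn n + (\<lambda>x. indicator (A n \<inter> box a b) x)" by (simp add: fn_def fun_eq_iff)
      show ?case unfolding eq by (rule test_closure_add[OF \<Omega>b Suc union(3)[of n]])
    qed
    have "A i \<in> sets borel" for i using union(2) by (auto simp: borel_eq_box)
    then have m: "(\<lambda>x. indicator (\<Union> (range A) \<inter> box a b) x :: complex) \<in> borel_measurable (vol \<Omega>)"
      by (intro measurable_restrict_space1) auto
    have "(\<lambda>n. fn n x) \<longlonglongrightarrow> indicator (\<Union>i. A i \<inter> box a b) x" for x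
      unfolding fn_eq by (rule LIMSEQ_indicator_UN)
    moreover have "(\<Union>i. A i \<inter> box a b) = \<Union> (range A) \<inter> box a b" by auto
    ultimately have lim: "(\<lambda>n. fn n x) \<longlonglongrightarrow> indicator (\<Union> (range A) \<inter> box a b) x" for x
      by (simp only:)
    have "cmod (fn n x) \<le> cmod 1" for n x by (simp add: fn_eq indicator_def)
    from test_closure_dominated[OF \<Omega>b m one fn this lim] show ?case .
  qed
qed

text \<open>\<open>\<Omega>\<close> is a countable union of boxes with closure inside it. Simple
  functions converging to \<open>f\<close> with modulus at most twice that of \<open>f\<close> are
  cut off to finite unions of these boxes, and the cut-offs converge dominatedly.\<close>

theorem test_functions_dense:
  assumes \<Omega>: "open \<Omega>" "emeasure lborel \<Omega> < \<infinity>" and f: "f \<in> l2 (vol \<Omega>)"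
  shows "f \<in> test_closure \<Omega>"
proof -
  have \<Omega>b: "\<Omega> \<in> sets borel" using \<Omega> by simp
  have sp [simp]: "space (vol \<Omega>) = \<Omega>" by (simp add: space_restrict_space)
  define \<F> where "\<F> = {box a b | a b :: R3. cbox a b \<subseteq> \<Omega>}"
  have "\<Union>\<F> = \<Omega>"
  proof
    show "\<Union>\<F> \<subseteq> \<Omega>" unfolding \<F>_def using box_subset_cbox by blast
    show "\<Omega> \<subseteq> \<Union>\<F>"
    proof
      fix x assume "x \<in> \<Omega>"
      then obtain a b where "cbox a b \<subseteq> \<Omega>" "x \<in> box a b" using open_contains_cbox[OF \<Omega>(1)] by metis
      then show "x \<in> \<Union>\<F>" unfolding \<F>_def by blast
    qed
  qed
  moreover obtain \<G> where \<G>: "\<G> \<subseteq> \<F>" "countable \<G>" "\<Union>\<G> = \<Union>\<F>"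
    by (rule Lindelof[of \<F>]) (auto simp: \<F>_def)
  ultimately have U\<G>: "\<Union>\<G> = \<Omega>" by simp
  show ?thesis
  proof (cases "\<Omega> = {}")
    case True
    then have "vol \<Omega> = vol {}" by simp
    have "nrm (vol \<Omega>) (f - (\<lambda>x. 0)) = 0"
      by (simp add: nrm_eq integral_restrict_space[OF] True)
    then show ?thesis using f test_zero unfolding test_closure_def by (auto intro!: bexI[of _ "\<lambda>x. 0"])
  next
    case False
    then have "\<G> \<noteq> {}" using U\<G> by auto
    define Q where "Q = from_nat_into \<G>"
    have Q: "range Q = \<G>" unfolding Q_def by (rule range_from_nat_into[OF \<open>\<G> \<noteq> {}\<close> \<G>(2)])
    have Qb: "\<exists>a b. Q k = box a b \<and> cbox a b \<subseteq> \<Omega>" for k using Q \<G>(1) unfolding \<F>_def by blast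
    have UQ: "(\<Union>k. Q k) = \<Omega>" using Q U\<G> by simp
    have Qsets [measurable]: "Q k \<in> sets borel" for k using Qb[of k] by (elim exE conjE) simp
    define R where "R n = (\<Union>k<n. Q k)" for n
    have Rsets: "R n \<in> sets borel" for n unfolding R_def by auto
    have ind: "(\<lambda>x. indicator (A \<inter> R n) x) \<in> test_closure \<Omega>" if "A \<in> sets borel" for A n
    proof (induction n)
      case 0
      then show ?case using test_closure_test[OF \<Omega>b test_zero] by (simp add: R_def)
    next
      case (Suc n)
      obtain a b where ab: "Q n = box a b" "cbox a b \<subseteq> \<Omega>" using Qb by blast
      \<comment> \<open>Removing the boxes already treated turns the union into a disjoint one, so
        that indicators add.\<close>
      have 1: "(\<lambda>x. indicator ((A - R n) \<inter> Q n) x) \<in> test_closure \<Omega>"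
        unfolding ab(1) by (rule box_section_in_test_closure[OF \<Omega> ab(2)]) (use that Rsets in auto)
      have eq: "(\<lambda>x. indicator (A \<inter> R (Suc n)) x) = ((\<lambda>x. indicator (A \<inter> R n) x) + (\<lambda>x. indicator ((A - R n) \<inter> Q n) x) :: field)"
        by (auto simp: fun_eq_iff indicator_def R_def lessThan_Suc)
      show ?case unfolding eq by (rule test_closure_add[OF \<Omega>b Suc 1])
    qed
    obtain s where "\<forall>i. simple_function (vol \<Omega>) (s i)" "\<forall>x\<in>\<Omega>. (\<lambda>i. s i x) \<longlonglongrightarrow> f x"
      "\<forall>i. \<forall>x\<in>\<Omega>. cmod (s i x) \<le> 2 * cmod (f x)"
      using borel_measurable_implies_sequence_metric[OF l2_measurable[OF f], of 0]
      unfolding sp dist_0_norm dist_norm diff_zero by blast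
    then have s: "\<And>i. simple_function (vol \<Omega>) (s i)" "\<And>x. x \<in> \<Omega> \<Longrightarrow> (\<lambda>i. s i x) \<longlonglongrightarrow> f x"
      "\<And>i x. x \<in> \<Omega> \<Longrightarrow> cmod (s i x) \<le> 2 * cmod (f x)"
      by blast+
    define fn :: "nat \<Rightarrow> field" where
      "fn n = (\<lambda>x. \<Sum>y\<in>s n ` \<Omega>. y * indicator ({x\<in>\<Omega>. s n x = y} \<inter> R n) x)" for n
    have fin: "finite (s n ` \<Omega>)" for n using simple_functionD(1)[OF s(1)[of n]] by simp
    have fn_eq: "fn n x = s n x * indicator (R n) x" if "x \<in> \<Omega>" for n x
    proof -
      have "fn n x = (\<Sum>y\<in>s n ` \<Omega>. if y = s n x then y * indicator (R n) x else 0)"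
        unfolding fn_def using that by (intro sum.cong) (auto simp: indicator_def)
      then show ?thesis using fin that by simp
    qed
    have fn: "fn n \<in> test_closure \<Omega>" for n
    proof -
      have lev: "{x\<in>\<Omega>. s n x = y} \<in> sets borel" for y
      proof -
        have "s n -` {y} \<inter> space (vol \<Omega>) \<in> sets (vol \<Omega>)" by (rule simple_functionD(2)[OF s(1)])
        moreover have "s n -` {y} \<inter> space (vol \<Omega>) = {x\<in>\<Omega>. s n x = y}" by auto
        ultimately show ?thesis using \<Omega>b by (auto simp: sets_restrict_space_iff)
      qed
      have "(\<lambda>x. \<Sum>y\<in>Y. y * indicator ({x\<in>\<Omega>. s n x = y} \<inter> R n) x) \<in> test_closure \<Omega>" if "finite Y" for Y
        using that
      proof induction
        case empty
        then show ?case using test_closure_test[OF \<Omega>b test_zero] by simp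
      next
        case (insert y Y)
        show ?case
          using test_closure_add[OF \<Omega>b test_closure_cmult[OF \<Omega>b ind[OF lev[of y], of n], of y] insert.IH]
          unfolding sum.insert[OF insert.hyps] plus_fun_def .
      qed
      then show ?thesis unfolding fn_def using fin by blast
    qed
    show ?thesis
    proof (rule test_closure_dominated[OF \<Omega>b l2_measurable[OF f] l2_cmult[OF f, of 2] fn])
      fix n x assume x: "x \<in> \<Omega>"
      show "cmod (fn n x) \<le> cmod (2 * f x)"
        using s(3)[OF x, of n] by (auto simp: fn_eq[OF x] norm_mult indicator_def)
    next
      fix x assume x: "x \<in> \<Omega>"
      then obtain k where "x \<in> Q k" using UQ by blast
      then have "x \<in> R n" if "n > k" for n using that by (auto simp: R_def)
      then have "s n x = fn n x" if "n > k" for n using that by (simp add: fn_eq[OF x])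
      then have "\<forall>\<^sub>F n in sequentially. s n x = fn n x"
        using eventually_gt_at_top[of k] by (rule eventually_mono[rotated])
      with s(2)[OF x] show "(\<lambda>n. fn n x) \<longlonglongrightarrow> f x" using tendsto_cong by fast
    qed
  qed
qed

text \<open>For a test function \<open>\<psi>\<close> the squared norm of \<open>f\<close> equals
  \<open>ip M f (f - \<psi>)\<close>, with \<open>M\<close> the measure on \<open>\<Omega>\<close>.
  If \<open>\<psi>\<close> is closer to \<open>f\<close> than the norm of \<open>f\<close>,
  Cauchy-Schwarz makes this strictly smaller than the squared norm.\<close>

lemma l2_eq_zero_of_orthogonal:
  assumes \<Omega>: "open \<Omega>" "emeasure lborel \<Omega> < \<infinity>" and f: "f \<in> l2 (vol \<Omega>)"
    and orth: "\<And>\<psi>. \<psi> \<in> test_functions \<Omega> \<Longrightarrow> ip (vol \<Omega>) f \<psi> = 0"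
  shows "nrm (vol \<Omega>) f = 0"
proof (rule ccontr)
  assume "nrm (vol \<Omega>) f \<noteq> 0"
  then have pos: "nrm (vol \<Omega>) f > 0" using nrm_nonneg[of "vol \<Omega>" f] by linarith
  obtain \<psi> where \<psi>: "\<psi> \<in> test_functions \<Omega>" "nrm (vol \<Omega>) (f - \<psi>) < nrm (vol \<Omega>) f"
    by (rule test_closureE[OF test_functions_dense[OF \<Omega> f] pos])
  have \<psi>l: "\<psi> \<in> l2 (vol \<Omega>)" using \<Omega> \<psi> by (intro test_l2) auto
  have "(nrm (vol \<Omega>) f)\<^sup>2 = ip (vol \<Omega>) f (f - \<psi>)"
    using orth[OF \<psi>(1)] l2.B_diff[OF f \<psi>l f] ip_sym[of "vol \<Omega>" f \<psi>] ip_sym[of "vol \<Omega>" f "f - \<psi>"]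
    by (simp only: nrm_sq)
  also have "\<dots> \<le> nrm (vol \<Omega>) f * nrm (vol \<Omega>) (f - \<psi>)"
    using l2.B_Cauchy_Schwarz[of f "vol \<Omega>" "f - \<psi>"] f \<psi>l by auto
  also have "\<dots> < nrm (vol \<Omega>) f * nrm (vol \<Omega>) f" using pos \<psi> by (intro mult_strict_left_mono) auto
  finally show False by (simp add: power2_eq_square)
qed

section \<open>Weak derivatives\<close>

lemma ip_cong_null:
  assumes "f \<in> l2 M" "f' \<in> l2 M" "g \<in> l2 M" "nrm M (f - f') = 0"
  shows "ip M f g = ip M f' g"
  using l2.B_Cauchy_Schwarz[of "f - f'" M g] l2.B_diff[OF assms(1-3)] assms by simp

locale bounded_domain =
  fixes \<Omega> :: "R3 set"
  assumes open_domain: "open \<Omega>" and bounded_domain: "bounded \<Omega>"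
begin

abbreviation M where "M \<equiv> vol \<Omega>"
abbreviation test where "test \<equiv> test_functions \<Omega>"

lemma domain_borel [simp]: "\<Omega> \<in> sets borel"
  using open_domain by simp

lemma emeasure_domain: "emeasure lborel \<Omega> < \<infinity>"
  using bounded_domain by (rule emeasure_bounded_finite)

lemma test_in_l2 [simp]: "\<psi> \<in> test \<Longrightarrow> \<psi> \<in> l2 M"
  by (rule test_l2) simp

lemma l2_orthogonal: "f \<in> l2 M \<Longrightarrow> (\<And>\<psi>. \<psi> \<in> test \<Longrightarrow> ip M f \<psi> = 0) \<Longrightarrow> nrm M f = 0"
  by (rule l2_eq_zero_of_orthogonal[OF open_domain emeasure_domain])

text \<open>Distributions pair without conjugation; evaluating them at conjugated functions turns
  distributional identities into identities for \<open>ip\<close>.\<close>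

lemma Re_distr_of_cnj:
  assumes "f \<in> l2 M" "\<psi> \<in> l2 M"
  shows "Re (distr_of \<Omega> f (\<lambda>x. cnj (\<psi> x))) = ip M f \<psi>"
  using l2_integrable_mult_cnj[OF assms]
  by (simp add: distr_of_def ip_def inner_eq_Re_mult_cnj del: times_complex.sel complex_cnj)

text \<open>\<open>weak_partial\<close> is a choice among representatives and is linear only modulo
  null functions. The relation is linear on the nose.\<close>

definition weak_deriv :: "3 \<Rightarrow> field \<Rightarrow> field \<Rightarrow> bool" where
  "weak_deriv i u g \<longleftrightarrow> represents \<Omega> (distr_partial i (distr_of \<Omega> u)) g"

lemma weak_deriv_iff:
  "weak_deriv i u g \<longleftrightarrow> g \<in> l2 M \<and> (\<forall>\<psi>\<in>test. (LINT x|M. u x * partial i \<psi> x) = - (LINT x|M. g x * \<psi> x))"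
  by (auto simp: weak_deriv_def represents_def distr_partial_def distr_of_def L2_eq_l2)
    (metis minus_minus)

lemma weak_deriv_l2: "weak_deriv i u g \<Longrightarrow> g \<in> l2 M"
  by (simp add: weak_deriv_iff)

lemma weak_deriv_ip:
  assumes g: "weak_deriv i u g" and u: "u \<in> l2 M" and \<psi>: "\<psi> \<in> test"
  shows "ip M u (partial i \<psi>) = - ip M g \<psi>"
proof -
  have "partial i (\<lambda>x. cnj (\<psi> x)) = (\<lambda>x. cnj (partial i \<psi> x))"
    by (rule partial_cnj[OF test_smooth[OF \<psi>]])
  then have "distr_of \<Omega> u (\<lambda>x. cnj (partial i \<psi> x)) = - distr_of \<Omega> g (\<lambda>x. cnj (\<psi> x))"
    using g test_cnj[OF \<psi>] unfolding weak_deriv_iff distr_of_def by metis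
  then have "Re (distr_of \<Omega> u (\<lambda>x. cnj (partial i \<psi> x))) = - Re (distr_of \<Omega> g (\<lambda>x. cnj (\<psi> x)))"
    by simp
  then show ?thesis using u \<psi> weak_deriv_l2[OF g] by (simp add: Re_distr_of_cnj test_partial)
qed

lemma weak_deriv_unique:
  assumes g: "weak_deriv i u g" and g': "weak_deriv i u g'" and u: "u \<in> l2 M"
  shows "nrm M (g - g') = 0"
proof (rule l2_orthogonal)
  show "g - g' \<in> l2 M" using weak_deriv_l2[OF g] weak_deriv_l2[OF g'] by simp
  fix \<psi> assume \<psi>: "\<psi> \<in> test"
  show "ip M (g - g') \<psi> = 0"
    using weak_deriv_ip[OF g u \<psi>] weak_deriv_ip[OF g' u \<psi>] \<psi>
    by (simp add: l2.B_diff[OF weak_deriv_l2[OF g] weak_deriv_l2[OF g']])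
qed

lemma weak_deriv_add:
  assumes g: "weak_deriv i u g" and h: "weak_deriv i v h" and u: "u \<in> l2 M" and v: "v \<in> l2 M"
  shows "weak_deriv i (u + v) (g + h)"
  unfolding weak_deriv_iff
proof (intro conjI ballI)
  have gh: "g \<in> l2 M" "h \<in> l2 M" using g h by (auto dest: weak_deriv_l2)
  then show "g + h \<in> l2 M" by simp
  fix \<psi> assume \<psi>: "\<psi> \<in> test"
  have "(LINT x|M. u x * partial i \<psi> x + v x * partial i \<psi> x)
      = (LINT x|M. u x * partial i \<psi> x) + (LINT x|M. v x * partial i \<psi> x)"
    using u v \<psi> by (intro Bochner_Integration.integral_add l2_integrable_mult) (auto simp: test_partial)
  moreover have "(LINT x|M. g x * \<psi> x + h x * \<psi> x) = (LINT x|M. g x * \<psi> x) + (LINT x|M. h x * \<psi> x)"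
    using gh \<psi> by (intro Bochner_Integration.integral_add l2_integrable_mult) auto
  ultimately show "(LINT x|M. (u + v) x * partial i \<psi> x) = - (LINT x|M. (g + h) x * \<psi> x)"
    using g h \<psi> by (simp add: weak_deriv_iff distrib_right)
qed

lemma weak_deriv_scaleR:
  assumes g: "weak_deriv i u g"
  shows "weak_deriv i (r *\<^sub>R u) (r *\<^sub>R g)"
  using g by (simp add: weak_deriv_iff scaleR_fun_def scaleR_conv_of_real mult.assoc l2_cmult)

lemma integration_by_parts:
  assumes f: "smooth_on UNIV f" and \<psi>: "\<psi> \<in> test"
  shows "(LINT x|M. f x * partial i \<psi> x) = - (LINT x|M. partial i f x * \<psi> x)"
proof -
  have t: "(\<lambda>x. f x * \<psi> x) \<in> test" "(\<lambda>x. f x * partial i \<psi> x) \<in> test" "(\<lambda>x. partial i f x * \<psi> x) \<in> test"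
    using f \<psi> by (auto intro: test_smooth_mult test_partial smooth_partial)
  have "0 = (LINT x|lborel. partial i (\<lambda>x. f x * \<psi> x) x)" by (rule integral_partial_zero[OF t(1), symmetric])
  also have "\<dots> = (LINT x|lborel. f x * partial i \<psi> x + partial i f x * \<psi> x)"
    by (simp add: partial_mult[OF f test_smooth[OF \<psi>]])
  also have "\<dots> = (LINT x|lborel. f x * partial i \<psi> x) + (LINT x|lborel. partial i f x * \<psi> x)"
    by (intro Bochner_Integration.integral_add test_integrable[OF t(2)] test_integrable[OF t(3)])
  finally show ?thesis
    using vanishing_integral(2)[OF domain_borel test_vanishes[OF t(2)]]
      vanishing_integral(2)[OF domain_borel test_vanishes[OF t(3)]]
    by (simp add: eq_neg_iff_add_eq_0)
qed

lemma weak_deriv_test: "\<psi> \<in> test \<Longrightarrow> weak_deriv i \<psi> (partial i \<psi>)"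
  by (simp add: weak_deriv_iff integration_by_parts test_smooth test_partial)

lemma H1_iff: "u \<in> H1 \<Omega> \<longleftrightarrow> u \<in> l2 M \<and> (\<forall>i. \<exists>g. weak_deriv i u g)"
  by (simp add: H1_def L2_eq_l2 distr_in_L2_def weak_deriv_def)

lemma H1_l2 [simp]: "u \<in> H1 \<Omega> \<Longrightarrow> u \<in> l2 M"
  by (simp add: H1_iff)

lemma weak_partial: "u \<in> H1 \<Omega> \<Longrightarrow> weak_deriv i u (weak_partial \<Omega> i u)"
  unfolding H1_iff weak_deriv_def weak_partial_def L2_rep_def
  by (rule someI_ex[of "represents \<Omega> (distr_partial i (distr_of \<Omega> u))"]) blast

lemma weak_partial_l2 [simp]: "u \<in> H1 \<Omega> \<Longrightarrow> weak_partial \<Omega> i u \<in> l2 M"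
  using weak_partial weak_deriv_l2 by blast

lemma H1_add: "u \<in> H1 \<Omega> \<Longrightarrow> v \<in> H1 \<Omega> \<Longrightarrow> u + v \<in> H1 \<Omega>"
  unfolding H1_iff using weak_deriv_add by (metis l2.X_add)

lemma H1_scaleR: "u \<in> H1 \<Omega> \<Longrightarrow> r *\<^sub>R u \<in> H1 \<Omega>"
  unfolding H1_iff using weak_deriv_scaleR by (metis l2.X_scale)

lemma test_H1 [simp]: "\<psi> \<in> test \<Longrightarrow> \<psi> \<in> H1 \<Omega>"
  unfolding H1_iff using weak_deriv_test by auto

definition grad_ip :: "field \<Rightarrow> field \<Rightarrow> real" where
  "grad_ip u w = (\<Sum>i\<in>UNIV. ip M (weak_partial \<Omega> i u) (weak_partial \<Omega> i w))"

lemma Re_grad_inner: "u \<in> H1 \<Omega> \<Longrightarrow> w \<in> H1 \<Omega> \<Longrightarrow> Re (grad_inner \<Omega> u w) = grad_ip u w"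
  by (simp add: grad_inner_def grad_ip_def Re_L2_inner L2_eq_l2)

lemma grad_ip_sym: "grad_ip u w = grad_ip w u"
  by (simp add: grad_ip_def ip_sym)

text \<open>Weak derivatives agree up to null functions, so any of them may replace the chosen one;
  linearity of \<open>grad_ip\<close> follows from that of \<open>weak_deriv\<close>.\<close>

lemma grad_ip_weak_deriv:
  assumes "u \<in> H1 \<Omega>" "w \<in> H1 \<Omega>" and g: "\<And>i. weak_deriv i u (g i)"
  shows "grad_ip u w = (\<Sum>i\<in>UNIV. ip M (g i) (weak_partial \<Omega> i w))"
  unfolding grad_ip_def
  using assms weak_deriv_unique[OF weak_partial g] by (intro sum.cong ip_cong_null) (auto dest: weak_deriv_l2)

lemma grad_ip_add:
  assumes "u \<in> H1 \<Omega>" "v \<in> H1 \<Omega>" "w \<in> H1 \<Omega>"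
  shows "grad_ip (u + v) w = grad_ip u w + grad_ip v w"
proof -
  have "grad_ip (u + v) w = (\<Sum>i\<in>UNIV. ip M (weak_partial \<Omega> i u + weak_partial \<Omega> i v) (weak_partial \<Omega> i w))"
    using assms by (intro grad_ip_weak_deriv H1_add weak_deriv_add weak_partial) auto
  then show ?thesis using assms by (simp add: grad_ip_def l2.B_add sum.distrib)
qed

lemma grad_ip_scaleR:
  assumes "u \<in> H1 \<Omega>" "w \<in> H1 \<Omega>"
  shows "grad_ip (r *\<^sub>R u) w = r * grad_ip u w"
proof -
  have "grad_ip (r *\<^sub>R u) w = (\<Sum>i\<in>UNIV. ip M (r *\<^sub>R weak_partial \<Omega> i u) (weak_partial \<Omega> i w))"
    using assms by (intro grad_ip_weak_deriv H1_scaleR weak_deriv_scaleR weak_partial)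
  then show ?thesis using assms by (simp add: grad_ip_def l2.B_scale sum_distrib_left)
qed

lemma H1_zero: "0 \<in> H1 \<Omega>"
  using test_H1[OF test_zero] by (simp add: zero_fun_def)

lemma H1_subspace: "subspace (H1 \<Omega>)"
  by (simp add: subspace_def H1_zero H1_add H1_scaleR)

sublocale grad: seminormed_subspace "H1 \<Omega>" grad_ip
proof
  show "grad_ip P P \<ge> 0" for P
    unfolding grad_ip_def by (intro sum_nonneg) (simp add: nrm_sq[symmetric])
qed (rule H1_subspace grad_ip_sym grad_ip_add grad_ip_scaleR; assumption)+

lemma nrm_weak_partial_le: "u \<in> H1 \<Omega> \<Longrightarrow> nrm M (weak_partial \<Omega> i u) \<le> grad.N u"
  unfolding grad.N_def nrm_def grad_ip_def
  by (intro real_sqrt_le_mono member_le_sum[of i UNIV "\<lambda>i. ip M (weak_partial \<Omega> i u) (weak_partial \<Omega> i u)"])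
    (auto simp: nrm_sq[symmetric])

lemma H1_norm_bounds:
  assumes "u \<in> H1 \<Omega>"
  shows "nrm M u \<le> H1_norm \<Omega> u" "grad.N u \<le> H1_norm \<Omega> u" "H1_norm \<Omega> u \<le> nrm M u + grad.N u"
proof -
  have eq: "H1_norm \<Omega> u = sqrt ((nrm M u)\<^sup>2 + (grad.N u)\<^sup>2)"
    using assms by (simp add: H1_norm_def L2_norm_eq_nrm nrm_sq grad.N_sq grad_ip_def)
  show "nrm M u \<le> H1_norm \<Omega> u" unfolding eq by (rule real_le_rsqrt) simp
  show "grad.N u \<le> H1_norm \<Omega> u" unfolding eq by (rule real_le_rsqrt) simp
  show "H1_norm \<Omega> u \<le> nrm M u + grad.N u" unfolding eq
    using assms by (intro sqrt_sum_squares_le_sum) auto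
qed

section \<open>The closure of the test functions and the Poincare inequality\<close>

lemma H10_H1 [simp]: "u \<in> H10 \<Omega> \<Longrightarrow> u \<in> H1 \<Omega>"
  by (simp add: H10_def)

lemma H10_approx:
  assumes "u \<in> H10 \<Omega>" "e > 0"
  obtains \<psi> where "\<psi> \<in> test" "nrm M (u - \<psi>) < e" "grad.N (u - \<psi>) < e"
proof -
  obtain \<psi> where \<psi>: "\<psi> \<in> test" "H1_norm \<Omega> (\<lambda>x. u x - \<psi> x) < e"
    using assms unfolding H10_def by blast
  have "u - \<psi> \<in> H1 \<Omega>" using assms \<psi> by simp
  from H1_norm_bounds[OF this] \<psi> show thesis by (intro that[of \<psi>]) (auto simp: fun_diff_def)
qed

lemma H10_I:
  assumes u: "u \<in> H1 \<Omega>"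
    and approx: "\<And>e. e > 0 \<Longrightarrow> \<exists>\<psi>\<in>test. nrm M (u - \<psi>) < e \<and> grad.N (u - \<psi>) < e"
  shows "u \<in> H10 \<Omega>"
  unfolding H10_def
proof (intro CollectI conjI allI impI u)
  fix e :: real assume "e > 0"
  then obtain \<psi> where \<psi>: "\<psi> \<in> test" "nrm M (u - \<psi>) < e / 2" "grad.N (u - \<psi>) < e / 2"
    using approx[of "e / 2"] by auto
  have "H1_norm \<Omega> (u - \<psi>) < e" using H1_norm_bounds(3)[of "u - \<psi>"] u \<psi> by simp
  then show "\<exists>\<psi>\<in>test. H1_norm \<Omega> (\<lambda>x. u x - \<psi> x) < e" using \<psi> by (intro bexI[of _ \<psi>]) (simp_all add: fun_diff_def)
qed

lemma test_H10 [simp]: "\<psi> \<in> test \<Longrightarrow> \<psi> \<in> H10 \<Omega>"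
  by (rule H10_I) (auto intro!: bexI[of _ \<psi>])

lemma test_add_fun: "\<psi> \<in> test \<Longrightarrow> \<theta> \<in> test \<Longrightarrow> \<psi> + \<theta> \<in> test"
  using test_add by (simp add: plus_fun_def)

lemma test_scaleR_fun: "\<psi> \<in> test \<Longrightarrow> r *\<^sub>R \<psi> \<in> test"
  using test_scaleR by (simp add: scaleR_fun_def)

lemma H10_add:
  assumes u: "u \<in> H10 \<Omega>" and v: "v \<in> H10 \<Omega>"
  shows "u + v \<in> H10 \<Omega>"
proof (rule H10_I)
  show "u + v \<in> H1 \<Omega>" using u v by simp
  fix e :: real assume "e > 0"
  then have e: "e / 2 > 0" by simp
  obtain \<psi> where \<psi>: "\<psi> \<in> test" "nrm M (u - \<psi>) < e / 2" "grad.N (u - \<psi>) < e / 2" by (rule H10_approx[OF u e])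
  obtain \<theta> where \<theta>: "\<theta> \<in> test" "nrm M (v - \<theta>) < e / 2" "grad.N (v - \<theta>) < e / 2" by (rule H10_approx[OF v e])
  have eq: "u + v - (\<psi> + \<theta>) = (u - \<psi>) + (v - \<theta>)" by simp
  have "nrm M ((u - \<psi>) + (v - \<theta>)) \<le> nrm M (u - \<psi>) + nrm M (v - \<theta>)"
    using u v \<psi> \<theta> by (intro l2.N_triangle) auto
  moreover have "grad.N ((u - \<psi>) + (v - \<theta>)) \<le> grad.N (u - \<psi>) + grad.N (v - \<theta>)"
    using u v \<psi> \<theta> by (intro grad.N_triangle) auto
  ultimately have "nrm M (u + v - (\<psi> + \<theta>)) < e \<and> grad.N (u + v - (\<psi> + \<theta>)) < e"
    unfolding eq using \<psi> \<theta> by linarith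
  then show "\<exists>\<psi>\<in>test. nrm M (u + v - \<psi>) < e \<and> grad.N (u + v - \<psi>) < e"
    using test_add_fun[OF \<psi>(1) \<theta>(1)] by blast
qed

lemma H10_scaleR:
  assumes u: "u \<in> H10 \<Omega>"
  shows "r *\<^sub>R u \<in> H10 \<Omega>"
proof (rule H10_I)
  show "r *\<^sub>R u \<in> H1 \<Omega>" using u by simp
  fix e :: real assume e: "e > 0"
  have r: "\<bar>r\<bar> + 1 > 0" by simp
  obtain \<psi> where \<psi>: "\<psi> \<in> test" "nrm M (u - \<psi>) < e / (\<bar>r\<bar> + 1)" "grad.N (u - \<psi>) < e / (\<bar>r\<bar> + 1)"
    by (rule H10_approx[OF u divide_pos_pos[OF e r]])
  have eq: "r *\<^sub>R u - r *\<^sub>R \<psi> = r *\<^sub>R (u - \<psi>)" by (simp add: scaleR_diff_right)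
  have small: "\<bar>r\<bar> * x < e" if "x < e / (\<bar>r\<bar> + 1)" "x \<ge> 0" for x
  proof -
    have "\<bar>r\<bar> * x \<le> (\<bar>r\<bar> + 1) * x" using that by (simp add: algebra_simps)
    also have "\<dots> < e" using that r by (simp add: field_simps)
    finally show ?thesis .
  qed
  have "nrm M (r *\<^sub>R (u - \<psi>)) < e" "grad.N (r *\<^sub>R (u - \<psi>)) < e"
    using u \<psi> by (simp_all add: l2.N_scale grad.N_scale small)
  then show "\<exists>\<psi>\<in>test. nrm M (r *\<^sub>R u - \<psi>) < e \<and> grad.N (r *\<^sub>R u - \<psi>) < e"
    unfolding eq[symmetric] using test_scaleR_fun[OF \<psi>(1)] by blast
qed

lemma H10_subspace: "subspace (H10 \<Omega>)"
  using test_H10[OF test_zero] by (simp add: subspace_def H10_add H10_scaleR zero_fun_def)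

text \<open>An additive functional that is bounded for the \<open>H1\<close> norm is determined on
  \<open>H10 \<Omega>\<close> by its values on test functions. Weak equations are extended from test
  functions to velocities and displacements in this way.\<close>

lemma H10_functional_zero:
  assumes diff: "\<And>u v. u \<in> H1 \<Omega> \<Longrightarrow> v \<in> H1 \<Omega> \<Longrightarrow> F (u - v) = F u - F v"
    and bound: "\<And>u. u \<in> H1 \<Omega> \<Longrightarrow> \<bar>F u\<bar> \<le> K * nrm M u + L * grad.N u"
    and zero: "\<And>\<psi>. \<psi> \<in> test \<Longrightarrow> F \<psi> = (0 :: real)" and w: "w \<in> H10 \<Omega>"
  shows "F w = 0"
proof (rule ccontr)
  assume nz: "F w \<noteq> 0"
  define p where "p = \<bar>K\<bar> + \<bar>L\<bar> + 1"
  define e where "e = \<bar>F w\<bar> / (2 * p)"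
  have p: "p > 0" by (simp add: p_def)
  have e: "e > 0" using nz p by (simp add: e_def)
  obtain \<psi> where \<psi>: "\<psi> \<in> test" "nrm M (w - \<psi>) < e" "grad.N (w - \<psi>) < e" by (rule H10_approx[OF w e])
  have "\<bar>F w\<bar> = \<bar>F (w - \<psi>)\<bar>" using diff[of w \<psi>] zero[OF \<psi>(1)] w \<psi> by simp
  also have "\<dots> \<le> K * nrm M (w - \<psi>) + L * grad.N (w - \<psi>)" using w \<psi> by (intro bound) auto
  also have "\<dots> \<le> \<bar>K\<bar> * e + \<bar>L\<bar> * e"
    using \<psi> w by (intro add_mono mult_mono) auto
  also have "\<dots> \<le> p * e" using e by (simp add: p_def algebra_simps)
  also have "\<dots> = \<bar>F w\<bar> / 2" using p by (simp add: e_def)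
  finally show False using nz by simp
qed

lemma poincare_test:
  assumes R: "\<And>x. x \<in> \<Omega> \<Longrightarrow> \<bar>x $ i\<bar> \<le> R" "R > 0" and \<psi>: "\<psi> \<in> test"
  shows "nrm M \<psi> \<le> 2 * R * nrm M (partial i \<psi>)"
proof -
  define c :: field where "c = (\<lambda>x. of_real (x $ i))"
  have sm: "smooth_on UNIV \<psi>" "smooth_on UNIV c" "smooth_on UNIV (\<lambda>x. cnj (\<psi> x))"
    using test_smooth[OF \<psi>] smooth_coord by (auto simp: c_def smooth_cnj)
  have c\<psi>: "(\<lambda>x. c x * \<psi> x) \<in> test" by (rule test_smooth_mult[OF \<psi> sm(2)])
  have p\<psi>: "partial i \<psi> \<in> test" by (rule test_partial[OF \<psi>])
  text \<open>Integrate \<open>\<partial>\<^sub>i (x\<^sub>i \<bar>\<psi>\<bar>\<^sup>2)\<close>.\<close>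
  have "(LINT x|M. cnj (\<psi> x) * partial i (\<lambda>x. c x * \<psi> x) x)
      = - (LINT x|M. partial i (\<lambda>x. cnj (\<psi> x)) x * (c x * \<psi> x))"
    by (rule integration_by_parts[OF sm(3) c\<psi>])
  moreover have "partial i (\<lambda>x. c x * \<psi> x) = (\<lambda>x. c x * partial i \<psi> x + \<psi> x)"
    using partial_mult[OF sm(2,1), of i] by (simp add: c_def partial_coord)
  moreover have "partial i (\<lambda>x. cnj (\<psi> x)) = (\<lambda>x. cnj (partial i \<psi> x))" by (rule partial_cnj[OF sm(1)])
  ultimately have "(LINT x|M. (c x * partial i \<psi> x + \<psi> x) * cnj (\<psi> x))
      = - (LINT x|M. (c x * \<psi> x) * cnj (partial i \<psi> x))"
    by (simp add: mult.commute)
  moreover have cp: "(\<lambda>x. c x * partial i \<psi> x) \<in> test" by (rule test_smooth_mult[OF p\<psi> sm(2)])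
  have "Re (LINT x|M. (c x * partial i \<psi> x + \<psi> x) * cnj (\<psi> x)) = ip M (\<lambda>x. c x * partial i \<psi> x + \<psi> x) \<psi>"
    using Re_distr_of_cnj[OF test_in_l2[OF test_add[OF cp \<psi>]] test_in_l2[OF \<psi>]] by (simp add: distr_of_def)
  moreover have "Re (LINT x|M. (c x * \<psi> x) * cnj (partial i \<psi> x)) = ip M (\<lambda>x. c x * \<psi> x) (partial i \<psi>)"
    using Re_distr_of_cnj[OF test_in_l2[OF c\<psi>] test_in_l2[OF p\<psi>]] by (simp add: distr_of_def)
  ultimately have "ip M (\<lambda>x. c x * partial i \<psi> x + \<psi> x) \<psi> = - ip M (\<lambda>x. c x * \<psi> x) (partial i \<psi>)"
    by (metis uminus_complex.sel(1))
  moreover have "ip M (\<lambda>x. c x * partial i \<psi> x + \<psi> x) \<psi> = ip M (\<lambda>x. c x * partial i \<psi> x) \<psi> + ip M \<psi> \<psi>"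
    using l2.B_add[of "\<lambda>x. c x * partial i \<psi> x" M \<psi> \<psi>] \<psi> cp by (simp add: plus_fun_def)
  \<comment> \<open>The coordinate is real and moves across the product, so the two cross terms
    coincide; this is the source of the factor 2.\<close>
  moreover have "ip M (\<lambda>x. c x * partial i \<psi> x) \<psi> = ip M (\<lambda>x. c x * \<psi> x) (partial i \<psi>)"
    unfolding ip_def c_def by (simp add: inner_complex_def algebra_simps)
  ultimately have "(nrm M \<psi>)\<^sup>2 = - 2 * ip M (\<lambda>x. c x * \<psi> x) (partial i \<psi>)" by (simp add: nrm_sq)
  also have "\<dots> \<le> 2 * (nrm M (\<lambda>x. c x * \<psi> x) * nrm M (partial i \<psi>))"
    using l2.B_Cauchy_Schwarz[OF test_in_l2[OF c\<psi>] test_in_l2[OF p\<psi>]] by linarith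
  also have "nrm M (\<lambda>x. c x * \<psi> x) \<le> nrm M (\<lambda>x. of_real R * \<psi> x)"
    using R \<psi> c\<psi>
    by (intro nrm_mono l2_cmult AE_I2)
      (auto simp: c_def norm_mult space_restrict_space intro!: mult_right_mono dest: test_in_l2 l2_measurable)
  also have "\<dots> = R * nrm M \<psi>" using R by (simp add: nrm_cmult)
  finally have "nrm M \<psi> * nrm M \<psi> \<le> (2 * R * nrm M (partial i \<psi>)) * nrm M \<psi>"
    by (simp add: power2_eq_square mult_right_mono mult_ac)
  then show ?thesis
    using R nrm_nonneg[of M \<psi>] by (cases "nrm M \<psi> = 0") (auto simp: mult_le_cancel_right)
qed

lemma weak_partial_diff_test:
  assumes "u \<in> H1 \<Omega>" "\<psi> \<in> test"
  shows "nrm M (weak_partial \<Omega> i u - partial i \<psi>) \<le> grad.N (u - \<psi>)"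
proof -
  have u\<psi>: "u - \<psi> \<in> H1 \<Omega>" using assms by simp
  have "weak_deriv i (u + (-1) *\<^sub>R \<psi>) (weak_partial \<Omega> i u + (-1) *\<^sub>R partial i \<psi>)"
    using assms by (intro weak_deriv_add weak_deriv_scaleR weak_partial weak_deriv_test)
      (auto intro: subspace_neg[OF l2.subspace])
  then have wd: "weak_deriv i (u - \<psi>) (weak_partial \<Omega> i u - partial i \<psi>)" by simp
  have "nrm M (weak_partial \<Omega> i u - partial i \<psi>) \<le> nrm M (weak_partial \<Omega> i (u - \<psi>)) +
      nrm M (weak_partial \<Omega> i u - partial i \<psi> - weak_partial \<Omega> i (u - \<psi>))"
    using weak_deriv_l2[OF wd] u\<psi> by (intro l2.N_le_add_diff) auto
  also have "nrm M (weak_partial \<Omega> i u - partial i \<psi> - weak_partial \<Omega> i (u - \<psi>)) = 0"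
    using weak_deriv_unique[OF wd weak_partial[OF u\<psi>]] u\<psi> by simp
  finally show ?thesis using nrm_weak_partial_le[OF u\<psi>, of i] by linarith
qed

text \<open>A bound on one coordinate of the domain gives the constant for test functions, and
  density extends it. The error is chosen as \<open>e / (1 + 2 * R)\<close> because it enters once
  directly and once with factor \<open>2 * R\<close>.\<close>

lemma poincare:
  obtains K where "K > 0" "\<And>u. u \<in> H10 \<Omega> \<Longrightarrow> nrm M u \<le> K * grad.N u"
proof -
  obtain R where R: "R > 0" "\<And>x. x \<in> \<Omega> \<Longrightarrow> norm x \<le> R"
    using bounded_domain unfolding bounded_pos by blast
  have R1: "\<bar>x $ 1\<bar> \<le> R" if "x \<in> \<Omega>" for x
    using R(2)[OF that] component_le_norm_cart[of x 1] by linarith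
  have "nrm M u \<le> 2 * R * grad.N u" if u: "u \<in> H10 \<Omega>" for u
  proof (rule field_le_epsilon)
    fix e :: real assume e: "e > 0"
    have p: "1 + 2 * R > 0" using R by simp
    obtain \<psi> where \<psi>: "\<psi> \<in> test" "nrm M (u - \<psi>) < e / (1 + 2 * R)" "grad.N (u - \<psi>) < e / (1 + 2 * R)"
      by (rule H10_approx[OF u divide_pos_pos[OF e p]])
    have "nrm M u \<le> nrm M \<psi> + nrm M (u - \<psi>)" using u \<psi> by (intro l2.N_le_add_diff) auto
    also have "nrm M \<psi> \<le> 2 * R * nrm M (partial 1 \<psi>)" using R R1 \<psi> by (intro poincare_test)
    also have "nrm M (partial 1 \<psi>) \<le> nrm M (weak_partial \<Omega> 1 u) + nrm M (weak_partial \<Omega> 1 u - partial 1 \<psi>)"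
      using l2.N_le_add_diff[of "partial 1 \<psi>" M "weak_partial \<Omega> 1 u"] u \<psi>
      by (simp add: test_partial l2.N_diff_commute[of "partial 1 \<psi>"])
    also have "nrm M (weak_partial \<Omega> 1 u - partial 1 \<psi>) \<le> grad.N (u - \<psi>)"
      using u \<psi> by (intro weak_partial_diff_test) auto
    also have "nrm M (weak_partial \<Omega> 1 u) \<le> grad.N u" using u by (intro nrm_weak_partial_le) auto
    also have "2 * R * (grad.N u + grad.N (u - \<psi>)) + nrm M (u - \<psi>)
        \<le> 2 * R * (grad.N u + e / (1 + 2 * R)) + e / (1 + 2 * R)"
      using R \<psi> by (intro add_mono mult_left_mono) auto
    also have "\<dots> = 2 * R * grad.N u + (1 + 2 * R) * (e / (1 + 2 * R))" by (simp only: ring_distribs)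
    also have "\<dots> = 2 * R * grad.N u + e" using p by simp
    finally show "nrm M u \<le> 2 * R * grad.N u + e" using R by (simp add: mult_left_mono)
  qed
  then show thesis using R by (intro that[of "2 * R"]) auto
qed

end

section \<open>The diffusive coupling\<close>

text \<open>\<open>mu\<close> is never square integrable at infinity. Dividing by
  \<open>sqrt (1 + \<xi>\<^sup>2)\<close> makes it so, and the factor taken away is absorbed by a
  diffusive variable from the domain.\<close>

definition mu_weight :: "real \<Rightarrow> real \<Rightarrow> real" where
  "mu_weight \<alpha> \<xi> = mu \<alpha> \<xi> / sqrt (1 + \<xi>\<^sup>2)"

lemma mu_measurable [measurable]: "mu \<alpha> \<in> borel_measurable borel"
  unfolding mu_def by measurable

lemma mu_weight_measurable [measurable]: "mu_weight \<alpha> \<in> borel_measurable borel"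
  unfolding mu_weight_def by measurable

lemma one_plus_square_pos [simp]: "1 + \<xi>\<^sup>2 > (0 :: real)" "1 + \<xi>\<^sup>2 \<noteq> (0 :: real)"
proof -
  show "1 + \<xi>\<^sup>2 > (0 :: real)" by (rule add_pos_nonneg) auto
  then show "1 + \<xi>\<^sup>2 \<noteq> (0 :: real)" by auto
qed

lemma mu_sq: "(mu \<alpha> \<xi>)\<^sup>2 = \<bar>\<xi>\<bar> powr (2 * \<alpha> - 1)"
proof -
  have "(mu \<alpha> \<xi>)\<^sup>2 = \<bar>\<xi>\<bar> powr ((2 * \<alpha> - 1) / 2 + (2 * \<alpha> - 1) / 2)"
    by (simp only: mu_def powr_add power2_eq_square)
  then show ?thesis by simp
qed

lemma mu_weight_sq: "(mu_weight \<alpha> \<xi>)\<^sup>2 = (mu \<alpha> \<xi>)\<^sup>2 / (1 + \<xi>\<^sup>2)"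
  by (simp add: mu_weight_def power_divide)

text \<open>Near 0 the square behaves like the power \<open>2 * \<alpha> - 1\<close>, integrable
  since \<open>\<alpha> > 0\<close>; at infinity like the power \<open>2 * \<alpha> - 3\<close>,
  integrable since \<open>\<alpha> < 1\<close>.\<close>

lemma integrable_mu_weight_sq:
  assumes "0 < \<alpha>" "\<alpha> < 1"
  shows "integrable lborel (\<lambda>\<xi>. (mu_weight \<alpha> \<xi>)\<^sup>2)"
proof -
  have "(\<lambda>x. x powr (2 * \<alpha> - 1)) integrable_on {0..1}"
    using assms by (intro integrable_on_powr_from_0) auto
  then have "(\<lambda>x. x powr (2 * \<alpha> - 1)) absolutely_integrable_on {0..1}"
    by (subst absolutely_integrable_on_iff_nonneg) auto
  then have 1: "integrable lborel (\<lambda>x. indicat_real {0..1} x *\<^sub>R x powr (2 * \<alpha> - 1))"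
    unfolding set_integrable_def by (subst (asm) integrable_completion) auto
  have "(\<lambda>x. x powr (2 * \<alpha> - 3)) integrable_on {1..}"
    using assms by (intro has_integral_integrable[OF has_integral_powr_to_inf]) auto
  then have "(\<lambda>x. x powr (2 * \<alpha> - 3)) absolutely_integrable_on {1..}"
    by (subst absolutely_integrable_on_iff_nonneg) auto
  then have 2: "integrable lborel (\<lambda>x. indicat_real {1..} x *\<^sub>R x powr (2 * \<alpha> - 3))"
    unfolding set_integrable_def by (subst (asm) integrable_completion) auto
  define h where "h x = indicat_real {0..1} x *\<^sub>R x powr (2 * \<alpha> - 1) + indicat_real {1..} x *\<^sub>R x powr (2 * \<alpha> - 3)" for x
  have h: "integrable lborel h" unfolding h_def using 1 2 by (rule Bochner_Integration.integrable_add)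
  have h': "integrable lborel (\<lambda>x. h (- x))"
    using lborel_integrable_real_affine_iff[of "-1" h 0] h by simp
  have h0: "h x \<ge> 0" for x by (simp add: h_def)
  have le: "(mu_weight \<alpha> \<xi>)\<^sup>2 \<le> h \<bar>\<xi>\<bar>" for \<xi>
  proof (cases "\<bar>\<xi>\<bar> \<le> 1")
    case True
    have "(mu_weight \<alpha> \<xi>)\<^sup>2 \<le> \<bar>\<xi>\<bar> powr (2 * \<alpha> - 1) / 1"
      unfolding mu_weight_sq mu_sq by (intro divide_left_mono) auto
    also have "\<dots> \<le> h \<bar>\<xi>\<bar>" using True by (simp add: h_def)
    finally show ?thesis .
  next
    case False
    have "(mu_weight \<alpha> \<xi>)\<^sup>2 \<le> \<bar>\<xi>\<bar> powr (2 * \<alpha> - 1) / \<xi>\<^sup>2"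
      unfolding mu_weight_sq mu_sq using False by (intro divide_left_mono mult_pos_pos) auto
    also have "\<xi>\<^sup>2 = \<bar>\<xi>\<bar> powr 2" using False by (simp add: powr_numeral)
    also have "\<bar>\<xi>\<bar> powr (2 * \<alpha> - 1) / \<bar>\<xi>\<bar> powr 2 = \<bar>\<xi>\<bar> powr (2 * \<alpha> - 3)"
      using powr_diff[of "\<bar>\<xi>\<bar>" "2 * \<alpha> - 1" 2] by simp
    also have "\<dots> \<le> h \<bar>\<xi>\<bar>" using False by (simp add: h_def)
    finally show ?thesis .
  qed
  show ?thesis
  proof (rule Bochner_Integration.integrable_bound[OF Bochner_Integration.integrable_add[OF h h']])
    have "(mu_weight \<alpha> \<xi>)\<^sup>2 \<le> h \<xi> + h (- \<xi>)" for \<xi>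
      using le[of \<xi>] h0[of \<xi>] h0[of "- \<xi>"] by (cases "\<xi> \<ge> 0") auto
    then show "AE \<xi> in lborel. norm ((mu_weight \<alpha> \<xi>)\<^sup>2) \<le> norm (h \<xi> + h (- \<xi>))"
      by (auto intro!: AE_I2 order_trans[OF _ abs_ge_self])
  qed simp
qed

text \<open>On bounded frequencies the weight costs at most the factor
  \<open>1 + b\<^sup>2\<close>.\<close>

lemma integrable_mu_sq_bounded:
  assumes "0 < \<alpha>" "\<alpha> < 1" and S: "S \<in> sets borel" "\<And>\<xi>. \<xi> \<in> S \<Longrightarrow> \<bar>\<xi>\<bar> \<le> b"
  shows "integrable lborel (\<lambda>\<xi>. (indicator S \<xi> * mu \<alpha> \<xi>)\<^sup>2)"
proof (rule Bochner_Integration.integrable_bound)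
  show "integrable lborel (\<lambda>\<xi>. (1 + b\<^sup>2) * (mu_weight \<alpha> \<xi>)\<^sup>2)"
    using assms by (intro integrable_mult_right integrable_mu_weight_sq) auto
  have "(indicator S \<xi> * mu \<alpha> \<xi>)\<^sup>2 \<le> (1 + b\<^sup>2) * (mu_weight \<alpha> \<xi>)\<^sup>2" for \<xi>
  proof (cases "\<xi> \<in> S")
    case True
    then have "\<xi>\<^sup>2 \<le> b\<^sup>2" using S(2)[OF True] by (metis abs_le_square_iff abs_ge_self abs_idempotent order_trans)
    then have "(1 + \<xi>\<^sup>2) * (mu_weight \<alpha> \<xi>)\<^sup>2 \<le> (1 + b\<^sup>2) * (mu_weight \<alpha> \<xi>)\<^sup>2" by (intro mult_right_mono) auto
    then show ?thesis using True by (simp add: mu_weight_sq)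
  qed simp
  then show "AE \<xi> in lborel. norm ((indicator S \<xi> * mu \<alpha> \<xi>)\<^sup>2) \<le> norm ((1 + b\<^sup>2) * (mu_weight \<alpha> \<xi>)\<^sup>2)"
    by (auto intro!: AE_I2 order_trans[OF _ abs_ge_self])
  show "(\<lambda>\<xi>. (indicator S \<xi> * mu \<alpha> \<xi>)\<^sup>2) \<in> borel_measurable lborel" using S by measurable
qed

definition weighted :: "(real \<Rightarrow> field) \<Rightarrow> real \<times> R3 \<Rightarrow> complex" where
  "weighted \<phi> = (\<lambda>(\<xi>, x). of_real (sqrt (1 + \<xi>\<^sup>2)) * \<phi> \<xi> x)"

definition tensor :: "(real \<Rightarrow> real) \<Rightarrow> field \<Rightarrow> real \<times> R3 \<Rightarrow> complex" where
  "tensor a f = (\<lambda>(\<xi>, x). of_real (a \<xi>) * f x)"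

locale diffusive_domain = bounded_domain +
  fixes \<alpha> :: real
  assumes \<alpha>: "0 < \<alpha>" "\<alpha> < 1"
begin

abbreviation Z where "Z \<equiv> cyl \<Omega>"

sublocale pair: pair_sigma_finite lborel M
  by (rule pair_sigma_finite_lborel_vol) simp

lemma tensor_in_l2: "a \<in> borel_measurable borel \<Longrightarrow> integrable lborel (\<lambda>\<xi>. (a \<xi>)\<^sup>2) \<Longrightarrow> f \<in> l2 M \<Longrightarrow> tensor a f \<in> l2 Z"
  and nrm_tensor: "a \<in> borel_measurable borel \<Longrightarrow> integrable lborel (\<lambda>\<xi>. (a \<xi>)\<^sup>2) \<Longrightarrow> f \<in> l2 M \<Longrightarrow>
    nrm Z (tensor a f) = sqrt (LINT \<xi>|lborel. (a \<xi>)\<^sup>2) * nrm M f"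
  using tensor_l2[OF domain_borel] by (simp_all add: tensor_def nrm_def real_sqrt_mult)

lemma L2L2_l2: "\<phi> \<in> L2L2 \<Omega> \<longleftrightarrow> case_prod \<phi> \<in> l2 Z"
  by (rule L2L2_iff) simp

lemma weighted_l2:
  assumes "\<phi> \<in> L2L2 \<Omega>" "(\<lambda>\<xi> x. of_real \<xi> * \<phi> \<xi> x) \<in> L2L2 \<Omega>"
  shows "weighted \<phi> \<in> l2 Z"
proof -
  have 1: "case_prod \<phi> \<in> l2 Z" "case_prod (\<lambda>\<xi> x. of_real \<xi> * \<phi> \<xi> x) \<in> l2 Z"
    using assms by (auto simp: L2L2_l2)
  have [measurable]: "case_prod \<phi> \<in> borel_measurable Z" using 1 by (auto dest: l2_measurable)
  have m: "weighted \<phi> \<in> borel_measurable Z"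
  proof -
    have "(\<lambda>z. of_real (sqrt (1 + (fst z)\<^sup>2)) * case_prod \<phi> z) \<in> borel_measurable Z" by measurable
    then show ?thesis by (simp add: weighted_def split_beta')
  qed
  have "(\<lambda>z. (cmod (weighted \<phi> z))\<^sup>2)
      = (\<lambda>z. (cmod (case_prod \<phi> z))\<^sup>2 + (cmod (case_prod (\<lambda>\<xi> x. of_real \<xi> * \<phi> \<xi> x) z))\<^sup>2)"
    by (auto simp: fun_eq_iff weighted_def norm_mult power_mult_distrib distrib_right)
  moreover have "integrable Z (\<lambda>z. (cmod (case_prod \<phi> z))\<^sup>2 + (cmod (case_prod (\<lambda>\<xi> x. of_real \<xi> * \<phi> \<xi> x) z))\<^sup>2)"
    using 1 by (intro Bochner_Integration.integrable_add l2_integrable_square)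
  ultimately show ?thesis using m by (simp add: l2_def)
qed

text \<open>\<open>Re \<integral>\<integral> \<mu>(\<xi>) \<phi>(\<xi>,x) cnj (w x)\<close>, with the weight \<open>sqrt (1 + \<xi>\<^sup>2)\<close> moved so that both factors are
  square integrable.\<close>
definition coupling :: "(real \<Rightarrow> field) \<Rightarrow> field \<Rightarrow> real" where
  "coupling \<phi> w = ip Z (weighted \<phi>) (tensor (mu_weight \<alpha>) w)"

definition mu_weight_norm :: real where
  "mu_weight_norm = sqrt (LINT \<xi>|lborel. (mu_weight \<alpha> \<xi>)\<^sup>2)"

lemma tensor_mu_weight_l2: "w \<in> l2 M \<Longrightarrow> tensor (mu_weight \<alpha>) w \<in> l2 Z"
  using \<alpha> by (intro tensor_in_l2 integrable_mu_weight_sq) auto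

lemma coupling_bound:
  assumes "weighted \<phi> \<in> l2 Z" "w \<in> l2 M"
  shows "\<bar>coupling \<phi> w\<bar> \<le> nrm Z (weighted \<phi>) * mu_weight_norm * nrm M w"
  using l2.B_Cauchy_Schwarz[OF assms(1) tensor_mu_weight_l2[OF assms(2)]] \<alpha> assms(2)
  by (simp add: coupling_def mu_weight_norm_def nrm_tensor integrable_mu_weight_sq mult.assoc)

lemma coupling_diff:
  assumes "weighted \<phi> \<in> l2 Z" "w \<in> l2 M" "w' \<in> l2 M"
  shows "coupling \<phi> (w - w') = coupling \<phi> w - coupling \<phi> w'"
proof -
  have "tensor (mu_weight \<alpha>) (w - w') = tensor (mu_weight \<alpha>) w - tensor (mu_weight \<alpha>) w'"
    by (auto simp: tensor_def fun_eq_iff algebra_simps)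
  then show ?thesis
    using l2.B_diff[OF tensor_mu_weight_l2[OF assms(2)] tensor_mu_weight_l2[OF assms(3)] assms(1)]
    by (simp only: coupling_def ip_sym[of Z "weighted \<phi>"])
qed

lemma weighted_tensor:
  "weighted \<phi> z * tensor (mu_weight \<alpha>) w z = (case z of (\<xi>, x) \<Rightarrow> of_real (mu \<alpha> \<xi>) * \<phi> \<xi> x * w x)"
proof (cases z)
  case (Pair \<xi> x)
  have "complex_of_real (sqrt (1 + \<xi>\<^sup>2)) * of_real (mu_weight \<alpha> \<xi>) = of_real (mu \<alpha> \<xi>)"
    unfolding of_real_mult[symmetric] by (simp add: mu_weight_def)
  then show ?thesis unfolding Pair weighted_def tensor_def prod.case
    by (metis (no_types, lifting) mult.assoc mult.left_commute)
qed

text \<open>Fubini applies because the integrand is a product of two functions in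
  \<open>l2 Z\<close> once the weight is moved from \<open>mu\<close> to
  \<open>\<phi>\<close>.\<close>

lemma distr_of_mu_integral:
  assumes \<phi>: "weighted \<phi> \<in> l2 Z" and w: "w \<in> l2 M"
  shows "Re (distr_of \<Omega> (mu_integral \<alpha> \<phi>) (\<lambda>x. cnj (w x))) = coupling \<phi> w"
proof -
  define f where "f \<xi> x = of_real (mu \<alpha> \<xi>) * \<phi> \<xi> x * cnj (w x)" for \<xi> x
  have f: "case_prod f z = weighted \<phi> z * cnj (tensor (mu_weight \<alpha>) w z)" for z
    using weighted_tensor[of \<phi> z "\<lambda>x. cnj (w x)"] by (cases z) (auto simp: f_def tensor_def)
  have i: "integrable Z (case_prod f)"
    unfolding f using \<phi> w by (intro l2_integrable_mult_cnj tensor_mu_weight_l2)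
  have "distr_of \<Omega> (mu_integral \<alpha> \<phi>) (\<lambda>x. cnj (w x)) = (LINT x|M. LINT \<xi>|lborel. f \<xi> x)"
    by (simp add: distr_of_def mu_integral_def f_def)
  also have "\<dots> = integral\<^sup>L Z (case_prod f)" by (rule pair.integral_snd[OF i])
  finally have "Re (distr_of \<Omega> (mu_integral \<alpha> \<phi>) (\<lambda>x. cnj (w x))) = (LINT z|Z. Re (case_prod f z))"
    using i by simp
  then show ?thesis by (simp only: f coupling_def ip_def inner_eq_Re_mult_cnj)
qed

text \<open>Cauchy-Schwarz in the frequency for almost every point of the domain, followed by
  integration over the domain.\<close>

lemma mu_integral_l2:
  assumes \<phi>: "weighted \<phi> \<in> l2 Z"
  shows "mu_integral \<alpha> \<phi> \<in> l2 M"
proof -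
  have wm [measurable]: "weighted \<phi> \<in> borel_measurable Z" by (rule l2_measurable[OF \<phi>])
  define f where "f x \<xi> = weighted \<phi> (\<xi>, x) * of_real (mu_weight \<alpha> \<xi>)" for x \<xi>
  have f: "of_real (mu \<alpha> \<xi>) * \<phi> \<xi> x = f x \<xi>" for \<xi> x
    using weighted_tensor[of \<phi> "(\<xi>, x)" "\<lambda>x. 1"] by (simp add: f_def tensor_def)
  have m: "mu_integral \<alpha> \<phi> \<in> borel_measurable M"
  proof -
    have "(\<lambda>(x, \<xi>). weighted \<phi> (\<xi>, x)) \<in> borel_measurable (M \<Otimes>\<^sub>M lborel)"
      using measurable_pair_swap[OF wm] by simp
    then have "case_prod f \<in> borel_measurable (M \<Otimes>\<^sub>M lborel)"
      unfolding f_def by measurable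
    then have "(\<lambda>x. LINT \<xi>|lborel. f x \<xi>) \<in> borel_measurable M"
      by (rule lborel.borel_measurable_lebesgue_integral)
    then show ?thesis by (simp only: mu_integral_def f)
  qed
  define g where "g \<xi> x = (cmod (weighted \<phi> (\<xi>, x)))\<^sup>2" for \<xi> x
  have gi: "integrable Z (case_prod g)"
  proof -
    have "case_prod g = (\<lambda>z. (cmod (weighted \<phi> z))\<^sup>2)" by (auto simp: g_def fun_eq_iff)
    then show ?thesis using l2_integrable_square[OF \<phi>] by simp
  qed
  have "AE x in M. (cmod (mu_integral \<alpha> \<phi> x))\<^sup>2 \<le> mu_weight_norm\<^sup>2 * (LINT \<xi>|lborel. g \<xi> x)"
    using pair.AE_integrable_snd[OF gi] AE_space[of M]
  proof eventually_elim
    case (elim x)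
    let ?k = "\<lambda>\<xi>. complex_of_real (cmod (weighted \<phi> (\<xi>, x)))"
    let ?m = "\<lambda>\<xi>. complex_of_real (\<bar>mu_weight \<alpha> \<xi>\<bar>)"
    have wx: "(\<lambda>\<xi>. weighted \<phi> (\<xi>, x)) \<in> borel_measurable lborel"
      by (rule measurable_Pair1[OF wm elim(2)])
    then have k: "?k \<in> l2 lborel" using elim by (auto simp: l2_def g_def)
    have w: "?m \<in> l2 lborel" using integrable_mu_weight_sq[OF \<alpha>] by (auto simp: l2_def)
    have "cmod (mu_integral \<alpha> \<phi> x) \<le> (LINT \<xi>|lborel. cmod (f x \<xi>))"
      unfolding mu_integral_def f by (rule integral_norm_bound)
    also have "\<dots> = ip lborel ?k ?m"
      unfolding ip_def by (intro Bochner_Integration.integral_cong) (auto simp: f_def norm_mult inner_complex_def)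
    also have "\<dots> \<le> nrm lborel ?k * nrm lborel ?m"
      using l2.B_Cauchy_Schwarz[OF k w] by linarith
    finally have "(cmod (mu_integral \<alpha> \<phi> x))\<^sup>2 \<le> (nrm lborel ?k * nrm lborel ?m)\<^sup>2" by (intro power_mono) auto
    also have "\<dots> = mu_weight_norm\<^sup>2 * (LINT \<xi>|lborel. g \<xi> x)"
      by (simp add: power_mult_distrib nrm_eq mu_weight_norm_def g_def)
    finally show ?case .
  qed
  moreover have "integrable M (\<lambda>x. mu_weight_norm\<^sup>2 * (LINT \<xi>|lborel. g \<xi> x))"
    by (intro integrable_mult_right pair.integrable_snd[OF gi])
  ultimately have "integrable M (\<lambda>x. (cmod (mu_integral \<alpha> \<phi> x))\<^sup>2)"
    using m by (elim Bochner_Integration.integrable_bound) (auto elim: eventually_mono intro: order_trans[OF _ abs_ge_self])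
  then show ?thesis using m by (simp add: l2_def)
qed

text \<open>One of the two derivatives is moved from the test function back to \<open>u\<close> as a
  weak derivative, the other stays on \<open>\<psi>\<close>.\<close>

lemma Re_distr_laplacian:
  assumes u: "u \<in> H1 \<Omega>" and \<psi>: "\<psi> \<in> test"
  shows "Re (distr_laplacian (distr_of \<Omega> u) (\<lambda>x. cnj (\<psi> x))) = - grad_ip u \<psi>"
proof -
  have p: "partial i \<psi> \<in> test" "partial i (partial i \<psi>) \<in> test" for i using \<psi> by (auto intro: test_partial)
  have pc: "partial i (partial i (\<lambda>x. cnj (\<psi> x))) = (\<lambda>x. cnj (partial i (partial i \<psi>) x))" for i
    using partial_cnj[OF test_smooth[OF \<psi>], of i] partial_cnj[OF test_smooth[OF p(1)], of i i] by simp
  have "Re (distr_laplacian (distr_of \<Omega> u) (\<lambda>x. cnj (\<psi> x)))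
      = (\<Sum>i\<in>UNIV. Re (distr_of \<Omega> u (\<lambda>x. cnj (partial i (partial i \<psi>) x))))"
    by (simp add: distr_laplacian_def distr_partial_def pc)
  also have "\<dots> = (\<Sum>i\<in>UNIV. ip M u (partial i (partial i \<psi>)))"
    using u p by (intro sum.cong refl Re_distr_of_cnj) auto
  also have "\<dots> = (\<Sum>i\<in>UNIV. - ip M (weak_partial \<Omega> i u) (partial i \<psi>))"
    using u p by (intro sum.cong refl weak_deriv_ip weak_partial) auto
  also have "\<dots> = - grad_ip \<psi> u"
    using grad_ip_weak_deriv[OF test_H1[OF \<psi>] u weak_deriv_test[OF \<psi>]]
    by (simp add: sum_negf ip_sym)
  finally show ?thesis by (simp only: grad_ip_sym)
qed

text \<open>On test functions this is the definition of the stress distribution. All four terms are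
  continuous in \<open>w\<close> for the \<open>H1\<close> norm, so it extends to
  \<open>H10 \<Omega>\<close>, with no boundary term.\<close>

lemma stress_green:
  assumes u: "u \<in> H1 \<Omega>" and v: "v \<in> H1 \<Omega>" and \<phi>: "weighted \<phi> \<in> l2 Z"
    and s: "represents \<Omega> (stress_distr \<Omega> \<alpha> b c u v \<phi>) s" and w: "w \<in> H10 \<Omega>"
  shows "ip M s w = - b * grad_ip u w - c * grad_ip v w - frak_C \<alpha> * coupling \<phi> w"
proof -
  have sl: "s \<in> l2 M" using s by (simp add: represents_def L2_eq_l2)
  define F where "F w = ip M s w + b * grad_ip u w + c * grad_ip v w + frak_C \<alpha> * coupling \<phi> w" for w
  have "F w = 0"
  proof (rule H10_functional_zero[OF _ _ _ w])
    fix w w' assume w: "w \<in> H1 \<Omega>" "w' \<in> H1 \<Omega>"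
    have s': "ip M s (w - w') = ip M s w - ip M s w'"
      using l2.B_diff[of w M w' s] w sl by (simp add: ip_sym[of M s])
    have g': "grad_ip z (w - w') = grad_ip z w - grad_ip z w'" if "z \<in> H1 \<Omega>" for z
      using grad.B_diff[of w w' z] w that by (simp add: grad_ip_sym[of z])
    have c': "coupling \<phi> (w - w') = coupling \<phi> w - coupling \<phi> w'"
      using w \<phi> by (intro coupling_diff) auto
    show "F (w - w') = F w - F w'"
      unfolding F_def s' g'[OF u] g'[OF v] c' by (simp add: algebra_simps)
  next
    fix w assume w: "w \<in> H1 \<Omega>"
    have "\<bar>F w\<bar> \<le> \<bar>ip M s w\<bar> + \<bar>b\<bar> * \<bar>grad_ip u w\<bar> + \<bar>c\<bar> * \<bar>grad_ip v w\<bar> + \<bar>frak_C \<alpha>\<bar> * \<bar>coupling \<phi> w\<bar>"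
      unfolding F_def abs_mult[symmetric] by linarith
    also have "\<dots> \<le> nrm M s * nrm M w + \<bar>b\<bar> * (grad.N u * grad.N w) + \<bar>c\<bar> * (grad.N v * grad.N w)
        + \<bar>frak_C \<alpha>\<bar> * (nrm Z (weighted \<phi>) * mu_weight_norm * nrm M w)"
      using u v w \<phi> sl
      by (intro add_mono mult_left_mono l2.B_Cauchy_Schwarz grad.B_Cauchy_Schwarz coupling_bound) auto
    also have "\<dots> = (nrm M s + \<bar>frak_C \<alpha>\<bar> * nrm Z (weighted \<phi>) * mu_weight_norm) * nrm M w
        + (\<bar>b\<bar> * grad.N u + \<bar>c\<bar> * grad.N v) * grad.N w" by (simp add: algebra_simps)
    finally show "\<bar>F w\<bar> \<le> \<dots>" .
  next
    fix \<psi> assume \<psi>: "\<psi> \<in> test"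
    have "stress_distr \<Omega> \<alpha> b c u v \<phi> (\<lambda>x. cnj (\<psi> x)) = distr_of \<Omega> s (\<lambda>x. cnj (\<psi> x))"
      using s test_cnj[OF \<psi>] by (simp add: represents_def)
    then have "Re (stress_distr \<Omega> \<alpha> b c u v \<phi> (\<lambda>x. cnj (\<psi> x))) = ip M s \<psi>"
      using Re_distr_of_cnj[OF sl test_in_l2[OF \<psi>]] by simp
    then show "F \<psi> = 0"
      using u v \<psi> \<phi>
      by (simp add: F_def stress_distr_def Re_distr_laplacian distr_of_mu_integral)
  qed
  then show ?thesis by (simp add: F_def)
qed

end

section \<open>The phase space\<close>

lemma (in seminormed_subspace) bform_cong:
  assumes b: "bform b" and eq: "\<And>P Q. P \<in> X \<Longrightarrow> Q \<in> X \<Longrightarrow> b P Q = c P Q"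
  shows "bform c"
proof -
  obtain K where K: "K \<ge> 0" "\<forall>P\<in>X. \<forall>Q\<in>X. \<bar>b P Q\<bar> \<le> K * N P * N Q"
    using b unfolding bform_def by blast
  show ?thesis
    unfolding bform_def
  proof (intro conjI)
    show "\<exists>K\<ge>0. \<forall>P\<in>X. \<forall>Q\<in>X. \<bar>c P Q\<bar> \<le> K * N P * N Q" using K eq by auto
  qed (use b in \<open>simp_all add: bform_def eq[symmetric]\<close>)
qed

lemma state_add_eq: "state_add P Q = P + Q"
  by (cases P; cases Q) (simp add: plus_fun_def)

lemma state_scale_eq: "state_scale (of_real r) P = r *\<^sub>R P"
  by (cases P) (simp add: scaleR_fun_def scaleR_conv_of_real)

lemma state_diff_eq: "state_diff P Q = P - Q"
  using state_scale_eq[of "-1" Q] by (simp add: state_diff_def state_add_eq)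

abbreviation st_u :: "state \<Rightarrow> field" where "st_u P \<equiv> fst P"
abbreviation st_v :: "state \<Rightarrow> field" where "st_v P \<equiv> fst (snd P)"
abbreviation st_U :: "state \<Rightarrow> field" where "st_U P \<equiv> fst (snd (snd P))"
abbreviation st_V :: "state \<Rightarrow> field" where "st_V P \<equiv> fst (snd (snd (snd P)))"
abbreviation st_p :: "state \<Rightarrow> real \<Rightarrow> field" where "st_p P \<equiv> fst (snd (snd (snd (snd P))))"
abbreviation st_q :: "state \<Rightarrow> real \<Rightarrow> field" where "st_q P \<equiv> snd (snd (snd (snd (snd P))))"

lemma case_prod_add: "case_prod (f + g) = case_prod f + case_prod g"
  and case_prod_scaleR: "case_prod (r *\<^sub>R h) = r *\<^sub>R case_prod h"
  by (auto simp: fun_eq_iff scaleR_fun_def)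

definition xi_mult :: "(real \<Rightarrow> real) \<Rightarrow> (real \<times> R3 \<Rightarrow> complex) \<Rightarrow> real \<times> R3 \<Rightarrow> complex" where
  "xi_mult h f = (\<lambda>z. of_real (h (fst z)) * f z)"

lemma xi_mult_l2:
  assumes f: "f \<in> l2 (cyl \<Omega>)" and h: "h \<in> borel_measurable borel" "\<And>\<xi>. \<bar>h \<xi>\<bar> \<le> C"
  shows "xi_mult h f \<in> l2 (cyl \<Omega>)" "nrm (cyl \<Omega>) (xi_mult h f) \<le> C * nrm (cyl \<Omega>) f"
proof -
  have "(\<lambda>z. complex_of_real (h (fst z))) \<in> borel_measurable (cyl \<Omega>)" using h(1) by measurable
  moreover have "cmod (of_real (h (fst z))) \<le> C" for z :: "real \<times> R3" using h(2) by simp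
  ultimately show "xi_mult h f \<in> l2 (cyl \<Omega>)" "nrm (cyl \<Omega>) (xi_mult h f) \<le> C * nrm (cyl \<Omega>) f"
    unfolding xi_mult_def by (rule l2_bounded_mult[OF f])+
qed

locale mixture = diffusive_domain +
  fixes \<rho>1 \<rho>2 \<eta> a11 a12 a22 :: real
  assumes \<rho>: "\<rho>1 > 0" "\<rho>2 > 0" and \<eta>: "\<eta> \<ge> 0"
    and a11: "a11 > 0" and det: "a11 * a22 - a12\<^sup>2 > 0"
begin

definition X where "X = phase_space \<Omega>"
definition B where "B P Q = Re (phase_inner \<Omega> \<rho>1 \<rho>2 \<alpha> a11 a12 a22 P Q)"
abbreviation C where "C \<equiv> frak_C \<alpha>"

lemma C_pos: "C > 0"
proof -
  have "\<alpha> * pi < pi" using \<alpha> by simp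
  then have "sin (\<alpha> * pi) > 0" using \<alpha> by (intro sin_gt_zero) auto
  then show ?thesis by (simp add: frak_C_def)
qed

lemma X_iff: "P \<in> X \<longleftrightarrow> st_u P \<in> H10 \<Omega> \<and> st_v P \<in> H10 \<Omega> \<and> st_U P \<in> l2 M \<and> st_V P \<in> l2 M
    \<and> case_prod (st_p P) \<in> l2 Z \<and> case_prod (st_q P) \<in> l2 Z"
  by (simp add: X_def phase_space_def mem_Times_iff L2L2_l2 L2_eq_l2)

lemma X_subspace: "subspace X"
  unfolding subspace_def
proof (intro conjI ballI allI)
  have "(0 :: real \<Rightarrow> field) = (\<lambda>_ _. 0)" by (simp add: fun_eq_iff)
  then have "case_prod (0 :: real \<Rightarrow> field) = 0" by (simp add: fun_eq_iff)
  then show "0 \<in> X"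
    unfolding X_iff
    using subspace_0[OF H10_subspace] subspace_0[OF l2.subspace, of M] subspace_0[OF l2.subspace, of Z]
    by simp
next
  fix P Q assume "P \<in> X" "Q \<in> X"
  then show "P + Q \<in> X" unfolding X_iff by (simp add: case_prod_add H10_add)
next
  fix P and r :: real assume "P \<in> X"
  then show "r *\<^sub>R P \<in> X" unfolding X_iff by (simp add: case_prod_scaleR H10_scaleR)
qed

definition pot :: "state \<Rightarrow> state \<Rightarrow> real" where
  "pot P Q = a11 * grad_ip (st_u P) (st_u Q) + a22 * grad_ip (st_v P) (st_v Q)
     + a12 * (grad_ip (st_u P) (st_v Q) + grad_ip (st_v P) (st_u Q))
     + \<alpha> * ip M (st_u P - st_v P) (st_u Q - st_v Q)"

lemma B_eq:
  assumes "P \<in> X" "Q \<in> X"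
  shows "B P Q = \<rho>1 * ip M (st_U P) (st_U Q) + \<rho>2 * ip M (st_V P) (st_V Q) + pot P Q
     + C * ip Z (case_prod (st_p P)) (case_prod (st_p Q)) + C * ip Z (case_prod (st_q P)) (case_prod (st_q Q))"
proof -
  obtain u v U V p q where P: "P = (u, v, U, V, p, q)" by (cases P)
  obtain u' v' U' V' p' q' where Q: "Q = (u', v', U', V', p', q')" by (cases Q)
  have X: "u \<in> H1 \<Omega>" "v \<in> H1 \<Omega>" "U \<in> L2 \<Omega>" "V \<in> L2 \<Omega>" "p \<in> L2L2 \<Omega>" "q \<in> L2L2 \<Omega>"
    "u' \<in> H1 \<Omega>" "v' \<in> H1 \<Omega>" "U' \<in> L2 \<Omega>" "V' \<in> L2 \<Omega>" "p' \<in> L2L2 \<Omega>" "q' \<in> L2L2 \<Omega>"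
    using assms by (auto simp: X_iff P Q L2_eq_l2 L2L2_l2)
  then have "u - v \<in> L2 \<Omega>" "u' - v' \<in> L2 \<Omega>" by (auto simp: L2_eq_l2)
  then have "Re (L2_inner \<Omega> (\<lambda>x. u x - v x) (\<lambda>x. u' x - v' x)) = ip M (u - v) (u' - v')"
    using Re_L2_inner[of "u - v" \<Omega> "u' - v'"] by (simp add: fun_diff_def)
  then show ?thesis
    using X by (simp add: B_def P Q pot_def Re_L2_inner Re_grad_inner Re_L2L2_inner)
qed

text \<open>Determinant over trace of the symmetric matrix with entries \<open>a11\<close>,
  \<open>a12\<close>, \<open>a22\<close>: an explicit lower bound for its smaller eigenvalue, since
  the larger one is at most the trace.\<close>

definition coercivity :: real where "coercivity = (a11 * a22 - a12\<^sup>2) / (a11 + a22)"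

lemma a22: "a22 > 0"
proof -
  have "a11 * a22 > 0" using det zero_le_power2[of a12] by linarith
  then show ?thesis using a11 by (simp add: zero_less_mult_iff)
qed

lemma coercivity_pos: "coercivity > 0"
  using det a11 a22 by (simp add: coercivity_def)

text \<open>Stated with \<open>\<bar>a12\<bar>\<close> because the mixed gradient term is known only
  through Cauchy-Schwarz, so the worst sign must be allowed.\<close>

lemma coercive:
  "coercivity * (x\<^sup>2 + y\<^sup>2) \<le> a11 * x\<^sup>2 + a22 * y\<^sup>2 - 2 * \<bar>a12\<bar> * x * y"
proof -
  define c where "c = coercivity"
  have s: "a11 + a22 > 0" using a11 a22 by simp
  have c: "c * (a11 + a22) = a11 * a22 - a12\<^sup>2" using s by (simp add: c_def coercivity_def)
  have d: "a11 - c > 0"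
  proof -
    have "(a11 - c) * (a11 + a22) = a11\<^sup>2 + a12\<^sup>2" using c by (simp add: algebra_simps power2_eq_square)
    also have "\<dots> > 0" using a11 by (simp add: add_pos_nonneg)
    finally show ?thesis using s by (simp add: zero_less_mult_iff)
  qed
  \<comment> \<open>The matrix minus \<open>c\<close> times the identity has determinant
    \<open>c\<^sup>2\<close>, because \<open>c\<close> times the trace cancels the determinant.
    Completing the square then gives positivity.\<close>
  have e: "(a11 - c) * (a22 - c) - a12\<^sup>2 = c\<^sup>2" using c by (simp add: algebra_simps power2_eq_square)
  have "0 \<le> ((a11 - c) * x - \<bar>a12\<bar> * y)\<^sup>2 + ((a11 - c) * (a22 - c) - a12\<^sup>2) * y\<^sup>2" unfolding e by simp
  also have "\<dots> = ((a11 - c) * x)\<^sup>2 - 2 * ((a11 - c) * x) * (\<bar>a12\<bar> * y) + (\<bar>a12\<bar> * y)\<^sup>2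
      + ((a11 - c) * (a22 - c) - a12\<^sup>2) * y\<^sup>2" by (simp only: power2_diff)
  also have "\<dots> = (a11 - c) * ((a11 - c) * x\<^sup>2 + (a22 - c) * y\<^sup>2 - 2 * \<bar>a12\<bar> * x * y)"
    by (simp add: algebra_simps power_mult_distrib) (simp add: algebra_simps power2_eq_square)
  finally have "0 \<le> (a11 - c) * x\<^sup>2 + (a22 - c) * y\<^sup>2 - 2 * \<bar>a12\<bar> * x * y"
    using d by (simp add: zero_le_mult_iff)
  then show ?thesis by (simp add: c_def algebra_simps)
qed

lemma pot_lower:
  assumes "P \<in> X"
  shows "coercivity * ((grad.N (st_u P))\<^sup>2 + (grad.N (st_v P))\<^sup>2) \<le> pot P P"
proof -
  have X: "st_u P \<in> H1 \<Omega>" "st_v P \<in> H1 \<Omega>" using assms by (auto simp: X_iff)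
  have "\<bar>a12 * grad_ip (st_u P) (st_v P)\<bar> \<le> \<bar>a12\<bar> * (grad.N (st_u P) * grad.N (st_v P))"
    unfolding abs_mult using X by (intro mult_left_mono grad.B_Cauchy_Schwarz) auto
  then have "- \<bar>a12\<bar> * (grad.N (st_u P) * grad.N (st_v P)) \<le> a12 * grad_ip (st_u P) (st_v P)" by linarith
  moreover have "\<alpha> * ip M (st_u P - st_v P) (st_u P - st_v P) \<ge> 0"
    using \<alpha> by (simp add: nrm_sq[symmetric])
  ultimately show ?thesis
    using coercive[of "grad.N (st_u P)" "grad.N (st_v P)"] X
    by (simp add: pot_def grad.N_sq grad_ip_sym[of "st_v P" "st_u P"] algebra_simps)
qed

lemma pot_nonneg: "P \<in> X \<Longrightarrow> pot P P \<ge> 0"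
  using pot_lower[of P] coercivity_pos by (auto intro: order_trans[rotated])

sublocale ph: seminormed_subspace X B
proof
  show "B P Q = B Q P" if "P \<in> X" "Q \<in> X" for P Q
  proof -
    have "pot P Q = pot Q P"
      unfolding pot_def
      by (simp only: ip_sym[of M "st_u P - st_v P"] grad_ip_sym[of "st_u P"] grad_ip_sym[of "st_v P"] add.commute)
    then show ?thesis
      using that
      by (simp only: B_eq ip_sym[of M "st_U P"] ip_sym[of M "st_V P"]
          ip_sym[of Z "case_prod (st_p P)"] ip_sym[of Z "case_prod (st_q P)"])
  qed
  fix P P' Q assume X: "P \<in> X" "P' \<in> X" "Q \<in> X"
  then have PP: "P + P' \<in> X" using X_subspace by (auto intro: subspace_add)
  have "st_u (P + P') - st_v (P + P') = (st_u P - st_v P) + (st_u P' - st_v P')" by simp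
  then have d: "ip M (st_u (P + P') - st_v (P + P')) (st_u Q - st_v Q)
      = ip M (st_u P - st_v P) (st_u Q - st_v Q) + ip M (st_u P' - st_v P') (st_u Q - st_v Q)"
    using X by (simp only:) (rule l2.B_add; simp add: X_iff)
  have "pot (P + P') Q = pot P Q + pot P' Q"
    unfolding pot_def d using X by (simp add: X_iff l2.B_add grad_ip_add algebra_simps)
  then show "B (P + P') Q = B P Q + B P' Q"
    using X by (simp add: B_eq PP) (simp add: X_iff l2.B_add case_prod_add algebra_simps)
next
  fix P Q r assume X: "P \<in> X" "Q \<in> X"
  then have rP: "r *\<^sub>R P \<in> X" using X_subspace by (auto intro: subspace_scale)
  have "st_u (r *\<^sub>R P) - st_v (r *\<^sub>R P) = r *\<^sub>R (st_u P - st_v P)" by (simp add: scaleR_diff_right)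
  then have d: "ip M (st_u (r *\<^sub>R P) - st_v (r *\<^sub>R P)) (st_u Q - st_v Q) = r * ip M (st_u P - st_v P) (st_u Q - st_v Q)"
    using X by (simp only:) (rule l2.B_scale; simp add: X_iff)
  have "pot (r *\<^sub>R P) Q = r * pot P Q"
    unfolding pot_def d using X by (simp add: X_iff l2.B_scale grad_ip_scaleR algebra_simps)
  then show "B (r *\<^sub>R P) Q = r * B P Q"
    using X by (simp add: B_eq rP) (simp add: X_iff l2.B_scale case_prod_scaleR algebra_simps)
next
  show "B P P \<ge> 0" if "P \<in> X" for P
    using that pot_nonneg \<rho> C_pos by (simp add: B_eq nrm_sq[symmetric])
qed (rule X_subspace)

lemma N_sq_eq:
  assumes "P \<in> X"
  shows "(ph.N P)\<^sup>2 = \<rho>1 * (nrm M (st_U P))\<^sup>2 + \<rho>2 * (nrm M (st_V P))\<^sup>2 + pot P P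
     + C * (nrm Z (case_prod (st_p P)))\<^sup>2 + C * (nrm Z (case_prod (st_q P)))\<^sup>2"
  using assms by (simp add: ph.N_sq B_eq nrm_sq)

text \<open>Bounded linear observables of the state. Every Lyapunov form below other than
  \<open>B\<close> and \<open>pot\<close> is a combination of inner products of two of them, hence a
  bounded bilinear form.\<close>

definition blin :: "'a measure \<Rightarrow> (state \<Rightarrow> 'a \<Rightarrow> complex) \<Rightarrow> bool" where
  "blin m L \<longleftrightarrow> (\<forall>P\<in>X. L P \<in> l2 m) \<and> (\<forall>P\<in>X. \<forall>Q\<in>X. L (P + Q) = L P + L Q) \<and>
     (\<forall>r. \<forall>P\<in>X. L (r *\<^sub>R P) = r *\<^sub>R L P) \<and> (\<exists>k\<ge>0. \<forall>P\<in>X. nrm m (L P) \<le> k * ph.N P)"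

lemma blinI:
  assumes "\<And>P. P \<in> X \<Longrightarrow> L P \<in> l2 m" "\<And>P Q. P \<in> X \<Longrightarrow> Q \<in> X \<Longrightarrow> L (P + Q) = L P + L Q"
    and "\<And>r P. P \<in> X \<Longrightarrow> L (r *\<^sub>R P) = r *\<^sub>R L P"
    and "k \<ge> 0" "\<And>P. P \<in> X \<Longrightarrow> nrm m (L P) \<le> k * ph.N P"
  shows "blin m L"
  using assms unfolding blin_def by blast

lemma blin_l2: "blin m L \<Longrightarrow> P \<in> X \<Longrightarrow> L P \<in> l2 m"
  by (simp add: blin_def)

lemma blin_bound:
  assumes "blin m L"
  obtains k where "k \<ge> 0" "\<And>P. P \<in> X \<Longrightarrow> nrm m (L P) \<le> k * ph.N P"
  using assms unfolding blin_def by blast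

lemma blin_of_square_bound:
  assumes "\<And>P. P \<in> X \<Longrightarrow> L P \<in> l2 m" "\<And>P Q. P \<in> X \<Longrightarrow> Q \<in> X \<Longrightarrow> L (P + Q) = L P + L Q"
    and "\<And>r P. P \<in> X \<Longrightarrow> L (r *\<^sub>R P) = r *\<^sub>R L P"
    and c: "c > 0" "\<And>P. P \<in> X \<Longrightarrow> c * (nrm m (L P))\<^sup>2 \<le> (ph.N P)\<^sup>2"
  shows "blin m L"
proof (rule blinI[of _ _ "1 / sqrt c"])
  fix P assume P: "P \<in> X"
  have "sqrt (c * (nrm m (L P))\<^sup>2) \<le> sqrt ((ph.N P)\<^sup>2)" using c(2)[OF P] by (rule real_sqrt_le_mono)
  then have "sqrt c * nrm m (L P) \<le> ph.N P" using P by (simp add: real_sqrt_mult)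
  then show "nrm m (L P) \<le> 1 / sqrt c * ph.N P" using c by (simp add: field_simps)
qed (use assms in auto)

lemma N_terms_nonneg:
  assumes "P \<in> X"
  shows "\<rho>1 * (nrm M (st_U P))\<^sup>2 \<ge> 0" "\<rho>2 * (nrm M (st_V P))\<^sup>2 \<ge> 0" "pot P P \<ge> 0"
    "C * (nrm Z (case_prod (st_p P)))\<^sup>2 \<ge> 0" "C * (nrm Z (case_prod (st_q P)))\<^sup>2 \<ge> 0"
  using assms \<rho> C_pos pot_nonneg by auto

lemma blin_U: "blin M st_U"
  by (rule blin_of_square_bound[OF _ _ _ \<rho>(1)]) (use N_terms_nonneg in \<open>auto simp: X_iff N_sq_eq\<close>)

lemma blin_V: "blin M st_V"
  by (rule blin_of_square_bound[OF _ _ _ \<rho>(2)]) (use N_terms_nonneg in \<open>auto simp: X_iff N_sq_eq\<close>)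

lemma blin_p: "blin Z (\<lambda>P. case_prod (st_p P))"
  by (rule blin_of_square_bound[OF _ _ _ C_pos])
    (use N_terms_nonneg in \<open>auto simp: X_iff N_sq_eq case_prod_add case_prod_scaleR\<close>)

lemma blin_q: "blin Z (\<lambda>P. case_prod (st_q P))"
  by (rule blin_of_square_bound[OF _ _ _ C_pos])
    (use N_terms_nonneg in \<open>auto simp: X_iff N_sq_eq case_prod_add case_prod_scaleR\<close>)

text \<open>The energy controls gradients; the Poincare constant \<open>K\<close> turns this into
  control of the displacements, at the price \<open>coercivity / K\<^sup>2\<close>.\<close>

lemma blin_uv: "blin M st_u" "blin M st_v"
proof -
  obtain K where K: "K > 0" "\<And>u. u \<in> H10 \<Omega> \<Longrightarrow> nrm M u \<le> K * grad.N u" using poincare by blast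
  have c: "coercivity / K\<^sup>2 > 0" using K coercivity_pos by simp
  have le: "coercivity / K\<^sup>2 * (nrm M w)\<^sup>2 \<le> coercivity * (grad.N w)\<^sup>2" if "w \<in> H10 \<Omega>" for w
  proof -
    have "(nrm M w)\<^sup>2 \<le> (K * grad.N w)\<^sup>2" using K(2)[OF that] by (intro power_mono) auto
    then have "(nrm M w)\<^sup>2 / K\<^sup>2 \<le> (grad.N w)\<^sup>2" using K by (simp add: power_mult_distrib divide_le_eq mult.commute)
    then have "coercivity * ((nrm M w)\<^sup>2 / K\<^sup>2) \<le> coercivity * (grad.N w)\<^sup>2"
      using coercivity_pos by (intro mult_left_mono) auto
    then show ?thesis by simp
  qed
  have pot_le: "pot P P \<le> (ph.N P)\<^sup>2" if "P \<in> X" for P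
    using N_terms_nonneg[OF that] N_sq_eq[OF that] by linarith
  have lo: "coercivity * (grad.N (st_u P))\<^sup>2 \<le> pot P P" "coercivity * (grad.N (st_v P))\<^sup>2 \<le> pot P P" if "P \<in> X" for P
  proof -
    have "coercivity * (grad.N (st_u P))\<^sup>2 \<ge> 0" "coercivity * (grad.N (st_v P))\<^sup>2 \<ge> 0"
      using coercivity_pos by auto
    then show "coercivity * (grad.N (st_u P))\<^sup>2 \<le> pot P P" "coercivity * (grad.N (st_v P))\<^sup>2 \<le> pot P P"
      using pot_lower[OF that] by (simp_all add: distrib_left)
  qed
  show "blin M st_u"
  proof (rule blin_of_square_bound[OF _ _ _ c])
    show "coercivity / K\<^sup>2 * (nrm M (st_u P))\<^sup>2 \<le> (ph.N P)\<^sup>2" if "P \<in> X" for P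
      using le[of "st_u P"] lo(1)[OF that] pot_le[OF that] that by (simp add: X_iff)
  qed (auto simp: X_iff)
  show "blin M st_v"
  proof (rule blin_of_square_bound[OF _ _ _ c])
    show "coercivity / K\<^sup>2 * (nrm M (st_v P))\<^sup>2 \<le> (ph.N P)\<^sup>2" if "P \<in> X" for P
      using le[of "st_v P"] lo(2)[OF that] pot_le[OF that] that by (simp add: X_iff)
  qed (auto simp: X_iff)
qed

lemma blin_diff:
  assumes L: "blin m L" and L': "blin m L'"
  shows "blin m (\<lambda>P. L P - L' P)"
proof -
  obtain k where k: "k \<ge> 0" "\<And>P. P \<in> X \<Longrightarrow> nrm m (L P) \<le> k * ph.N P" using blin_bound[OF L] by blast
  obtain k' where k': "k' \<ge> 0" "\<And>P. P \<in> X \<Longrightarrow> nrm m (L' P) \<le> k' * ph.N P" using blin_bound[OF L'] by blast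
  show ?thesis
  proof (rule blinI[of _ _ "k + k'"])
    fix P assume P: "P \<in> X"
    have "nrm m (L P - L' P) \<le> nrm m (L P) + nrm m (- L' P)"
      using l2.N_triangle[of "L P" m "- L' P"] blin_l2[OF L P] blin_l2[OF L' P]
        subspace_neg[OF l2.subspace, of "L' P" m]
      by simp
    then show "nrm m (L P - L' P) \<le> (k + k') * ph.N P"
      using k(2)[OF P] k'(2)[OF P] blin_l2[OF L' P] by (simp add: l2.N_minus algebra_simps)
  qed (use k k' L L' in \<open>auto simp: blin_def scaleR_diff_right\<close>)
qed

lemma blin_xi_mult:
  assumes L: "blin Z L" and h: "h \<in> borel_measurable borel" "\<And>\<xi>. \<bar>h \<xi>\<bar> \<le> c"
  shows "blin Z (\<lambda>P. xi_mult h (L P))"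
proof -
  have c: "c \<ge> 0" using h(2)[of 0] by linarith
  obtain k where k: "k \<ge> 0" "\<And>P. P \<in> X \<Longrightarrow> nrm Z (L P) \<le> k * ph.N P" using blin_bound[OF L] by blast
  show ?thesis
  proof (rule blinI[of _ _ "c * k"])
    fix P assume P: "P \<in> X"
    show "xi_mult h (L P) \<in> l2 Z" by (rule xi_mult_l2[OF blin_l2[OF L P] h])
    have "nrm Z (xi_mult h (L P)) \<le> c * nrm Z (L P)" by (rule xi_mult_l2(2)[OF blin_l2[OF L P] h])
    also have "\<dots> \<le> c * (k * ph.N P)" using k(2)[OF P] c by (rule mult_left_mono)
    finally show "nrm Z (xi_mult h (L P)) \<le> c * k * ph.N P" by (simp add: mult.assoc)
  qed (use L c k in \<open>auto simp: blin_def xi_mult_def fun_eq_iff scaleR_fun_def algebra_simps\<close>)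
qed

lemma blin_tensor:
  assumes L: "blin M L" and a: "a \<in> borel_measurable borel" "integrable lborel (\<lambda>\<xi>. (a \<xi>)\<^sup>2)"
  shows "blin Z (\<lambda>P. tensor a (L P))"
proof -
  obtain k where k: "k \<ge> 0" "\<And>P. P \<in> X \<Longrightarrow> nrm M (L P) \<le> k * ph.N P" using blin_bound[OF L] by blast
  show ?thesis
  proof (rule blinI[of _ _ "sqrt (LINT \<xi>|lborel. (a \<xi>)\<^sup>2) * k"])
    fix P assume P: "P \<in> X"
    show "tensor a (L P) \<in> l2 Z" by (rule tensor_in_l2[OF a blin_l2[OF L P]])
    have "nrm Z (tensor a (L P)) = sqrt (LINT \<xi>|lborel. (a \<xi>)\<^sup>2) * nrm M (L P)"
      by (rule nrm_tensor[OF a blin_l2[OF L P]])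
    also have "\<dots> \<le> sqrt (LINT \<xi>|lborel. (a \<xi>)\<^sup>2) * (k * ph.N P)" using k(2)[OF P] by (intro mult_left_mono) auto
    finally show "nrm Z (tensor a (L P)) \<le> sqrt (LINT \<xi>|lborel. (a \<xi>)\<^sup>2) * k * ph.N P" by (simp add: mult.assoc)
  qed (use L k in \<open>auto simp: blin_def tensor_def fun_eq_iff scaleR_fun_def algebra_simps\<close>)
qed

lemma bform_ip:
  assumes L: "blin m L" and L': "blin m L'"
  shows "ph.bform (\<lambda>P Q. ip m (L P) (L' Q))"
proof -
  obtain k where k: "k \<ge> 0" "\<And>P. P \<in> X \<Longrightarrow> nrm m (L P) \<le> k * ph.N P" using blin_bound[OF L] by blast
  obtain k' where k': "k' \<ge> 0" "\<And>P. P \<in> X \<Longrightarrow> nrm m (L' P) \<le> k' * ph.N P" using blin_bound[OF L'] by blast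
  have b: "\<bar>ip m (L P) (L' Q)\<bar> \<le> (k * k') * ph.N P * ph.N Q" if "P \<in> X" "Q \<in> X" for P Q
  proof -
    have "\<bar>ip m (L P) (L' Q)\<bar> \<le> nrm m (L P) * nrm m (L' Q)"
      by (rule l2.B_Cauchy_Schwarz[OF blin_l2[OF L that(1)] blin_l2[OF L' that(2)]])
    also have "\<dots> \<le> (k * ph.N P) * (k' * ph.N Q)"
      using k k' that by (intro mult_mono) auto
    finally show ?thesis by (simp add: mult_ac)
  qed
  have l: "L P \<in> l2 m" "L' P \<in> l2 m" if "P \<in> X" for P using that L L' by (auto simp: blin_def)
  have add2: "ip m f (g + g') = ip m f g + ip m f g'" if "f \<in> l2 m" "g \<in> l2 m" "g' \<in> l2 m" for f g g'
    using l2.B_add[OF that(2,3,1)] by (simp add: ip_sym[of m f])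
  have scale2: "ip m f (r *\<^sub>R g) = r * ip m f g" if "f \<in> l2 m" "g \<in> l2 m" for f g r
    using l2.B_scale[OF that(2,1)] by (simp add: ip_sym[of m f])
  have "k * k' \<ge> 0" using k k' by simp
  then show ?thesis unfolding ph.bform_def
    using L L' b l by (auto simp: blin_def l2.B_add l2.B_scale add2 scale2)
qed

text \<open>Bilinearity and boundedness come from \<open>B\<close> by subtracting the other four
  energy terms, so the gradient terms need no separate estimate.\<close>

lemma bform_pot: "ph.bform pot"
proof -
  let ?b = "\<lambda>P Q. B P Q - \<rho>1 * ip M (st_U P) (st_U Q) - \<rho>2 * ip M (st_V P) (st_V Q)
     - C * ip Z (case_prod (st_p P)) (case_prod (st_p Q)) - C * ip Z (case_prod (st_q P)) (case_prod (st_q Q))"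
  have b: "ph.bform ?b"
    by (intro ph.bform_diff ph.bform_cmult ph.bform_B bform_ip blin_U blin_V blin_p blin_q)
  have "?b P Q = pot P Q" if "P \<in> X" "Q \<in> X" for P Q using that by (simp add: B_eq)
  with b show ?thesis by (rule ph.bform_cong)
qed

end

section \<open>Decay of the diffusive variables\<close>

text \<open>A bounded multiplier whose square is at most \<open>\<xi>\<^sup>2 + \<eta>\<close>. It
  stands in for the unbounded weight of the dissipation, since the Barbalat argument requires a
  bounded form, and it vanishes only at 0.\<close>

definition damping :: "real \<Rightarrow> real" where
  "damping \<xi> = \<bar>\<xi>\<bar> / sqrt (1 + \<xi>\<^sup>2)"

lemma damping_measurable [measurable]: "damping \<in> borel_measurable borel"
  unfolding damping_def by measurable

lemma damping_nonneg [simp]: "damping \<xi> \<ge> 0"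
  by (simp add: damping_def)

lemma damping_sq: "(damping \<xi>)\<^sup>2 = \<xi>\<^sup>2 / (1 + \<xi>\<^sup>2)"
  by (simp add: damping_def power_divide)

lemma damping_le_1: "damping \<xi> \<le> 1"
proof -
  have "(damping \<xi>)\<^sup>2 \<le> 1\<^sup>2" by (simp add: damping_sq divide_le_eq)
  then show ?thesis by (rule power2_le_imp_le) simp
qed

lemma damping_mono: "\<bar>a\<bar> \<le> \<bar>\<xi>\<bar> \<Longrightarrow> damping a \<le> damping \<xi>"
proof -
  assume "\<bar>a\<bar> \<le> \<bar>\<xi>\<bar>"
  then have "a\<^sup>2 \<le> \<xi>\<^sup>2" by (simp add: abs_le_square_iff)
  then have "(damping a)\<^sup>2 \<le> (damping \<xi>)\<^sup>2" by (simp add: damping_sq frac_le_eq field_simps)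
  then show ?thesis by (rule power2_le_imp_le) simp
qed

lemma damping_pos: "\<xi> \<noteq> 0 \<Longrightarrow> damping \<xi> > 0"
  by (simp add: damping_def)

text \<open>Decay of the damped variable passes to every multiplier bounded by a multiple of
  \<open>damping\<close>, in particular to bounded ones supported away from frequency 0.\<close>

lemma nrm_xi_mult_le:
  assumes f: "f \<in> l2 (cyl \<Omega>)" and k: "k \<in> borel_measurable borel" "\<And>\<xi>. \<bar>k \<xi>\<bar> \<le> c * damping \<xi>" and c: "c \<ge> 0"
  shows "nrm (cyl \<Omega>) (xi_mult k f) \<le> c * nrm (cyl \<Omega>) (xi_mult damping f)"
proof -
  have h: "xi_mult damping f \<in> l2 (cyl \<Omega>)"
    using damping_le_1 by (intro xi_mult_l2[OF f, of _ 1]) auto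
  have [measurable]: "f \<in> borel_measurable (cyl \<Omega>)" "k \<in> borel_measurable borel"
    using f k by (auto dest: l2_measurable)
  have "cmod (xi_mult k f z) \<le> cmod (of_real c * xi_mult damping f z)" for z
    using mult_right_mono[OF k(2)[of "fst z"] norm_ge_zero[of "f z"]] c
    by (simp add: xi_mult_def norm_mult mult.assoc)
  moreover have "xi_mult k f \<in> borel_measurable (cyl \<Omega>)" unfolding xi_mult_def by measurable
  ultimately have "nrm (cyl \<Omega>) (xi_mult k f) \<le> nrm (cyl \<Omega>) (\<lambda>z. of_real c * xi_mult damping f z)"
    by (intro nrm_mono l2_cmult h) auto
  then show ?thesis using c by (simp add: nrm_cmult)
qed

text \<open>Half-open, so that consecutive dyadic annuli are disjoint and have no gaps.\<close>

definition annulus :: "real \<Rightarrow> real \<Rightarrow> real set" where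
  "annulus a b = {\<xi>. a \<le> \<bar>\<xi>\<bar> \<and> \<bar>\<xi>\<bar> < b}"

text \<open>The frequency 0 is left out because no annulus of positive inner radius contains it; it
  is a null set.\<close>

definition punctured :: "real \<Rightarrow> real set" where
  "punctured b = {\<xi>. 0 < \<bar>\<xi>\<bar> \<and> \<bar>\<xi>\<bar> < b}"

lemma annulus_measurable [measurable]: "annulus a b \<in> sets borel"
  and punctured_measurable [measurable]: "punctured b \<in> sets borel"
  unfolding annulus_def punctured_def by measurable

locale mixture_semigroup = mixture +
  fixes T :: "real \<Rightarrow> state \<Rightarrow> state" and D :: "state set" and A :: "state \<Rightarrow> state"
  assumes semigroup: "dissipative_semigroup X B T D A"
begin

sublocale ph: dissipative_semigroup X B T D A
  by (rule semigroup)

text \<open>The bound on the observable of \<open>A (T t P)\<close> bounds its time derivative,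
  which is needed where that derivative multiplies a small factor.\<close>

lemma trajectory_bound:
  assumes L: "blin m L" and P: "P \<in> D"
  obtains K where "K \<ge> 0" "\<And>t. t \<ge> 0 \<Longrightarrow> nrm m (L (T t P)) \<le> K" "\<And>t. t \<ge> 0 \<Longrightarrow> nrm m (L (A (T t P))) \<le> K"
proof -
  obtain k where k: "k \<ge> 0" "\<And>P. P \<in> X \<Longrightarrow> nrm m (L P) \<le> k * ph.N P" using blin_bound[OF L] by blast
  show thesis
  proof
    show "k * (ph.N P + ph.N (A P)) \<ge> 0" using k P by simp
    fix t :: real assume t: "t \<ge> 0"
    have "nrm m (L (T t P)) \<le> k * ph.N (T t P)" using P t by (intro k) auto
    also have "\<dots> \<le> k * (ph.N P + ph.N (A P))"
      using ph.T_contr[OF t, of P] P k by (intro mult_left_mono) (auto intro: add_increasing2)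
    finally show "nrm m (L (T t P)) \<le> k * (ph.N P + ph.N (A P))" .
    have "nrm m (L (A (T t P))) \<le> k * ph.N (A (T t P))" using ph.T_domain(1)[OF P t] by (intro k) auto
    also have "\<dots> \<le> k * (ph.N P + ph.N (A P))"
      using ph.N_A_T_le[OF P t] P k by (intro mult_left_mono) (auto intro: add_increasing)
    finally show "nrm m (L (A (T t P))) \<le> k * (ph.N P + ph.N (A P))" .
  qed
qed

end

text \<open>One of the two displacements \<open>w\<close>, with its velocity \<open>W\<close> and its diffusive variable \<open>p\<close>, along the
  trajectory of \<open>P\<^sub>0\<close>.\<close>

locale channel = mixture_semigroup +
  fixes w W :: "state \<Rightarrow> field" and p :: "state \<Rightarrow> real \<Rightarrow> field" and P0 :: state
  assumes w: "blin M w" and W: "blin M W" and p: "blin Z (\<lambda>P. case_prod (p P))"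
    and P0: "P0 \<in> D"
    and w_deriv: "\<And>P. P \<in> D \<Longrightarrow> w (A P) = W P"
    and p_deriv: "\<And>P. P \<in> D \<Longrightarrow> p (A P) = diffusive \<alpha> \<eta> (p P) (W P)"
    and p_weighted: "\<And>P. P \<in> D \<Longrightarrow> weighted (p P) \<in> l2 Z"
    and p_limit: "((\<lambda>t. nrm Z (xi_mult damping (case_prod (p (T t P0))))) \<longlongrightarrow> 0) at_top"
    and p_bounded: "\<exists>K. \<forall>t\<ge>0. nrm Z (weighted (p (T t P0))) \<le> K"
begin

abbreviation x where "x t \<equiv> T t P0"

lemma x_D: "t \<ge> 0 \<Longrightarrow> x t \<in> D"
  using ph.T_domain(1)[OF P0] .

lemma x_X: "t \<ge> 0 \<Longrightarrow> x t \<in> X"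
  using x_D by auto

lemma xi_mult_limit:
  assumes "k \<in> borel_measurable borel" "\<And>\<xi>. \<bar>k \<xi>\<bar> \<le> c * damping \<xi>" "c \<ge> 0"
  shows "((\<lambda>t. nrm Z (xi_mult k (case_prod (p (x t))))) \<longlongrightarrow> 0) at_top"
proof (rule tendsto_sandwich[OF _ _ tendsto_const])
  show "((\<lambda>t. c * nrm Z (xi_mult damping (case_prod (p (x t))))) \<longlongrightarrow> 0) at_top"
    using tendsto_mult_right_zero[OF p_limit] .
  show "\<forall>\<^sub>F t in at_top. nrm Z (xi_mult k (case_prod (p (x t)))) \<le> c * nrm Z (xi_mult damping (case_prod (p (x t))))"
    using eventually_ge_at_top[of 0]
  proof eventually_elim
    case (elim t)
    show ?case by (rule nrm_xi_mult_le[OF blin_l2[OF p x_X[OF elim]] assms])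
  qed
qed auto

text \<open>The diffusive equation has source \<open>\<mu> W\<close>, so pairing \<open>p\<close>
  with \<open>\<mu> W\<close> and differentiating produces the square of the velocity. Every other
  term contains \<open>p\<close> on frequencies where it already decays, times a bounded
  factor.\<close>

lemma velocity_limit: "((\<lambda>t. nrm M (W (x t))) \<longlongrightarrow> 0) at_top"
proof -
  \<comment> \<open>On this interval \<open>damping\<close> is at least 1/2 and the rate
    \<open>\<xi>\<^sup>2 + \<eta>\<close> is bounded, so both \<open>a\<close> and \<open>k\<close>
    are dominated by multiples of \<open>damping\<close>.\<close>
  define a :: "real \<Rightarrow> real" where "a = indicat_real {1..2}"
  define am where "am \<xi> = a \<xi> * mu \<alpha> \<xi>" for \<xi>
  define k where "k \<xi> = a \<xi> * (\<xi>\<^sup>2 + \<eta>)" for \<xi>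
  have meas [measurable]: "a \<in> borel_measurable borel" "am \<in> borel_measurable borel" "k \<in> borel_measurable borel"
    unfolding a_def am_def[abs_def] k_def[abs_def] by measurable
  have am2: "integrable lborel (\<lambda>\<xi>. (am \<xi>)\<^sup>2)"
    unfolding am_def a_def using \<alpha> by (intro integrable_mu_sq_bounded[of _ _ 2]) auto
  have half: "damping \<xi> \<ge> 1 / 2" if "1 \<le> \<xi>" for \<xi>
  proof -
    have "(1 / 2)\<^sup>2 \<le> (damping \<xi>)\<^sup>2" using power_mono[OF that, of 2] by (simp add: damping_sq power_divide field_simps)
    then show ?thesis by (rule power2_le_imp_le) simp
  qed
  have a_le: "\<bar>a \<xi>\<bar> \<le> 2 * damping \<xi>" for \<xi>
    using half[of \<xi>] by (auto simp: a_def indicator_def)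
  have k_le: "\<bar>k \<xi>\<bar> \<le> (2 * (4 + \<eta>)) * damping \<xi>" for \<xi>
  proof (cases "\<xi> \<in> {1..2}")
    case True
    then have "\<xi>\<^sup>2 \<le> 2\<^sup>2" by (intro power_mono) auto
    then have "\<bar>k \<xi>\<bar> \<le> (4 + \<eta>) * 1" using True \<eta> by (simp add: k_def a_def)
    also have "\<dots> \<le> (4 + \<eta>) * (2 * damping \<xi>)" using half[of \<xi>] True \<eta> by (intro mult_left_mono) auto
    finally show ?thesis by (simp add: mult_ac)
  qed (use \<eta> in \<open>simp add: k_def a_def\<close>)
  have k_bd: "\<bar>k \<xi>\<bar> \<le> 2 * (4 + \<eta>)" for \<xi>
    using order_trans[OF k_le mult_left_mono[OF damping_le_1]] \<eta> by simp
  have a_bd: "\<bar>a \<xi>\<bar> \<le> 1" for \<xi> by (simp add: a_def indicator_def)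
  let ?ap = "\<lambda>P. xi_mult a (case_prod (p P))"
  let ?kp = "\<lambda>P. xi_mult k (case_prod (p P))"
  let ?tW = "\<lambda>P. tensor am (W P)"
  have bl: "blin Z ?ap" "blin Z ?kp" "blin Z ?tW"
    using blin_xi_mult[OF p meas(1) a_bd] blin_xi_mult[OF p meas(3) k_bd] blin_tensor[OF W meas(2) am2] by auto
  define c where "c P Q = (-1) * ip Z (?ap P) (?tW Q)" for P Q
  define q where "q P Q = ip Z (?tW P) (?tW Q)" for P Q
  obtain K where K: "K \<ge> 0" "\<And>t. t \<ge> 0 \<Longrightarrow> nrm Z (?tW (x t)) \<le> K" "\<And>t. t \<ge> 0 \<Longrightarrow> nrm Z (?tW (A (x t))) \<le> K"
    by (rule trajectory_bound[OF bl(3) P0], rule that; blast)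
  define r where "r t = nrm Z (?kp (x t)) * K + nrm Z (?ap (x t)) * K" for t
  have ap_lim: "((\<lambda>t. nrm Z (?ap (x t))) \<longlongrightarrow> 0) at_top" by (rule xi_mult_limit[OF meas(1) a_le]) simp
  have kp_lim: "((\<lambda>t. nrm Z (?kp (x t))) \<longlongrightarrow> 0) at_top" using \<eta> by (intro xi_mult_limit[OF meas(3) k_le]) simp
  have r_lim: "(r \<longlongrightarrow> 0) at_top"
    unfolding r_def using tendsto_add[OF tendsto_mult_left_zero[OF kp_lim, of K] tendsto_mult_left_zero[OF ap_lim, of K]] by simp
  have "((\<lambda>t. q (x t) (x t)) \<longlongrightarrow> 0) at_top"
  proof (rule ph.bform_barbalat[OF _ _ P0 _ _ r_lim, where c = c and q = q and l = 0])
    show "ph.bform c" unfolding c_def[abs_def] by (intro ph.bform_cmult bform_ip bl)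
    show "ph.bform q" unfolding q_def[abs_def] by (intro bform_ip bl)
    show "q Q Q \<ge> 0" for Q by (simp add: q_def nrm_sq[symmetric])
    show "((\<lambda>t. c (x t) (x t)) \<longlongrightarrow> 0) at_top"
    proof (rule Lim_null_comparison)
      show "((\<lambda>t. nrm Z (?ap (x t)) * K) \<longlongrightarrow> 0) at_top" using tendsto_mult_left_zero[OF ap_lim] .
      show "\<forall>\<^sub>F t in at_top. norm (c (x t) (x t)) \<le> nrm Z (?ap (x t)) * K"
        using eventually_ge_at_top[of 0]
      proof eventually_elim
        case (elim t)
        have "\<bar>ip Z (?ap (x t)) (?tW (x t))\<bar> \<le> nrm Z (?ap (x t)) * nrm Z (?tW (x t))"
          by (intro l2.B_Cauchy_Schwarz blin_l2[OF bl(1)] blin_l2[OF bl(3)] x_X elim)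
        also have "\<dots> \<le> nrm Z (?ap (x t)) * K" using K(2)[OF elim] by (intro mult_left_mono) auto
        finally show ?case by (simp add: c_def)
      qed
    qed
    fix t :: real assume "t > 0"
    then have t: "t \<ge> 0" by simp
    have AX: "A (x t) \<in> X" using x_D[OF t] by auto
    note l = blin_l2[OF bl(1) x_X[OF t]] blin_l2[OF bl(2) x_X[OF t]] blin_l2[OF bl(3) x_X[OF t]]
      blin_l2[OF bl(3) AX]
    \<comment> \<open>The diffusive equation localised to the chosen frequencies.\<close>
    have eq: "?ap (A (x t)) = ?tW (x t) - ?kp (x t)"
      unfolding p_deriv[OF x_D[OF t]]
      by (auto simp: fun_eq_iff xi_mult_def diffusive_def tensor_def am_def k_def algebra_simps)
    have "c (A (x t)) (x t) + c (x t) (A (x t)) = ip Z (?kp (x t)) (?tW (x t)) - ip Z (?ap (x t)) (?tW (A (x t))) - q (x t) (x t)"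
      using l2.B_diff[OF l(3,2,3)] unfolding c_def eq by (simp add: q_def)
    moreover have "\<bar>ip Z (?kp (x t)) (?tW (x t))\<bar> \<le> nrm Z (?kp (x t)) * K"
      by (rule order_trans[OF l2.B_Cauchy_Schwarz[OF l(2,3)] mult_left_mono[OF K(2)[OF t]]]) simp
    \<comment> \<open>The acceleration is only bounded, but it meets the factor
      \<open>?ap (x t)\<close>, which decays.\<close>
    moreover have "\<bar>ip Z (?ap (x t)) (?tW (A (x t)))\<bar> \<le> nrm Z (?ap (x t)) * K"
      by (rule order_trans[OF l2.B_Cauchy_Schwarz[OF l(1,4)] mult_left_mono[OF K(3)[OF t]]]) simp
    ultimately show "c (A (x t)) (x t) + c (x t) (A (x t)) \<le> r t - q (x t) (x t)"
      unfolding r_def by linarith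
  qed
  define \<kappa> where "\<kappa> = (LINT \<xi>|lborel. (am \<xi>)\<^sup>2)"
  \<comment> \<open>For \<open>\<xi>\<close> between 1 and 2 the power
    \<open>2 * \<alpha> - 1\<close> exceeds -1, so the integrand is at least 1/2. Dividing by
    \<open>\<kappa>\<close> recovers the velocity itself.\<close>
  have "1 / 2 \<le> \<kappa>"
  proof -
    have "(LINT (\<xi>::real)|lborel. (1 / 2) * indicat_real {1..2} \<xi>) \<le> \<kappa>"
      unfolding \<kappa>_def
    proof (intro integral_mono am2)
      show "integrable lborel (\<lambda>\<xi>::real. (1 / 2) * indicat_real {1..2} \<xi>)" by simp
      fix \<xi> :: real
      show "(1 / 2) * indicat_real {1..2} \<xi> \<le> (am \<xi>)\<^sup>2"
      proof (cases "\<xi> \<in> {1..2}")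
        case True
        then have "(am \<xi>)\<^sup>2 = \<xi> powr (2 * \<alpha> - 1)" by (simp add: am_def a_def mu_sq)
        also have "\<dots> \<ge> \<xi> powr (-1)" using True \<alpha> by (intro powr_mono) auto
        finally have "\<xi> powr (-1) \<le> (am \<xi>)\<^sup>2" .
        moreover have "\<xi> powr (-1) \<ge> 1 / 2" using True by (simp add: powr_minus_divide field_simps)
        ultimately have "1 / 2 \<le> (am \<xi>)\<^sup>2" by (rule order_trans[rotated])
        then show ?thesis using True by simp
      qed simp
    qed
    then show ?thesis by simp
  qed
  then have \<kappa>: "\<kappa> > 0" by simp
  have eq: "nrm M (W (x t)) = sqrt (q (x t) (x t)) / sqrt \<kappa>" if "t \<ge> 0" for t
    using nrm_tensor[OF meas(2) am2 blin_l2[OF W x_X[OF that]]] \<kappa>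
    by (simp add: q_def nrm_def \<kappa>_def field_simps)
  have "((\<lambda>t. sqrt (q (x t) (x t)) / sqrt \<kappa>) \<longlongrightarrow> sqrt 0 / sqrt \<kappa>) at_top"
    using \<kappa> by (intro tendsto_divide tendsto_real_sqrt tendsto_const \<open>((\<lambda>t. q (x t) (x t)) \<longlongrightarrow> 0) at_top\<close>) auto
  moreover have "\<forall>\<^sub>F t in at_top. sqrt (q (x t) (x t)) / sqrt \<kappa> = nrm M (W (x t))"
    using eventually_ge_at_top[of 0] by eventually_elim (simp only: eq)
  ultimately show ?thesis using tendsto_cong by fastforce
qed

text \<open>\<open>coupling\<close> is not continuous for the energy norm, so decay of
  \<open>p\<close> under \<open>damping\<close> does not suffice. Frequencies are split: on
  \<open>S n\<close> the weight is dominated by \<open>damping\<close>, while off \<open>S n\<close>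
  the tail of \<open>mu_weight\<close> is small uniformly in time, because
  \<open>weighted (p (x t))\<close> stays bounded.\<close>

lemma coupling_limit: "((\<lambda>t. coupling (p (x t)) (w (x t))) \<longlongrightarrow> 0) at_top"
proof -
  \<comment> \<open>Equivalently \<open>1 + \<xi>\<^sup>2 \<le> n * \<bar>\<xi>\<bar>\<close>: both
    very low and very high frequencies are excluded, and the complements shrink to the single point
    0.\<close>
  define S where "S n = {\<xi>. sqrt (1 + \<xi>\<^sup>2) \<le> real n * damping \<xi>}" for n
  have S [measurable]: "S n \<in> sets borel" for n unfolding S_def by measurable
  define tail where "tail n \<xi> = indicat_real (- S n) \<xi> * mu_weight \<alpha> \<xi>" for n \<xi>
  have tail_m [measurable]: "tail n \<in> borel_measurable borel" for n unfolding tail_def by measurable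
  have tail_le: "(tail n \<xi>)\<^sup>2 \<le> (mu_weight \<alpha> \<xi>)\<^sup>2" for n \<xi>
    by (simp add: tail_def indicator_def)
  have tail2: "integrable lborel (\<lambda>\<xi>. (tail n \<xi>)\<^sup>2)" for n
    by (rule Bochner_Integration.integrable_bound[OF integrable_mu_weight_sq[OF \<alpha>]]) (auto simp: tail_le)
  have "(\<lambda>n. LINT \<xi>|lborel. (tail n \<xi>)\<^sup>2) \<longlonglongrightarrow> (LINT (\<xi>::real)|lborel. (0 :: real))"
  proof (rule integral_dominated_convergence[where w = "\<lambda>\<xi>. (mu_weight \<alpha> \<xi>)\<^sup>2"])
    have "(\<lambda>n. (tail n \<xi>)\<^sup>2) \<longlonglongrightarrow> 0" if "\<xi> \<noteq> 0" for \<xi>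
    proof -
      obtain N :: nat where N: "sqrt (1 + \<xi>\<^sup>2) / damping \<xi> \<le> real N" using real_arch_simple by blast
      have "tail n \<xi> = 0" if "n \<ge> N" for n
      proof -
        have "sqrt (1 + \<xi>\<^sup>2) \<le> real N * damping \<xi>" using N damping_pos[OF \<open>\<xi> \<noteq> 0\<close>] by (simp add: divide_le_eq)
        also have "\<dots> \<le> real n * damping \<xi>" using that by (intro mult_right_mono) auto
        finally show ?thesis by (simp add: tail_def S_def)
      qed
      then have "\<forall>\<^sub>F n in sequentially. (tail n \<xi>)\<^sup>2 = 0"
        by (intro eventually_mono[OF eventually_ge_at_top[of N]]) simp
      then show ?thesis by (rule tendsto_eventually)
    qed
    then show "AE \<xi> in lborel. (\<lambda>n. (tail n \<xi>)\<^sup>2) \<longlonglongrightarrow> 0"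
      using AE_lborel_singleton[of "0::real"] by (auto elim: eventually_mono)
  qed (auto simp: tail_le integrable_mu_weight_sq[OF \<alpha>])
  then have "(\<lambda>n. sqrt (LINT \<xi>|lborel. (tail n \<xi>)\<^sup>2)) \<longlonglongrightarrow> 0"
    using tendsto_real_sqrt by fastforce
  then have tail_lim: "(\<lambda>n. K * sqrt (LINT \<xi>|lborel. (tail n \<xi>)\<^sup>2)) \<longlonglongrightarrow> 0" for K :: real
    using tendsto_mult_right_zero by blast
  obtain Kp where Kp: "\<And>t. t \<ge> 0 \<Longrightarrow> nrm Z (weighted (p (x t))) \<le> Kp" using p_bounded by blast
  obtain Kw where Kw: "Kw \<ge> 0" "\<And>t. t \<ge> 0 \<Longrightarrow> nrm M (w (x t)) \<le> Kw" "\<And>t. t \<ge> 0 \<Longrightarrow> nrm M (w (A (x t))) \<le> Kw"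
    by (rule trajectory_bound[OF w P0], rule that; blast)
  have Kp0: "Kp \<ge> 0" using Kp[of 0] nrm_nonneg[of Z "weighted (p (x 0))"] by linarith
  have mw0: "mu_weight_norm \<ge> 0" by (simp add: mu_weight_norm_def)
  have bound: "\<bar>coupling (p (x t)) (w (x t))\<bar> \<le> real n * nrm Z (xi_mult damping (case_prod (p (x t)))) * (mu_weight_norm * Kw)
      + Kp * Kw * sqrt (LINT \<xi>|lborel. (tail n \<xi>)\<^sup>2)" if t: "t \<ge> 0" for t n
  proof -
    define k where "k \<xi> = indicat_real (S n) \<xi> * sqrt (1 + \<xi>\<^sup>2)" for \<xi>
    have k [measurable]: "k \<in> borel_measurable borel" unfolding k_def by measurable
    have k_le: "\<bar>k \<xi>\<bar> \<le> real n * damping \<xi>" for \<xi> by (auto simp: k_def S_def indicator_def)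
    have pl: "case_prod (p (x t)) \<in> l2 Z" by (rule blin_l2[OF p x_X[OF t]])
    have wl: "w (x t) \<in> l2 M" by (rule blin_l2[OF w x_X[OF t]])
    have kl: "xi_mult k (case_prod (p (x t))) \<in> l2 Z"
    proof (rule xi_mult_l2(1)[OF pl k])
      show "\<bar>k \<xi>\<bar> \<le> real n * 1" for \<xi> by (rule order_trans[OF k_le mult_left_mono[OF damping_le_1]]) simp
    qed
    have weighted_l: "weighted (p (x t)) \<in> l2 Z" by (rule p_weighted[OF x_D[OF t]])
    have tl: "tensor (tail n) (w (x t)) \<in> l2 Z" by (rule tensor_in_l2[OF tail_m tail2 wl])
    have ml: "tensor (mu_weight \<alpha>) (w (x t)) \<in> l2 Z" by (rule tensor_mu_weight_l2[OF wl])
    have "coupling (p (x t)) (w (x t)) = (LINT z|Z. xi_mult k (case_prod (p (x t))) z \<bullet> tensor (mu_weight \<alpha>) (w (x t)) z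
        + weighted (p (x t)) z \<bullet> tensor (tail n) (w (x t)) z)"
      unfolding coupling_def ip_def
      by (intro Bochner_Integration.integral_cong refl)
        (auto simp: xi_mult_def weighted_def tensor_def k_def tail_def indicator_def)
    also have "\<dots> = ip Z (xi_mult k (case_prod (p (x t)))) (tensor (mu_weight \<alpha>) (w (x t)))
        + ip Z (weighted (p (x t))) (tensor (tail n) (w (x t)))"
      unfolding ip_def by (intro Bochner_Integration.integral_add l2_integrable_inner kl ml weighted_l tl)
    finally have "\<bar>coupling (p (x t)) (w (x t))\<bar>
        \<le> nrm Z (xi_mult k (case_prod (p (x t)))) * nrm Z (tensor (mu_weight \<alpha>) (w (x t)))
        + nrm Z (weighted (p (x t))) * nrm Z (tensor (tail n) (w (x t)))"
      using l2.B_Cauchy_Schwarz[OF kl ml] l2.B_Cauchy_Schwarz[OF weighted_l tl] by linarith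
    also have "nrm Z (xi_mult k (case_prod (p (x t)))) * nrm Z (tensor (mu_weight \<alpha>) (w (x t)))
        \<le> (real n * nrm Z (xi_mult damping (case_prod (p (x t))))) * (mu_weight_norm * Kw)"
      using Kw(2)[OF t] mw0 \<alpha>
      by (intro mult_mono nrm_xi_mult_le[OF pl k k_le])
        (auto simp: nrm_tensor[OF mu_weight_measurable integrable_mu_weight_sq wl] mu_weight_norm_def intro: mult_left_mono)
    also have "nrm Z (weighted (p (x t))) * nrm Z (tensor (tail n) (w (x t)))
        \<le> Kp * (sqrt (LINT \<xi>|lborel. (tail n \<xi>)\<^sup>2) * Kw)"
      unfolding nrm_tensor[OF tail_m tail2 wl] using Kp[OF t] Kw(2)[OF t] Kp0
      by (intro mult_mono) auto
    finally show ?thesis by (simp add: mult_ac)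
  qed
  show ?thesis
  proof (rule tendstoI)
    fix e :: real assume e: "e > 0"
    \<comment> \<open>The cut \<open>n\<close> is fixed before time: the tail bound holds for all
      times, and only the remaining term needs late times.\<close>
    obtain n where n: "Kp * Kw * sqrt (LINT \<xi>|lborel. (tail n \<xi>)\<^sup>2) < e / 2"
      using order_tendstoD(2)[OF tail_lim[of "Kp * Kw"], of "e / 2"] e
      by (auto dest!: eventually_happens'[OF sequentially_bot])
    have "((\<lambda>t. real n * nrm Z (xi_mult damping (case_prod (p (x t)))) * (mu_weight_norm * Kw)) \<longlongrightarrow> 0) at_top"
      by (intro tendsto_mult_left_zero tendsto_mult_right_zero p_limit)
    then have "\<forall>\<^sub>F t in at_top. real n * nrm Z (xi_mult damping (case_prod (p (x t)))) * (mu_weight_norm * Kw) < e / 2"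
      using e by (intro order_tendstoD) auto
    then show "\<forall>\<^sub>F t in at_top. dist (coupling (p (x t)) (w (x t))) 0 < e"
      using eventually_ge_at_top[of 0]
    proof eventually_elim
      case (elim t)
      then show ?case using bound[of t n] n by (simp add: dist_real_def)
    qed
  qed
qed

end

section \<open>Low frequencies of the diffusive variable\<close>

context channel
begin

text \<open>\<open>p - \<mu> w\<close> restricted to frequencies in \<open>S\<close>. Since \<open>\<partial>\<^sub>t (p - \<mu> w) = - (\<xi>\<^sup>2 + \<eta>) p\<close>, on an annulus
  \<open>a \<le> \<bar>\<xi>\<bar> < 2 a\<close> its growth is controlled uniformly in \<open>a\<close>.\<close>
definition low :: "real set \<Rightarrow> state \<Rightarrow> real \<times> R3 \<Rightarrow> complex" where
  "low S P = xi_mult (indicat_real S) (case_prod (p P)) - tensor (\<lambda>\<xi>. indicat_real S \<xi> * mu \<alpha> \<xi>) (w P)"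

definition mu_mass :: "real set \<Rightarrow> real" where
  "mu_mass S = (LINT \<xi>|lborel. (indicat_real S \<xi> * mu \<alpha> \<xi>)\<^sup>2)"

lemma low_apply: "low S P (\<xi>, y) = indicator S \<xi> * (p P \<xi> y - of_real (mu \<alpha> \<xi>) * w P y)"
  by (simp add: low_def xi_mult_def tensor_def indicator_def)

lemma indicator_mu_measurable: "S \<in> sets borel \<Longrightarrow> (\<lambda>\<xi>. indicat_real S \<xi> * mu \<alpha> \<xi>) \<in> borel_measurable borel"
  by (intro borel_measurable_times borel_measurable_indicator mu_measurable)

lemma indicator_mu_integrable:
  "S \<in> sets borel \<Longrightarrow> (\<And>\<xi>. \<xi> \<in> S \<Longrightarrow> \<bar>\<xi>\<bar> \<le> b) \<Longrightarrow> integrable lborel (\<lambda>\<xi>. (indicat_real S \<xi> * mu \<alpha> \<xi>)\<^sup>2)"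
  using \<alpha> by (rule integrable_mu_sq_bounded)

lemma blin_low:
  assumes S: "S \<in> sets borel" "\<And>\<xi>. \<xi> \<in> S \<Longrightarrow> \<bar>\<xi>\<bar> \<le> b"
  shows "blin Z (low S)"
proof -
  have "blin Z (\<lambda>P. xi_mult (indicat_real S) (case_prod (p P)))"
    using S by (intro blin_xi_mult[OF p, of _ 1]) auto
  moreover have "blin Z (\<lambda>P. tensor (\<lambda>\<xi>. indicat_real S \<xi> * mu \<alpha> \<xi>) (w P))"
    by (rule blin_tensor[OF w indicator_mu_measurable[OF S(1)] indicator_mu_integrable[OF S]])
  ultimately show ?thesis unfolding low_def[abs_def] by (rule blin_diff)
qed

lemma annulus_bounded: "\<xi> \<in> annulus a b \<Longrightarrow> \<bar>\<xi>\<bar> \<le> b"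
  and punctured_bounded: "\<xi> \<in> punctured b \<Longrightarrow> \<bar>\<xi>\<bar> \<le> b"
  by (auto simp: annulus_def punctured_def)

text \<open>On the annulus the rate \<open>\<xi>\<^sup>2 + \<eta>\<close> lies between
  \<open>a\<^sup>2 + \<eta>\<close>, which damps, and \<open>b\<^sup>2 + \<eta>\<close>, which
  multiplies the source formed from the bounded displacement. The dissipative Gronwall bound keeps
  only the quotient of the two.\<close>

lemma low_annulus_growth:
  assumes a: "0 < a" "b \<le> 2 * a" and K: "\<And>t. t \<ge> 0 \<Longrightarrow> nrm M (w (x t)) \<le> K" and t: "t \<ge> 0"
  shows "ip Z (low (annulus a b) (x t)) (low (annulus a b) (x t))
    \<le> ip Z (low (annulus a b) (x 0)) (low (annulus a b) (x 0)) + 4 * K\<^sup>2 * mu_mass (annulus a b)"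
proof (cases "b \<ge> 0")
  case False
  then have S: "annulus a b = {}" using a by (auto simp: annulus_def)
  have "low {} P = (\<lambda>z. 0)" for P by (auto simp: fun_eq_iff low_apply)
  then show ?thesis unfolding S by (simp add: ip_def mu_mass_def)
next
  case b: True
  define S where "S = annulus a b"
  define k where "k \<xi> = indicat_real S \<xi> * (\<xi>\<^sup>2 + \<eta>)" for \<xi>
  define m where "m = mu_mass S"
  have S: "S \<in> sets borel" "\<And>\<xi>. \<xi> \<in> S \<Longrightarrow> \<bar>\<xi>\<bar> \<le> b" by (auto simp: S_def annulus_bounded)
  have k [measurable]: "k \<in> borel_measurable borel" unfolding k_def[abs_def] using S by measurable
  have S_sq: "a\<^sup>2 \<le> \<xi>\<^sup>2" "\<xi>\<^sup>2 \<le> b\<^sup>2" if "\<xi> \<in> S" for \<xi>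
  proof -
    have "\<bar>a\<bar> \<le> \<bar>\<xi>\<bar>" "\<bar>\<xi>\<bar> \<le> \<bar>b\<bar>" using that a b by (auto simp: S_def annulus_def)
    then show "a\<^sup>2 \<le> \<xi>\<^sup>2" "\<xi>\<^sup>2 \<le> b\<^sup>2" by (simp_all add: abs_le_square_iff)
  qed
  have k_bd: "\<bar>k \<xi>\<bar> \<le> b\<^sup>2 + \<eta>" for \<xi> using S_sq(2)[of \<xi>] \<eta> by (auto simp: k_def indicator_def)
  have bl: "blin Z (low S)" by (rule blin_low[OF S])
  let ?f = "\<lambda>t. ip Z (low S (x t)) (low S (x t))"
  let ?f' = "\<lambda>t. ip Z (low S (A (x t))) (low S (x t)) + ip Z (low S (x t)) (low S (A (x t)))"
  have m0: "m \<ge> 0" by (simp add: m_def mu_mass_def)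
  have K0: "K \<ge> 0" using K[of 0] nrm_nonneg[of M "w (x 0)"] by linarith
  have deriv: "?f' t \<le> (b\<^sup>2 + \<eta>) * (m * K\<^sup>2) - (a\<^sup>2 + \<eta>) * ?f t" if t: "t \<ge> 0" for t
  proof -
    let ?L = "low S (x t)" and ?p = "xi_mult k (case_prod (p (x t)))"
    let ?t = "tensor (\<lambda>\<xi>. indicat_real S \<xi> * mu \<alpha> \<xi>) (w (x t))"
    have Ll: "?L \<in> l2 Z" by (rule blin_l2[OF bl x_X[OF t]])
    have pl: "?p \<in> l2 Z" by (rule xi_mult_l2(1)[OF blin_l2[OF p x_X[OF t]] k k_bd])
    have wl: "w (x t) \<in> l2 M" by (rule blin_l2[OF w x_X[OF t]])
    have tl: "?t \<in> l2 Z"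
      by (rule tensor_in_l2[OF indicator_mu_measurable[OF S(1)] indicator_mu_integrable[OF S] wl])
    \<comment> \<open>The source \<open>\<mu> W\<close> cancels against the time derivative of
      \<open>\<mu> w\<close>, so no velocity appears.\<close>
    have "low S (A (x t)) = - ?p"
      using p_deriv[OF x_D[OF t]] w_deriv[OF x_D[OF t]]
      by (auto simp: fun_eq_iff low_apply xi_mult_def diffusive_def k_def indicator_def algebra_simps)
    then have "?f' t = - 2 * ip Z ?p ?L"
      using ip_sym[of Z ?L "- ?p"] l2.B_scale[OF pl Ll, of "-1"] by simp
    also have "\<dots> \<le> (LINT z|Z. (b\<^sup>2 + \<eta>) * (cmod (?t z))\<^sup>2 - (a\<^sup>2 + \<eta>) * (cmod (?L z))\<^sup>2)"
    proof -
      have "(LINT z|Z. - 2 * (?p z \<bullet> ?L z)) \<le> (LINT z|Z. (b\<^sup>2 + \<eta>) * (cmod (?t z))\<^sup>2 - (a\<^sup>2 + \<eta>) * (cmod (?L z))\<^sup>2)"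
      proof (rule integral_mono)
        show "integrable Z (\<lambda>z. - 2 * (?p z \<bullet> ?L z))"
          by (intro integrable_mult_right l2_integrable_inner pl Ll)
        show "integrable Z (\<lambda>z. (b\<^sup>2 + \<eta>) * (cmod (?t z))\<^sup>2 - (a\<^sup>2 + \<eta>) * (cmod (?L z))\<^sup>2)"
          by (intro Bochner_Integration.integrable_diff integrable_mult_right l2_integrable_square tl Ll)
        fix z :: "real \<times> R3"
        obtain \<xi> y where z: "z = (\<xi>, y)" by (cases z)
        show "- 2 * (?p z \<bullet> ?L z) \<le> (b\<^sup>2 + \<eta>) * (cmod (?t z))\<^sup>2 - (a\<^sup>2 + \<eta>) * (cmod (?L z))\<^sup>2"
        proof (cases "\<xi> \<in> S")
          case False
          then show ?thesis by (simp add: z low_apply xi_mult_def tensor_def k_def)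
        next
          case True
          define q where "q = p (x t) \<xi> y"
          define r where "r = of_real (mu \<alpha> \<xi>) * w (x t) y"
          define c where "c = \<xi>\<^sup>2 + \<eta>"
          have c: "a\<^sup>2 + \<eta> \<le> c" "c \<le> b\<^sup>2 + \<eta>" "c \<ge> 0" using S_sq[OF True] \<eta> by (auto simp: c_def)
          have v: "?p z = c *\<^sub>R q" "?L z = q - r" "?t z = r"
            using True by (simp_all add: z low_apply xi_mult_def tensor_def k_def q_def r_def c_def scaleR_conv_of_real)
          have "(cmod r)\<^sup>2 = (cmod (q - (q - r)))\<^sup>2" by simp
          also have "\<dots> = (cmod q)\<^sup>2 - 2 * (q \<bullet> (q - r)) + (cmod (q - r))\<^sup>2"
            by (simp add: power2_norm_eq_inner inner_diff_left inner_diff_right inner_commute)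
          \<comment> \<open>Polarisation splits the dissipation into damping of
            \<open>q - r\<close>, a source in \<open>r\<close>, and a term in \<open>q\<close> of
            favourable sign, which is dropped.\<close>
          finally have "- 2 * (q \<bullet> (q - r)) = (cmod r)\<^sup>2 - (cmod q)\<^sup>2 - (cmod (q - r))\<^sup>2" by simp
          then have "c * (- 2 * (q \<bullet> (q - r))) = c * ((cmod r)\<^sup>2 - (cmod q)\<^sup>2 - (cmod (q - r))\<^sup>2)"
            by (rule arg_cong)
          then have "- 2 * (c * (q \<bullet> (q - r))) = c * ((cmod r)\<^sup>2 - (cmod q)\<^sup>2 - (cmod (q - r))\<^sup>2)"
            by (simp only: mult.left_commute)
          also have "\<dots> \<le> c * (cmod r)\<^sup>2 - c * (cmod (q - r))\<^sup>2" using c by (simp add: algebra_simps)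
          also have "\<dots> \<le> (b\<^sup>2 + \<eta>) * (cmod r)\<^sup>2 - (a\<^sup>2 + \<eta>) * (cmod (q - r))\<^sup>2"
            using c by (intro diff_mono mult_right_mono) auto
          finally show ?thesis by (simp only: v inner_scaleR_left)
        qed
      qed
      then show ?thesis by (simp add: ip_def)
    qed
    also have "\<dots> = (b\<^sup>2 + \<eta>) * ip Z ?t ?t - (a\<^sup>2 + \<eta>) * ip Z ?L ?L"
      using tl Ll by (simp add: ip_self l2_integrable_square)
    also have "ip Z ?t ?t = m * (nrm M (w (x t)))\<^sup>2"
      using nrm_tensor[OF indicator_mu_measurable[OF S(1)] indicator_mu_integrable[OF S] wl]
      by (simp add: nrm_sq[symmetric] power_mult_distrib m_def mu_mass_def)
    also have "(b\<^sup>2 + \<eta>) * (m * (nrm M (w (x t)))\<^sup>2) \<le> (b\<^sup>2 + \<eta>) * (m * K\<^sup>2)"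
      using K[OF t] m0 \<eta> by (intro mult_left_mono power_mono) auto
    finally show ?thesis by simp
  qed
  have "?f t \<le> ?f 0 + ((b\<^sup>2 + \<eta>) * (m * K\<^sup>2)) / (a\<^sup>2 + \<eta>)"
  proof (rule gronwall_dissipation[OF _ deriv])
    show "(?f has_real_derivative ?f' t) (at t within {0..})" if "t \<ge> 0" for t
      by (rule ph.bform_has_derivative[OF bform_ip[OF bl bl] P0 that])
    show "0 < a\<^sup>2 + \<eta>" using a \<eta> by (simp add: add_pos_nonneg)
  qed (use m0 \<eta> t in \<open>auto simp: nrm_sq[symmetric]\<close>)
  also have "((b\<^sup>2 + \<eta>) * (m * K\<^sup>2)) / (a\<^sup>2 + \<eta>) \<le> 4 * (m * K\<^sup>2)"
  proof -
    \<comment> \<open>The constant 4 is the squared ratio of the radii; adding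
      \<open>\<eta> \<ge> 0\<close> to both rates preserves it.\<close>
    have "b\<^sup>2 \<le> (2 * a)\<^sup>2" using a b by (intro power_mono) auto
    then have "b\<^sup>2 + \<eta> \<le> 4 * (a\<^sup>2 + \<eta>)" using \<eta> by (simp add: power_mult_distrib)
    then have "(b\<^sup>2 + \<eta>) * (m * K\<^sup>2) \<le> (4 * (a\<^sup>2 + \<eta>)) * (m * K\<^sup>2)" using m0 by (intro mult_right_mono) auto
    also have "\<dots> = 4 * (m * K\<^sup>2) * (a\<^sup>2 + \<eta>)" by (simp only: mult_ac)
    finally show ?thesis using a \<eta> by (subst pos_divide_le_eq) (auto simp: add_pos_nonneg)
  qed
  finally show ?thesis by (simp add: S_def m_def mult_ac)
qed

text \<open>Disjoint frequency supports are orthogonal, so bounds on annuli add up exactly and no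
  constant accumulates over the dyadic sum.\<close>

lemma low_disjoint_union:
  assumes S: "S \<in> sets borel" "S' \<in> sets borel" "\<And>\<xi>. \<xi> \<in> S \<union> S' \<Longrightarrow> \<bar>\<xi>\<bar> \<le> b" and disj: "S \<inter> S' = {}" and P: "P \<in> X"
  shows "ip Z (low (S \<union> S') P) (low (S \<union> S') P) = ip Z (low S P) (low S P) + ip Z (low S' P) (low S' P)"
    and "mu_mass (S \<union> S') = mu_mass S + mu_mass S'"
proof -
  have l: "low S P \<in> l2 Z" "low S' P \<in> l2 Z"
    using blin_l2[OF blin_low P, of S b] blin_l2[OF blin_low P, of S' b] S by auto
  have "(cmod (low (S \<union> S') P z))\<^sup>2 = (cmod (low S P z))\<^sup>2 + (cmod (low S' P z))\<^sup>2" for z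
  proof (cases z)
    case (Pair \<xi> y)
    then show ?thesis using disj by (cases "\<xi> \<in> S"; cases "\<xi> \<in> S'") (auto simp: low_apply)
  qed
  then show "ip Z (low (S \<union> S') P) (low (S \<union> S') P) = ip Z (low S P) (low S P) + ip Z (low S' P) (low S' P)"
    using l by (simp add: ip_self l2_integrable_square)
  have i: "integrable lborel (\<lambda>\<xi>. (indicat_real S \<xi> * mu \<alpha> \<xi>)\<^sup>2)" "integrable lborel (\<lambda>\<xi>. (indicat_real S' \<xi> * mu \<alpha> \<xi>)\<^sup>2)"
    using indicator_mu_integrable[of S b] indicator_mu_integrable[of S' b] S by auto
  have "(indicat_real (S \<union> S') \<xi> * mu \<alpha> \<xi>)\<^sup>2 = (indicat_real S \<xi> * mu \<alpha> \<xi>)\<^sup>2 + (indicat_real S' \<xi> * mu \<alpha> \<xi>)\<^sup>2" for \<xi>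
    using disj by (cases "\<xi> \<in> S"; cases "\<xi> \<in> S'") auto
  then show "mu_mass (S \<union> S') = mu_mass S + mu_mass S'"
    unfolding mu_mass_def using i by simp
qed

lemma low_mono:
  assumes S: "S \<in> sets borel" "S' \<in> sets borel" "\<And>\<xi>. \<xi> \<in> S' \<Longrightarrow> \<bar>\<xi>\<bar> \<le> b" and sub: "S \<subseteq> S'" and P: "P \<in> X"
  shows "ip Z (low S P) (low S P) \<le> ip Z (low S' P) (low S' P)" "mu_mass S \<le> mu_mass S'"
proof -
  have eq: "S \<union> (S' - S) = S'" using sub by auto
  have d: "ip Z (low S' P) (low S' P) = ip Z (low S P) (low S P) + ip Z (low (S' - S) P) (low (S' - S) P)"
    "mu_mass S' = mu_mass S + mu_mass (S' - S)"
    using low_disjoint_union[of S "S' - S" b P] S sub P unfolding eq by auto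
  then show "ip Z (low S P) (low S P) \<le> ip Z (low S' P) (low S' P)" by (simp add: nrm_sq[symmetric])
  have "mu_mass (S' - S) \<ge> 0" by (simp add: mu_mass_def)
  then show "mu_mass S \<le> mu_mass S'" using d by simp
qed

text \<open>Induction over dyadic annuli gives the bound down to radius \<open>e / 2 ^ n\<close>
  with the same constant for all \<open>n\<close>; the annuli exhaust the punctured interval, and
  dominated convergence at the fixed time \<open>t\<close> removes the inner radius.\<close>

lemma low_punctured_growth:
  assumes e: "e > 0" and K: "\<And>t. t \<ge> 0 \<Longrightarrow> nrm M (w (x t)) \<le> K" and t: "t \<ge> 0"
  shows "ip Z (low (punctured e) (x t)) (low (punctured e) (x t))
    \<le> ip Z (low (punctured e) (x 0)) (low (punctured e) (x 0)) + 4 * K\<^sup>2 * mu_mass (punctured e)" (is "_ \<le> ?\<beta>")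
proof -
  let ?S = "\<lambda>n. annulus (e / 2 ^ n) e"
  have dyadic: "ip Z (low (?S n) (x t)) (low (?S n) (x t))
    \<le> ip Z (low (?S n) (x 0)) (low (?S n) (x 0)) + 4 * K\<^sup>2 * mu_mass (?S n)" for n
  proof (induction n)
    case 0
    have S: "annulus e e = {}" by (auto simp: annulus_def)
    have "low {} P = (\<lambda>z. 0)" for P by (auto simp: fun_eq_iff low_apply)
    then show ?case by (simp add: S ip_def mu_mass_def)
  next
    case (Suc n)
    let ?R = "annulus (e / 2 ^ Suc n) (e / 2 ^ n)"
    have le: "e / 2 ^ Suc n \<le> e / 2 ^ n" "e / 2 ^ n \<le> e"
      using e by (auto simp: divide_le_eq field_simps)
    have un: "?S (Suc n) = ?R \<union> ?S n" using le unfolding annulus_def by auto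
    have disj: "?R \<inter> ?S n = {}" by (auto simp: annulus_def)
    have bd: "\<bar>\<xi>\<bar> \<le> e" if "\<xi> \<in> ?R \<union> ?S n" for \<xi> using that le by (auto simp: annulus_def)
    have "ip Z (low ?R (x t)) (low ?R (x t)) \<le> ip Z (low ?R (x 0)) (low ?R (x 0)) + 4 * K\<^sup>2 * mu_mass ?R"
      using e by (intro low_annulus_growth K t) auto
    moreover have "ip Z (low (?S (Suc n)) (x s)) (low (?S (Suc n)) (x s))
        = ip Z (low ?R (x s)) (low ?R (x s)) + ip Z (low (?S n) (x s)) (low (?S n) (x s))" if "s \<ge> 0" for s
      unfolding un by (rule low_disjoint_union(1)[OF annulus_measurable annulus_measurable bd disj x_X[OF that]])
    moreover have "mu_mass (?S (Suc n)) = mu_mass ?R + mu_mass (?S n)"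
      unfolding un by (rule low_disjoint_union(2)[OF annulus_measurable annulus_measurable bd disj x_X[OF t]])
    ultimately show ?case using Suc.IH t by (simp only: distrib_left order_refl)
  qed
  have pos: "e / 2 ^ n > 0" for n :: nat using e by simp
  have sub: "?S n \<subseteq> punctured e" for n
    unfolding annulus_def punctured_def using less_le_trans[OF pos[of n]] by blast
  have bound: "nrm Z (low (?S n) (x t)) \<le> sqrt ?\<beta>" for n
  proof -
    have "ip Z (low (?S n) (x 0)) (low (?S n) (x 0)) + 4 * K\<^sup>2 * mu_mass (?S n) \<le> ?\<beta>"
      using low_mono[OF annulus_measurable punctured_measurable punctured_bounded sub x_X[OF order_refl]]
      by (intro add_mono mult_left_mono) auto
    then show ?thesis unfolding nrm_def using order_trans[OF dyadic[of n]] by (intro real_sqrt_le_mono) auto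
  qed
  have bl: "blin Z (low (punctured e))" by (rule blin_low[OF punctured_measurable punctured_bounded])
  have bln: "blin Z (low (?S n))" for n by (rule blin_low[OF annulus_measurable annulus_bounded])
  note l = blin_l2[OF bl x_X[OF t]] blin_l2[OF bln x_X[OF t]]
  have "(\<lambda>n. nrm Z (\<lambda>z. low (punctured e) (x t) z - low (?S n) (x t) z)) \<longlonglongrightarrow> 0"
  proof (rule nrm_dominated_convergence[OF l2_measurable[OF l(1)] l(1) l2_measurable[OF l(2)]])
    have "cmod (low (?S n) (x t) z) \<le> cmod (low (punctured e) (x t) z)" for n z
    proof (cases z)
      case (Pair \<xi> y)
      show ?thesis using subsetD[OF sub[of n], of \<xi>] by (auto simp: Pair low_apply indicator_def)
    qed
    then show "AE z in Z. cmod (low (?S n) (x t) z) \<le> cmod (low (punctured e) (x t) z)" for n by simp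
    have "(\<lambda>n. low (?S n) (x t) z) \<longlonglongrightarrow> low (punctured e) (x t) z" for z
    proof (cases z)
      case (Pair \<xi> y)
      show ?thesis
      proof (cases "\<xi> \<in> punctured e")
        case True
        have "(\<lambda>n. e * (1 / 2) ^ n) \<longlonglongrightarrow> e * 0" by (intro tendsto_mult tendsto_const LIMSEQ_power_zero) auto
        then have "(\<lambda>n. e / 2 ^ n) \<longlonglongrightarrow> 0" by (simp add: power_divide)
        then have "\<forall>\<^sub>F n in sequentially. e / 2 ^ n < \<bar>\<xi>\<bar>"
          using True by (intro order_tendstoD) (auto simp: punctured_def)
        then have "\<forall>\<^sub>F n in sequentially. low (?S n) (x t) z = low (punctured e) (x t) z"
        proof eventually_elim
          case (elim n)
          then show ?case using True by (auto simp: Pair low_apply annulus_def punctured_def)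
        qed
        then show ?thesis by (rule tendsto_eventually)
      next
        case False
        then have "\<xi> \<notin> ?S n" for n using sub[of n] by blast
        then show ?thesis using False by (simp add: Pair low_apply)
      qed
    qed
    then show "AE z in Z. (\<lambda>n. low (?S n) (x t) z) \<longlonglongrightarrow> low (punctured e) (x t) z" by simp
  qed
  then have lim: "(\<lambda>n. sqrt ?\<beta> + nrm Z (low (punctured e) (x t) - low (?S n) (x t))) \<longlonglongrightarrow> sqrt ?\<beta> + 0"
    by (intro tendsto_add tendsto_const) (simp add: fun_diff_def)
  have "nrm Z (low (punctured e) (x t)) \<le> sqrt ?\<beta> + 0"
  proof (rule tendsto_lowerbound[OF lim])
    have "nrm Z (low (punctured e) (x t)) \<le> sqrt ?\<beta> + nrm Z (low (punctured e) (x t) - low (?S n) (x t))" for n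
      using l2.N_le_add_diff[OF l(1) l(2)[of n]] bound[of n] by linarith
    then show "\<forall>\<^sub>F n in sequentially. nrm Z (low (punctured e) (x t)) \<le> sqrt ?\<beta> + nrm Z (low (punctured e) (x t) - low (?S n) (x t))"
      by simp
  qed simp
  then have "sqrt (ip Z (low (punctured e) (x t)) (low (punctured e) (x t))) \<le> sqrt ?\<beta>" by (simp add: nrm_def)
  then show ?thesis by (simp only: real_sqrt_le_iff)
qed

text \<open>The punctured intervals shrink to the empty set, so dominated convergence applies. Only
  the initial state matters here: \<open>low_punctured_growth\<close> carries the smallness to all
  later times.\<close>

lemma small_frequencies:
  "\<exists>\<epsilon> :: nat \<Rightarrow> real. (\<forall>n. \<epsilon> n > 0) \<and>
    (\<lambda>n. ip Z (low (punctured (\<epsilon> n)) (x 0)) (low (punctured (\<epsilon> n)) (x 0))) \<longlonglongrightarrow> 0 \<and>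
    (\<lambda>n. mu_mass (punctured (\<epsilon> n))) \<longlonglongrightarrow> 0"
proof -
  define \<epsilon> where "\<epsilon> n = inverse (real (Suc n))" for n
  have pos: "\<epsilon> n > 0" for n by (simp add: \<epsilon>_def)
  have le: "\<epsilon> n \<le> 1" for n by (simp add: \<epsilon>_def field_simps)
  have lim: "\<epsilon> \<longlonglongrightarrow> 0" unfolding \<epsilon>_def by (rule LIMSEQ_inverse_real_of_nat)
  have sub: "punctured (\<epsilon> n) \<subseteq> punctured 1" for n using le[of n] by (auto simp: punctured_def)
  have vanish: "\<forall>\<^sub>F n in sequentially. \<xi> \<notin> punctured (\<epsilon> n)" for \<xi>
  proof (cases "\<xi> = 0")
    case False
    have "\<forall>\<^sub>F n in sequentially. \<epsilon> n < \<bar>\<xi>\<bar>" using order_tendstoD(2)[OF lim, of "\<bar>\<xi>\<bar>"] False by simp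
    then show ?thesis by eventually_elim (simp add: punctured_def)
  qed (simp add: punctured_def)
  have bl: "blin Z (low (punctured e))" for e by (rule blin_low[OF punctured_measurable punctured_bounded])
  note l = blin_l2[OF bl x_X[OF order_refl]]
  have "(\<lambda>n. nrm Z (\<lambda>z. 0 - low (punctured (\<epsilon> n)) (x 0) z)) \<longlonglongrightarrow> 0"
  proof (rule nrm_dominated_convergence[OF _ l[of 1] l2_measurable[OF l]])
    have "cmod (low (punctured (\<epsilon> n)) (x 0) z) \<le> cmod (low (punctured 1) (x 0) z)" for n z
      using sub[of n] by (cases z) (auto simp: low_apply indicator_def)
    then show "AE z in Z. cmod (low (punctured (\<epsilon> n)) (x 0) z) \<le> cmod (low (punctured 1) (x 0) z)" for n by simp
    have "(\<lambda>n. low (punctured (\<epsilon> n)) (x 0) z) \<longlonglongrightarrow> 0" for z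
    proof (rule tendsto_eventually)
      show "\<forall>\<^sub>F n in sequentially. low (punctured (\<epsilon> n)) (x 0) z = 0"
        using vanish[of "fst z"] by eventually_elim (cases z, simp add: low_apply)
    qed
    then show "AE z in Z. (\<lambda>n. low (punctured (\<epsilon> n)) (x 0) z) \<longlonglongrightarrow> 0" by simp
  qed simp
  then have "(\<lambda>n. nrm Z (low (punctured (\<epsilon> n)) (x 0))) \<longlonglongrightarrow> 0"
    using nrm_cmult[of Z "-1"] by simp
  then have "(\<lambda>n. (nrm Z (low (punctured (\<epsilon> n)) (x 0)))\<^sup>2) \<longlonglongrightarrow> 0\<^sup>2" by (rule tendsto_power)
  then have 1: "(\<lambda>n. ip Z (low (punctured (\<epsilon> n)) (x 0)) (low (punctured (\<epsilon> n)) (x 0))) \<longlonglongrightarrow> 0"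
    by (simp add: nrm_sq)
  have "(\<lambda>n. LINT \<xi>|lborel. (indicat_real (punctured (\<epsilon> n)) \<xi> * mu \<alpha> \<xi>)\<^sup>2) \<longlonglongrightarrow> (LINT (\<xi>::real)|lborel. (0::real))"
  proof (rule integral_dominated_convergence[where w = "\<lambda>\<xi>. (indicat_real (punctured 1) \<xi> * mu \<alpha> \<xi>)\<^sup>2"])
    show "integrable lborel (\<lambda>\<xi>. (indicat_real (punctured 1) \<xi> * mu \<alpha> \<xi>)\<^sup>2)"
      by (rule indicator_mu_integrable[OF punctured_measurable punctured_bounded])
    show "AE \<xi> in lborel. norm ((indicat_real (punctured (\<epsilon> n)) \<xi> * mu \<alpha> \<xi>)\<^sup>2) \<le> (indicat_real (punctured 1) \<xi> * mu \<alpha> \<xi>)\<^sup>2" for n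
      using sub[of n] by (auto simp: indicator_def)
    have "(\<lambda>n. (indicat_real (punctured (\<epsilon> n)) \<xi> * mu \<alpha> \<xi>)\<^sup>2) \<longlonglongrightarrow> 0" for \<xi>
      by (rule tendsto_eventually, rule eventually_mono[OF vanish[of \<xi>]]) simp
    then show "AE \<xi> in lborel. (\<lambda>n. (indicat_real (punctured (\<epsilon> n)) \<xi> * mu \<alpha> \<xi>)\<^sup>2) \<longlonglongrightarrow> 0" by simp
  qed measurable
  then have 2: "(\<lambda>n. mu_mass (punctured (\<epsilon> n))) \<longlonglongrightarrow> 0" by (simp add: mu_mass_def)
  show ?thesis using pos 1 2 by (intro exI[of _ \<epsilon>]) simp
qed

text \<open>Split \<open>p\<close> into frequencies above \<open>e\<close>, where
  \<open>damping\<close> is bounded below, the part \<open>low\<close> below \<open>e\<close>, and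
  the remainder \<open>\<mu> w\<close> below \<open>e\<close>. The last two are small for small
  \<open>e\<close> uniformly in time, so \<open>e\<close> is fixed before time tends to
  infinity.\<close>

lemma diffusive_limit: "((\<lambda>t. nrm Z (case_prod (p (x t)))) \<longlongrightarrow> 0) at_top"
proof -
  obtain K where K: "K \<ge> 0" "\<And>t. t \<ge> 0 \<Longrightarrow> nrm M (w (x t)) \<le> K" "\<And>t. t \<ge> 0 \<Longrightarrow> nrm M (w (A (x t))) \<le> K"
    by (rule trajectory_bound[OF w P0], rule that; blast)
  from small_frequencies obtain \<epsilon> :: "nat \<Rightarrow> real" where \<epsilon>: "\<forall>n. \<epsilon> n > 0"
    "(\<lambda>n. ip Z (low (punctured (\<epsilon> n)) (x 0)) (low (punctured (\<epsilon> n)) (x 0))) \<longlonglongrightarrow> 0"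
    "(\<lambda>n. mu_mass (punctured (\<epsilon> n))) \<longlonglongrightarrow> 0"
    by (elim exE conjE)
  define \<beta> where "\<beta> n = sqrt (ip Z (low (punctured (\<epsilon> n)) (x 0)) (low (punctured (\<epsilon> n)) (x 0))
      + 4 * K\<^sup>2 * mu_mass (punctured (\<epsilon> n))) + sqrt (mu_mass (punctured (\<epsilon> n))) * K" for n
  have "\<beta> \<longlonglongrightarrow> sqrt (0 + 4 * K\<^sup>2 * 0) + sqrt 0 * K"
    unfolding \<beta>_def by (intro tendsto_intros \<epsilon>)
  then have \<beta>: "\<beta> \<longlonglongrightarrow> 0" by simp
  have bound: "nrm Z (case_prod (p (x t))) \<le> (1 / damping (\<epsilon> n)) * nrm Z (xi_mult damping (case_prod (p (x t)))) + \<beta> n"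
    if t: "t \<ge> 0" for t n
  proof -
    define e where "e = \<epsilon> n"
    have e: "e > 0" using \<epsilon> by (simp add: e_def)
    define h where "h \<xi> = indicat_real {\<xi>. e \<le> \<bar>\<xi>\<bar>} \<xi>" for \<xi>
    have h [measurable]: "h \<in> borel_measurable borel" unfolding h_def[abs_def] by measurable
    have hp: "damping e > 0" using e by (intro damping_pos) auto
    have h_le: "\<bar>h \<xi>\<bar> \<le> 1 / damping e * damping \<xi>" for \<xi>
      using damping_mono[of e \<xi>] hp e by (auto simp: h_def indicator_def)
    let ?p = "case_prod (p (x t))"
    let ?m = "tensor (\<lambda>\<xi>. indicat_real (punctured e) \<xi> * mu \<alpha> \<xi>) (w (x t))"
    have pl: "?p \<in> l2 Z" by (rule blin_l2[OF p x_X[OF t]])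
    have wl: "w (x t) \<in> l2 M" by (rule blin_l2[OF w x_X[OF t]])
    have hl: "xi_mult h ?p \<in> l2 Z" by (rule xi_mult_l2(1)[OF pl h, of 1]) (simp add: h_def indicator_def)
    have ll: "low (punctured e) (x t) \<in> l2 Z"
      by (rule blin_l2[OF blin_low[OF punctured_measurable punctured_bounded] x_X[OF t]])
    have ml: "?m \<in> l2 Z"
      by (rule tensor_in_l2[OF indicator_mu_measurable[OF punctured_measurable]
          indicator_mu_integrable[OF punctured_measurable punctured_bounded] wl])
    \<comment> \<open>At frequency 0 the pieces of the decomposition all vanish, so the identity
      below holds only almost everywhere.\<close>
    have ae: "AE z in Z. fst z \<noteq> 0"
    proof (rule pair.AE_pair_measure)
      show "{z \<in> space Z. fst z \<noteq> 0} \<in> sets Z" by measurable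
      show "AE \<xi> in lborel. AE y in M. fst (\<xi>, y) \<noteq> (0::real)"
        using AE_lborel_singleton[of "0::real"] by eventually_elim simp
    qed
    have "AE z in Z. ?p z = (xi_mult h ?p + (low (punctured e) (x t) + ?m)) z"
      using ae
    proof eventually_elim
      case (elim z)
      obtain \<xi> y where z: "z = (\<xi>, y)" by (cases z)
      have "h \<xi> = 1 \<and> indicat_real (punctured e) \<xi> = 0 \<or> h \<xi> = 0 \<and> indicat_real (punctured e) \<xi> = 1"
        using elim z by (auto simp: h_def punctured_def indicator_def)
      moreover have "(low (punctured e) (x t)) z = of_real (indicat_real (punctured e) \<xi>) * (p (x t) \<xi> y - of_real (mu \<alpha> \<xi>) * w (x t) y)"
        by (simp add: z low_apply indicator_def)
      ultimately show ?case by (auto simp: z xi_mult_def tensor_def)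
    qed
    then have "nrm Z ?p = nrm Z (xi_mult h ?p + (low (punctured e) (x t) + ?m))"
      using pl hl ll ml by (intro nrm_AE_cong l2_measurable) auto
    also have "\<dots> \<le> nrm Z (xi_mult h ?p) + (nrm Z (low (punctured e) (x t)) + nrm Z ?m)"
      using l2.N_triangle[OF hl l2.X_add[OF ll ml]] l2.N_triangle[OF ll ml] by linarith
    also have "nrm Z (xi_mult h ?p) \<le> 1 / damping e * nrm Z (xi_mult damping ?p)"
      using hp by (intro nrm_xi_mult_le[OF pl h h_le]) auto
    also have "nrm Z (low (punctured e) (x t)) \<le> sqrt (ip Z (low (punctured e) (x 0)) (low (punctured e) (x 0))
      + 4 * K\<^sup>2 * mu_mass (punctured e))"
      unfolding nrm_def by (intro real_sqrt_le_mono low_punctured_growth e K t)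
    also have "nrm Z ?m \<le> sqrt (mu_mass (punctured e)) * K"
      using nrm_tensor[OF indicator_mu_measurable[OF punctured_measurable]
          indicator_mu_integrable[OF punctured_measurable punctured_bounded] wl] K(2)[OF t]
      by (simp add: mu_mass_def mult_left_mono)
    finally show ?thesis by (simp add: \<beta>_def e_def)
  qed
  show ?thesis
  proof (rule tendstoI)
    fix d :: real assume d: "d > 0"
    obtain n where n: "\<beta> n < d / 2"
      using order_tendstoD(2)[OF \<beta>, of "d / 2"] d by (auto dest!: eventually_happens'[OF sequentially_bot])
    have "((\<lambda>t. (1 / damping (\<epsilon> n)) * nrm Z (xi_mult damping (case_prod (p (x t))))) \<longlongrightarrow> 0) at_top"
      by (intro tendsto_mult_right_zero p_limit)
    then have "\<forall>\<^sub>F t in at_top. (1 / damping (\<epsilon> n)) * nrm Z (xi_mult damping (case_prod (p (x t)))) < d / 2"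
      using d by (intro order_tendstoD) auto
    then show "\<forall>\<^sub>F t in at_top. dist (nrm Z (case_prod (p (x t)))) 0 < d"
      using eventually_ge_at_top[of 0]
    proof eventually_elim
      case (elim t)
      then have "nrm Z (case_prod (p (x t))) < d" using bound[of t n] n by linarith
      then show ?case by (simp add: dist_real_def)
    qed
  qed
qed

end

section \<open>The generator\<close>

context mixture
begin

abbreviation Dom where "Dom \<equiv> mixture_domain \<Omega> \<alpha> \<eta> a11 a12 a22"
abbreviation Op where "Op \<equiv> mixture_op \<Omega> \<rho>1 \<rho>2 \<alpha> \<eta> a11 a12 a22"

definition stress1 :: "state \<Rightarrow> field" where
  "stress1 P = L2_rep \<Omega> (stress_distr \<Omega> \<alpha> a11 a12 (st_u P) (st_v P) (st_p P))"
definition stress2 :: "state \<Rightarrow> field" where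
  "stress2 P = L2_rep \<Omega> (stress_distr \<Omega> \<alpha> a12 a22 (st_u P) (st_v P) (st_q P))"

lemma represents_L2_rep: "distr_in_L2 \<Omega> F \<Longrightarrow> represents \<Omega> F (L2_rep \<Omega> F)"
  unfolding distr_in_L2_def L2_rep_def by (rule someI_ex[of "represents \<Omega> F"])

lemma domain_iff:
  "P \<in> Dom \<longleftrightarrow> P \<in> X \<and> st_U P \<in> H10 \<Omega> \<and> st_V P \<in> H10 \<Omega> \<and>
     (\<lambda>x. of_real a11 * st_u P x + of_real a12 * st_v P x) \<in> H2 \<Omega> \<and>
     (\<lambda>x. of_real a12 * st_u P x + of_real a22 * st_v P x) \<in> H2 \<Omega> \<and>
     distr_in_L2 \<Omega> (stress_distr \<Omega> \<alpha> a11 a12 (st_u P) (st_v P) (st_p P)) \<and>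
     distr_in_L2 \<Omega> (stress_distr \<Omega> \<alpha> a12 a22 (st_u P) (st_v P) (st_q P)) \<and>
     (\<lambda>\<xi> x. of_real \<xi> * st_p P \<xi> x) \<in> L2L2 \<Omega> \<and> (\<lambda>\<xi> x. of_real \<xi> * st_q P \<xi> x) \<in> L2L2 \<Omega> \<and>
     diffusive \<alpha> \<eta> (st_p P) (st_U P) \<in> L2L2 \<Omega> \<and> diffusive \<alpha> \<eta> (st_q P) (st_V P) \<in> L2L2 \<Omega>"
  by (cases P) (simp add: mixture_domain_def X_def)

lemma op_components:
  "st_u (Op P) = st_U P" "st_v (Op P) = st_V P"
  "st_U (Op P) = (1 / \<rho>1) *\<^sub>R (stress1 P - \<alpha> *\<^sub>R (st_u P - st_v P))"
  "st_V (Op P) = (1 / \<rho>2) *\<^sub>R (stress2 P + \<alpha> *\<^sub>R (st_u P - st_v P))"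
  "st_p (Op P) = diffusive \<alpha> \<eta> (st_p P) (st_U P)" "st_q (Op P) = diffusive \<alpha> \<eta> (st_q P) (st_V P)"
  by (cases P; simp add: stress1_def stress2_def fun_eq_iff scaleR_fun_def scaleR_conv_of_real del: of_real_divide of_real_1)+

lemma domain_stress:
  assumes "P \<in> Dom"
  shows "represents \<Omega> (stress_distr \<Omega> \<alpha> a11 a12 (st_u P) (st_v P) (st_p P)) (stress1 P)"
    "represents \<Omega> (stress_distr \<Omega> \<alpha> a12 a22 (st_u P) (st_v P) (st_q P)) (stress2 P)"
    "stress1 P \<in> l2 M" "stress2 P \<in> l2 M"
proof -
  show 1: "represents \<Omega> (stress_distr \<Omega> \<alpha> a11 a12 (st_u P) (st_v P) (st_p P)) (stress1 P)"
    and 2: "represents \<Omega> (stress_distr \<Omega> \<alpha> a12 a22 (st_u P) (st_v P) (st_q P)) (stress2 P)"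
    using assms unfolding stress1_def stress2_def domain_iff by (auto intro: represents_L2_rep)
  then show "stress1 P \<in> l2 M" "stress2 P \<in> l2 M" by (auto simp: represents_def L2_eq_l2)
qed

lemma domain_X: "P \<in> Dom \<Longrightarrow> P \<in> X"
  by (simp add: domain_iff)

lemma domain_weighted:
  assumes "P \<in> Dom"
  shows "weighted (st_p P) \<in> l2 Z" "weighted (st_q P) \<in> l2 Z"
  using assms by (auto simp: domain_iff X_iff L2L2_l2 intro: weighted_l2)

lemma domain_diffusive:
  assumes "P \<in> Dom"
  shows "case_prod (diffusive \<alpha> \<eta> (st_p P) (st_U P)) \<in> l2 Z" "case_prod (diffusive \<alpha> \<eta> (st_q P) (st_V P)) \<in> l2 Z"
  using assms by (auto simp: domain_iff L2L2_l2)

lemma op_X: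
  assumes P: "P \<in> Dom"
  shows "Op P \<in> X"
  unfolding X_iff op_components
proof (intro conjI)
  show "st_U P \<in> H10 \<Omega>" "st_V P \<in> H10 \<Omega>" using P by (auto simp: domain_iff)
  have uv: "st_u P - st_v P \<in> l2 M" using domain_X[OF P] by (simp add: X_iff)
  show "(1 / \<rho>1) *\<^sub>R (stress1 P - \<alpha> *\<^sub>R (st_u P - st_v P)) \<in> l2 M"
    "(1 / \<rho>2) *\<^sub>R (stress2 P + \<alpha> *\<^sub>R (st_u P - st_v P)) \<in> l2 M"
    using uv domain_stress[OF P] by (auto intro!: l2.X_scale l2.X_diff l2.X_add)
qed (rule domain_diffusive[OF P])+

text \<open>The momentum equation in weak form. It is tested with the velocity for the energy
  identity and with the displacement for the decay of the potential energy.\<close>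

lemma op_U_weak:
  assumes P: "P \<in> Dom" and w: "w \<in> H10 \<Omega>"
  shows "\<rho>1 * ip M (st_U (Op P)) w = - a11 * grad_ip (st_u P) w - a12 * grad_ip (st_v P) w
    - C * coupling (st_p P) w - \<alpha> * ip M (st_u P - st_v P) w"
proof -
  have uv: "st_u P - st_v P \<in> l2 M" "st_u P \<in> H1 \<Omega>" "st_v P \<in> H1 \<Omega>" using domain_X[OF P] by (simp_all add: X_iff)
  have wl: "w \<in> l2 M" using w by simp
  have "\<rho>1 * ip M (st_U (Op P)) w = ip M (stress1 P - \<alpha> *\<^sub>R (st_u P - st_v P)) w"
    unfolding op_components using \<rho> wl uv domain_stress(3)[OF P]
    by (subst l2.B_scale) (auto intro!: l2.X_diff l2.X_scale)
  also have "\<dots> = ip M (stress1 P) w - \<alpha> * ip M (st_u P - st_v P) w"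
    by (simp only: l2.B_diff[OF domain_stress(3)[OF P] l2.X_scale[OF uv(1)] wl] l2.B_scale[OF uv(1) wl])
  finally show ?thesis
    using stress_green[OF uv(2,3) domain_weighted(1)[OF P] domain_stress(1)[OF P] w] by simp
qed

lemma op_V_weak:
  assumes P: "P \<in> Dom" and w: "w \<in> H10 \<Omega>"
  shows "\<rho>2 * ip M (st_V (Op P)) w = - a12 * grad_ip (st_u P) w - a22 * grad_ip (st_v P) w
    - C * coupling (st_q P) w + \<alpha> * ip M (st_u P - st_v P) w"
proof -
  have uv: "st_u P - st_v P \<in> l2 M" "st_u P \<in> H1 \<Omega>" "st_v P \<in> H1 \<Omega>" using domain_X[OF P] by (simp_all add: X_iff)
  have wl: "w \<in> l2 M" using w by simp
  have "\<rho>2 * ip M (st_V (Op P)) w = ip M (stress2 P + \<alpha> *\<^sub>R (st_u P - st_v P)) w"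
    unfolding op_components using \<rho> wl uv domain_stress(4)[OF P]
    by (subst l2.B_scale) (auto intro!: l2.X_add l2.X_scale)
  also have "\<dots> = ip M (stress2 P) w + \<alpha> * ip M (st_u P - st_v P) w"
    by (simp only: l2.B_add[OF domain_stress(4)[OF P] l2.X_scale[OF uv(1)] wl] l2.B_scale[OF uv(1) wl])
  finally show ?thesis
    using stress_green[OF uv(2,3) domain_weighted(2)[OF P] domain_stress(2)[OF P] w] by simp
qed

text \<open>This is \<open>\<integral>\<integral> (\<xi>\<^sup>2 + \<eta>) \<bar>\<phi>\<bar>\<^sup>2\<close>, finite on the domain.\<close>
definition dissipation :: "(real \<Rightarrow> field) \<Rightarrow> real" where
  "dissipation \<phi> = (nrm Z (weighted \<phi>))\<^sup>2 + (\<eta> - 1) * (nrm Z (case_prod \<phi>))\<^sup>2"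

text \<open>The rate is written as \<open>(1 + \<xi>\<^sup>2) + (\<eta> - 1)\<close> and one factor
  \<open>sqrt (1 + \<xi>\<^sup>2)\<close> is shifted from \<open>mu\<close> to
  \<open>\<phi>\<close>; then only products of functions in \<open>l2 Z\<close> are integrated,
  although \<open>\<mu> U\<close> need not lie there.\<close>

lemma diffusive_dissipation:
  assumes \<phi>: "weighted \<phi> \<in> l2 Z" "case_prod \<phi> \<in> l2 Z" and d: "case_prod (diffusive \<alpha> \<eta> \<phi> U) \<in> l2 Z" and U: "U \<in> l2 M"
  shows "ip Z (case_prod (diffusive \<alpha> \<eta> \<phi> U)) (case_prod \<phi>) = coupling \<phi> U - dissipation \<phi>"
proof -
  have t: "tensor (mu_weight \<alpha>) U \<in> l2 Z" by (rule tensor_mu_weight_l2[OF U])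
  have pw: "case_prod (diffusive \<alpha> \<eta> \<phi> U) z \<bullet> case_prod \<phi> z = weighted \<phi> z \<bullet> tensor (mu_weight \<alpha>) U z
      - ((cmod (weighted \<phi> z))\<^sup>2 + (\<eta> - 1) * (cmod (case_prod \<phi> z))\<^sup>2)" for z
  proof (cases z)
    case (Pair \<xi> y)
    define s where "s = sqrt (1 + \<xi>\<^sup>2)"
    have s: "s > 0" "s\<^sup>2 = 1 + \<xi>\<^sup>2" by (simp_all add: s_def)
    have e1: "case_prod (diffusive \<alpha> \<eta> \<phi> U) z = (- (\<xi>\<^sup>2 + \<eta>)) *\<^sub>R \<phi> \<xi> y + mu \<alpha> \<xi> *\<^sub>R U y"
      by (simp add: Pair diffusive_def scaleR_conv_of_real)
    have e2: "weighted \<phi> z = s *\<^sub>R \<phi> \<xi> y"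
      by (simp add: Pair weighted_def s_def scaleR_conv_of_real)
    have e3: "tensor (mu_weight \<alpha>) U z = (mu \<alpha> \<xi> / s) *\<^sub>R U y"
      by (simp add: Pair tensor_def mu_weight_def s_def scaleR_conv_of_real)
    have e4: "(cmod (s *\<^sub>R \<phi> \<xi> y))\<^sup>2 = (1 + \<xi>\<^sup>2) * (cmod (\<phi> \<xi> y))\<^sup>2"
      by (simp add: power_mult_distrib s)
    have e5: "case_prod \<phi> z = \<phi> \<xi> y" by (simp add: Pair)
    show ?thesis unfolding e1 e2 e3 e4 e5 using s(1)
      by (simp add: inner_add_left power2_norm_eq_inner inner_commute[of "U y"] algebra_simps)
  qed
  have "ip Z (case_prod (diffusive \<alpha> \<eta> \<phi> U)) (case_prod \<phi>)
      = (LINT z|Z. weighted \<phi> z \<bullet> tensor (mu_weight \<alpha>) U z - ((cmod (weighted \<phi> z))\<^sup>2 + (\<eta> - 1) * (cmod (case_prod \<phi> z))\<^sup>2))"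
    unfolding ip_def pw ..
  also have "\<dots> = (LINT z|Z. weighted \<phi> z \<bullet> tensor (mu_weight \<alpha>) U z)
      - (LINT z|Z. (cmod (weighted \<phi> z))\<^sup>2 + (\<eta> - 1) * (cmod (case_prod \<phi> z))\<^sup>2)"
    by (intro Bochner_Integration.integral_diff Bochner_Integration.integrable_add integrable_mult_right
        l2_integrable_inner l2_integrable_square \<phi> t)
  also have "(LINT z|Z. (cmod (weighted \<phi> z))\<^sup>2 + (\<eta> - 1) * (cmod (case_prod \<phi> z))\<^sup>2)
      = (LINT z|Z. (cmod (weighted \<phi> z))\<^sup>2) + (LINT z|Z. (\<eta> - 1) * (cmod (case_prod \<phi> z))\<^sup>2)"
    by (intro Bochner_Integration.integral_add integrable_mult_right l2_integrable_square \<phi>)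
  finally show ?thesis by (simp add: coupling_def dissipation_def nrm_sq ip_def power2_norm_eq_inner)
qed

text \<open>Pointwise, \<open>(damping \<xi>)\<^sup>2 \<le> \<xi>\<^sup>2 \<le> \<xi>\<^sup>2 +
  \<eta>\<close>; and adding \<open>\<bar>\<phi>\<bar>\<^sup>2\<close> to the dissipation density
  gives at least \<open>(1 + \<xi>\<^sup>2) * \<bar>\<phi>\<bar>\<^sup>2\<close>.\<close>

lemma dissipation_lower:
  assumes \<phi>: "weighted \<phi> \<in> l2 Z" "case_prod \<phi> \<in> l2 Z"
  shows "(nrm Z (xi_mult damping (case_prod \<phi>)))\<^sup>2 \<le> dissipation \<phi>"
    and "(nrm Z (weighted \<phi>))\<^sup>2 \<le> dissipation \<phi> + (nrm Z (case_prod \<phi>))\<^sup>2"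
proof -
  have h: "xi_mult damping (case_prod \<phi>) \<in> l2 Z"
    by (rule xi_mult_l2(1)[OF \<phi>(2) damping_measurable, of 1]) (simp add: damping_le_1)
  have pw: "(cmod (xi_mult damping (case_prod \<phi>) z))\<^sup>2 \<le> (cmod (weighted \<phi> z))\<^sup>2 + (\<eta> - 1) * (cmod (case_prod \<phi> z))\<^sup>2" for z
  proof (cases z)
    case (Pair \<xi> y)
    have "(damping \<xi>)\<^sup>2 \<le> \<xi>\<^sup>2 / 1" unfolding damping_sq by (intro divide_left_mono) auto
    then have "(damping \<xi>)\<^sup>2 * (cmod (\<phi> \<xi> y))\<^sup>2 \<le> (\<xi>\<^sup>2 + \<eta>) * (cmod (\<phi> \<xi> y))\<^sup>2"
      using \<eta> by (intro mult_right_mono) auto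
    moreover have "(cmod (xi_mult damping (case_prod \<phi>) z))\<^sup>2 = (damping \<xi>)\<^sup>2 * (cmod (\<phi> \<xi> y))\<^sup>2"
      by (simp add: Pair xi_mult_def norm_mult power_mult_distrib)
    moreover have "(cmod (weighted \<phi> z))\<^sup>2 = (1 + \<xi>\<^sup>2) * (cmod (\<phi> \<xi> y))\<^sup>2"
      by (simp add: Pair weighted_def norm_mult power_mult_distrib)
    ultimately show ?thesis by (simp add: Pair algebra_simps)
  qed
  have "(LINT z|Z. (cmod (xi_mult damping (case_prod \<phi>) z))\<^sup>2)
      \<le> (LINT z|Z. (cmod (weighted \<phi> z))\<^sup>2 + (\<eta> - 1) * (cmod (case_prod \<phi> z))\<^sup>2)"
    by (intro integral_mono Bochner_Integration.integrable_add integrable_mult_right l2_integrable_square \<phi> h pw)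
  also have "\<dots> = (LINT z|Z. (cmod (weighted \<phi> z))\<^sup>2) + (LINT z|Z. (\<eta> - 1) * (cmod (case_prod \<phi> z))\<^sup>2)"
    by (intro Bochner_Integration.integral_add integrable_mult_right l2_integrable_square \<phi>)
  finally show "(nrm Z (xi_mult damping (case_prod \<phi>)))\<^sup>2 \<le> dissipation \<phi>"
    by (simp add: dissipation_def nrm_sq ip_self)
  show "(nrm Z (weighted \<phi>))\<^sup>2 \<le> dissipation \<phi> + (nrm Z (case_prod \<phi>))\<^sup>2"
    using \<eta> by (simp add: dissipation_def algebra_simps)
qed

text \<open>The elastic terms cancel by the weak momentum equations tested with the velocities, and
  each coupling term occurs once in a momentum equation and once, with opposite sign, in a diffusive
  equation.\<close>

lemma energy_identity:
  assumes P: "P \<in> Dom"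
  shows "B (Op P) P = - C * (dissipation (st_p P) + dissipation (st_q P))"
proof -
  note X = domain_X[OF P]
  have UV: "st_U P \<in> H10 \<Omega>" "st_V P \<in> H10 \<Omega>" using P by (auto simp: domain_iff)
  have l: "st_U P \<in> l2 M" "st_V P \<in> l2 M" "st_u P - st_v P \<in> l2 M" "case_prod (st_p P) \<in> l2 Z" "case_prod (st_q P) \<in> l2 Z"
    using X by (auto simp: X_iff)
  have d: "ip M (st_U P - st_V P) (st_u P - st_v P) = ip M (st_u P - st_v P) (st_U P) - ip M (st_u P - st_v P) (st_V P)"
    using l2.B_diff[OF l(1,2,3)] by (simp only: ip_sym[of M "st_u P - st_v P"])
  have pot: "pot (Op P) P = a11 * grad_ip (st_u P) (st_U P) + a22 * grad_ip (st_v P) (st_V P)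
     + a12 * (grad_ip (st_v P) (st_U P) + grad_ip (st_u P) (st_V P))
     + \<alpha> * (ip M (st_u P - st_v P) (st_U P) - ip M (st_u P - st_v P) (st_V P))"
    unfolding pot_def op_components d
    by (simp only: grad_ip_sym[of "st_U P"] grad_ip_sym[of "st_V P"])
  have U: "\<rho>1 * ip M (st_U (Op P)) (st_U P) = - a11 * grad_ip (st_u P) (st_U P) - a12 * grad_ip (st_v P) (st_U P)
    - C * coupling (st_p P) (st_U P) - \<alpha> * ip M (st_u P - st_v P) (st_U P)"
    by (rule op_U_weak[OF P UV(1)])
  have V: "\<rho>2 * ip M (st_V (Op P)) (st_V P) = - a12 * grad_ip (st_u P) (st_V P) - a22 * grad_ip (st_v P) (st_V P)
    - C * coupling (st_q P) (st_V P) + \<alpha> * ip M (st_u P - st_v P) (st_V P)"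
    by (rule op_V_weak[OF P UV(2)])
  have p: "ip Z (case_prod (st_p (Op P))) (case_prod (st_p P)) = coupling (st_p P) (st_U P) - dissipation (st_p P)"
    unfolding op_components by (rule diffusive_dissipation[OF domain_weighted(1)[OF P] l(4) domain_diffusive(1)[OF P] l(1)])
  have q: "ip Z (case_prod (st_q (Op P))) (case_prod (st_q P)) = coupling (st_q P) (st_V P) - dissipation (st_q P)"
    unfolding op_components by (rule diffusive_dissipation[OF domain_weighted(2)[OF P] l(5) domain_diffusive(2)[OF P] l(2)])
  show ?thesis
    unfolding B_eq[OF op_X[OF P] X] U V pot p q by (simp add: algebra_simps)
qed

section \<open>Density of the domain\<close>

lemma distr_partial_smooth:
  assumes "smooth_on UNIV f" "\<psi> \<in> test"
  shows "distr_partial i (distr_of \<Omega> f) \<psi> = distr_of \<Omega> (partial i f) \<psi>"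
  using integration_by_parts[OF assms, of i] by (simp add: distr_partial_def distr_of_def)

lemma distr_partial2_smooth:
  assumes f: "smooth_on UNIV f" and \<psi>: "\<psi> \<in> test"
  shows "distr_partial j (distr_partial i (distr_of \<Omega> f)) \<psi> = distr_of \<Omega> (partial j (partial i f)) \<psi>"
proof -
  have "distr_partial j (distr_partial i (distr_of \<Omega> f)) \<psi> = - distr_partial i (distr_of \<Omega> f) (partial j \<psi>)"
    by (simp only: distr_partial_def)
  also have "\<dots> = - distr_of \<Omega> (partial i f) (partial j \<psi>)"
    by (simp only: distr_partial_smooth[OF f test_partial[OF \<psi>]])
  also have "\<dots> = distr_partial j (distr_of \<Omega> (partial i f)) \<psi>" by (simp add: distr_partial_def)
  finally show ?thesis using distr_partial_smooth[OF smooth_partial[OF f] \<psi>, of j i] by simp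
qed

lemma test_H2:
  assumes u: "u \<in> test"
  shows "u \<in> H2 \<Omega>"
proof -
  have "represents \<Omega> (distr_partial j (distr_partial i (distr_of \<Omega> u))) (partial j (partial i u))" for i j
    unfolding represents_def using u distr_partial2_smooth[OF test_smooth[OF u]]
    by (simp add: L2_eq_l2 test_partial)
  then show ?thesis using u unfolding H2_def distr_in_L2_def by auto
qed

text \<open>For test functions the Laplacians are classical, and \<open>mu_integral_l2\<close>
  handles the remaining term, so the regularity conditions of the domain hold.\<close>

lemma stress_of_test:
  assumes u: "u \<in> test" and v: "v \<in> test" and \<phi>: "weighted \<phi> \<in> l2 Z"
  shows "distr_in_L2 \<Omega> (stress_distr \<Omega> \<alpha> b c u v \<phi>)"
proof -
  define lap where "lap f = (\<lambda>x. \<Sum>i\<in>UNIV. partial i (partial i f) x)" for f :: field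
  have sum_l2: "(\<lambda>x. \<Sum>i\<in>I. partial i (partial i f) x) \<in> l2 M" if "finite I" "f \<in> test" for I f
    using that(1)
  proof induction
    case (insert i I)
    then show ?case using that(2) by (simp add: l2_add test_partial)
  qed (simp add: l2_zero)
  have lap_l: "lap f \<in> l2 M" if "f \<in> test" for f
    unfolding lap_def using sum_l2[OF finite that] .
  have lap: "distr_laplacian (distr_of \<Omega> f) \<psi> = distr_of \<Omega> (lap f) \<psi>" if f: "f \<in> test" and \<psi>: "\<psi> \<in> test" for f \<psi>
  proof -
    have "distr_laplacian (distr_of \<Omega> f) \<psi> = (\<Sum>i\<in>UNIV. distr_of \<Omega> (partial i (partial i f)) \<psi>)"
      unfolding distr_laplacian_def using distr_partial2_smooth[OF test_smooth[OF f] \<psi>] by simp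
    also have "\<dots> = (LINT x|M. (\<Sum>i\<in>UNIV. partial i (partial i f) x * \<psi> x))"
      unfolding distr_of_def using f \<psi>
      by (intro Bochner_Integration.integral_sum[symmetric] l2_integrable_mult) (auto intro!: test_in_l2 test_partial)
    finally show ?thesis by (simp add: distr_of_def lap_def sum_distrib_right)
  qed
  have m: "mu_integral \<alpha> \<phi> \<in> l2 M" by (rule mu_integral_l2[OF \<phi>])
  define g where "g = (\<lambda>x. of_real b * lap u x + of_real c * lap v x - of_real C * mu_integral \<alpha> \<phi> x)"
  have "g \<in> l2 M" unfolding g_def by (intro l2_diff l2_add l2_cmult lap_l u v m)
  moreover have "stress_distr \<Omega> \<alpha> b c u v \<phi> \<psi> = distr_of \<Omega> g \<psi>" if \<psi>: "\<psi> \<in> test" for \<psi>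
  proof -
    have i: "integrable M (\<lambda>x. lap u x * \<psi> x)" "integrable M (\<lambda>x. lap v x * \<psi> x)"
      "integrable M (\<lambda>x. mu_integral \<alpha> \<phi> x * \<psi> x)"
      using lap_l[OF u] lap_l[OF v] m \<psi> by (auto intro: l2_integrable_mult)
    have "distr_of \<Omega> g \<psi> = (LINT x|M. of_real b * (lap u x * \<psi> x) + of_real c * (lap v x * \<psi> x)
        - of_real C * (mu_integral \<alpha> \<phi> x * \<psi> x))"
      by (simp add: distr_of_def g_def algebra_simps)
    also have "\<dots> = of_real b * (LINT x|M. lap u x * \<psi> x) + of_real c * (LINT x|M. lap v x * \<psi> x)
        - of_real C * (LINT x|M. mu_integral \<alpha> \<phi> x * \<psi> x)"
      using i by simp
    finally show ?thesis
      unfolding stress_distr_def lap[OF u \<psi>] lap[OF v \<psi>] by (simp only: distr_of_def)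
  qed
  ultimately show ?thesis unfolding distr_in_L2_def represents_def by (auto simp: L2_eq_l2)
qed

text \<open>Outside \<open>\<bar>\<xi>\<bar> \<le> n\<close> the approximation solves \<open>-(\<xi>\<^sup>2 + \<eta>) \<phi> + \<mu> U = 0\<close>.\<close>

lemma diffusive_approximation:
  assumes \<phi>: "case_prod \<phi> \<in> l2 Z" and U: "U \<in> l2 M" and e: "e > 0"
  obtains \<phi>' where "case_prod \<phi>' \<in> l2 Z" "(\<lambda>\<xi> x. of_real \<xi> * \<phi>' \<xi> x) \<in> L2L2 \<Omega>"
    "diffusive \<alpha> \<eta> \<phi>' U \<in> L2L2 \<Omega>" "nrm Z (case_prod \<phi> - case_prod \<phi>') < e"
proof -
  \<comment> \<open>With \<open>Suc n\<close> the modified frequencies satisfy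
    \<open>\<bar>\<xi>\<bar> > 1\<close>, so the denominator stays away from 0 even if
    \<open>\<eta> = 0\<close>.\<close>
  define \<theta> where "\<theta> n = (\<lambda>\<xi> x. if \<bar>\<xi>\<bar> \<le> real (Suc n) then \<phi> \<xi> x else of_real (mu \<alpha> \<xi> / (\<xi>\<^sup>2 + \<eta>)) * U x)" for n
  define i where "i n \<xi> = indicat_real {\<xi>. \<bar>\<xi>\<bar> \<le> real (Suc n)} \<xi>" for n \<xi>
  define b where "b n \<xi> = (1 - i n \<xi>) * (mu \<alpha> \<xi> / (\<xi>\<^sup>2 + \<eta>))" for n \<xi>
  have [measurable]: "i n \<in> borel_measurable borel" for n unfolding i_def[abs_def] by measurable
  have bm [measurable]: "b n \<in> borel_measurable borel" for n unfolding b_def[abs_def] by measurable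
  have xb_le: "\<bar>\<xi> * b n \<xi>\<bar> \<le> 2 * \<bar>mu_weight \<alpha> \<xi>\<bar>" for n \<xi>
  proof (cases "\<bar>\<xi>\<bar> \<le> real (Suc n)")
    case True
    then show ?thesis by (simp add: b_def i_def)
  next
    case False
    then have x1: "\<bar>\<xi>\<bar> \<ge> 1" by simp
    then have x2: "\<xi>\<^sup>2 \<ge> 1" using abs_le_square_iff[of 1 \<xi>] by simp
    \<comment> \<open>Valid since \<open>\<bar>\<xi>\<bar> \<ge> 1\<close>. It makes
      \<open>\<xi> * b n \<xi>\<close> at most twice \<open>mu_weight\<close>, so the new variable
      stays square integrable after multiplication by \<open>\<xi>\<close>.\<close>
    have "sqrt (1 + \<xi>\<^sup>2) \<le> 2 * \<bar>\<xi>\<bar>"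
      by (rule real_le_lsqrt) (use x2 in \<open>auto simp: power_mult_distrib\<close>)
    then have "\<bar>\<xi>\<bar> * sqrt (1 + \<xi>\<^sup>2) \<le> \<bar>\<xi>\<bar> * (2 * \<bar>\<xi>\<bar>)" by (intro mult_left_mono) auto
    also have "\<dots> = 2 * \<xi>\<^sup>2" by (simp add: power2_eq_square)
    also have "\<dots> \<le> 2 * (\<xi>\<^sup>2 + \<eta>)" using \<eta> by simp
    finally have *: "\<bar>\<xi>\<bar> * sqrt (1 + \<xi>\<^sup>2) \<le> 2 * (\<xi>\<^sup>2 + \<eta>)" .
    have pos: "\<xi>\<^sup>2 + \<eta> > 0" using x2 \<eta> by linarith
    have "\<bar>\<xi>\<bar> / (\<xi>\<^sup>2 + \<eta>) \<le> 2 / sqrt (1 + \<xi>\<^sup>2)" using * pos by (simp add: field_simps)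
    then have "\<bar>mu \<alpha> \<xi>\<bar> * (\<bar>\<xi>\<bar> / (\<xi>\<^sup>2 + \<eta>)) \<le> \<bar>mu \<alpha> \<xi>\<bar> * (2 / sqrt (1 + \<xi>\<^sup>2))" by (rule mult_left_mono) simp
    then show ?thesis using False pos by (simp add: b_def i_def mu_weight_def abs_mult mult_ac)
  qed
  have b_le: "\<bar>b n \<xi>\<bar> \<le> 2 * \<bar>mu_weight \<alpha> \<xi>\<bar>" for n \<xi>
  proof (cases "\<bar>\<xi>\<bar> \<le> real (Suc n)")
    case True
    then show ?thesis by (simp add: b_def i_def)
  next
    case False
    then have "1 * \<bar>b n \<xi>\<bar> \<le> \<bar>\<xi>\<bar> * \<bar>b n \<xi>\<bar>" by (intro mult_right_mono) auto
    then show ?thesis using xb_le[of \<xi> n] by (simp add: abs_mult)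
  qed
  have square_integrable: "integrable lborel (\<lambda>\<xi>. (f \<xi>)\<^sup>2)" if m: "f \<in> borel_measurable borel" and le: "\<And>\<xi>. \<bar>f \<xi>\<bar> \<le> 2 * \<bar>mu_weight \<alpha> \<xi>\<bar>" for f
  proof (rule Bochner_Integration.integrable_bound)
    show "integrable lborel (\<lambda>\<xi>. 4 * (mu_weight \<alpha> \<xi>)\<^sup>2)" by (intro integrable_mult_right integrable_mu_weight_sq \<alpha>)
    have "\<bar>f \<xi>\<bar> \<le> \<bar>2 * mu_weight \<alpha> \<xi>\<bar>" for \<xi> using le[of \<xi>] by (simp add: abs_mult)
    then have "(f \<xi>)\<^sup>2 \<le> (2 * mu_weight \<alpha> \<xi>)\<^sup>2" for \<xi> by (simp only: abs_le_square_iff)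
    then show "AE \<xi> in lborel. norm ((f \<xi>)\<^sup>2) \<le> norm (4 * (mu_weight \<alpha> \<xi>)\<^sup>2)" by (simp add: power_mult_distrib)
  qed (use m in measurable)
  have bU: "tensor (b n) U \<in> l2 Z" for n by (rule tensor_in_l2[OF bm square_integrable[OF bm b_le] U])
  have xbU: "tensor (\<lambda>\<xi>. \<xi> * b n \<xi>) U \<in> l2 Z" for n
    by (rule tensor_in_l2[OF _ square_integrable[OF _ xb_le] U]) measurable
  have \<theta>_eq: "case_prod (\<theta> n) = xi_mult (i n) (case_prod \<phi>) + tensor (b n) U" for n
    by (auto simp: fun_eq_iff \<theta>_def xi_mult_def tensor_def b_def i_def)
  have \<theta>l: "case_prod (\<theta> n) \<in> l2 Z" for n
  proof -
    have "xi_mult (i n) (case_prod \<phi>) \<in> l2 Z" by (rule xi_mult_l2(1)[OF \<phi>, of _ 1]) (simp_all add: i_def indicator_def)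
    then show ?thesis unfolding \<theta>_eq using bU[of n] by (rule l2.X_add)
  qed
  have x\<theta>: "(\<lambda>\<xi> x. of_real \<xi> * \<theta> n \<xi> x) \<in> L2L2 \<Omega>" for n
  proof -
    have "xi_mult (\<lambda>\<xi>. \<xi> * i n \<xi>) (case_prod \<phi>) \<in> l2 Z"
      by (rule xi_mult_l2(1)[OF \<phi>, of _ "real (Suc n)"]) (auto simp: i_def indicator_def)
    then have "xi_mult (\<lambda>\<xi>. \<xi> * i n \<xi>) (case_prod \<phi>) + tensor (\<lambda>\<xi>. \<xi> * b n \<xi>) U \<in> l2 Z"
      using xbU[of n] by (rule l2.X_add)
    moreover have "case_prod (\<lambda>\<xi> x. of_real \<xi> * \<theta> n \<xi> x) = xi_mult (\<lambda>\<xi>. \<xi> * i n \<xi>) (case_prod \<phi>) + tensor (\<lambda>\<xi>. \<xi> * b n \<xi>) U"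
      by (auto simp: fun_eq_iff \<theta>_def xi_mult_def tensor_def b_def i_def)
    ultimately show ?thesis by (simp only: L2L2_l2)
  qed
  have d\<theta>: "diffusive \<alpha> \<eta> (\<theta> n) U \<in> L2L2 \<Omega>" for n
  proof -
    let ?S = "{\<xi>. \<bar>\<xi>\<bar> \<le> real (Suc n)}"
    have k: "\<bar>- (\<xi>\<^sup>2 + \<eta>) * i n \<xi>\<bar> \<le> (real (Suc n))\<^sup>2 + \<eta>" for \<xi>
    proof (cases "\<xi> \<in> ?S")
      case True
      then have "\<bar>\<xi>\<bar>\<^sup>2 \<le> (real (Suc n))\<^sup>2" by (intro power_mono) auto
      moreover have "\<bar>- (\<xi>\<^sup>2 + \<eta>)\<bar> = \<xi>\<^sup>2 + \<eta>" unfolding abs_minus_cancel using \<eta> by (intro abs_of_nonneg) simp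
      moreover have "i n \<xi> = 1" using True by (simp add: i_def)
      ultimately show ?thesis by (simp only: power2_abs mult_1_right add_mono order_refl)
    qed (use \<eta> in \<open>simp add: i_def\<close>)
    have "xi_mult (\<lambda>\<xi>. - (\<xi>\<^sup>2 + \<eta>) * i n \<xi>) (case_prod \<phi>) \<in> l2 Z"
      by (rule xi_mult_l2(1)[OF \<phi> _ k]) measurable
    moreover have "tensor (\<lambda>\<xi>. indicat_real ?S \<xi> * mu \<alpha> \<xi>) U \<in> l2 Z"
      by (rule tensor_in_l2[OF _ integrable_mu_sq_bounded[OF \<alpha>, of _ "real (Suc n)"] U]) auto
    ultimately have "xi_mult (\<lambda>\<xi>. - (\<xi>\<^sup>2 + \<eta>) * i n \<xi>) (case_prod \<phi>) + tensor (\<lambda>\<xi>. indicat_real ?S \<xi> * mu \<alpha> \<xi>) U \<in> l2 Z"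
      by (rule l2.X_add)
    moreover have "case_prod (diffusive \<alpha> \<eta> (\<theta> n) U) z
        = (xi_mult (\<lambda>\<xi>. - (\<xi>\<^sup>2 + \<eta>) * i n \<xi>) (case_prod \<phi>) + tensor (\<lambda>\<xi>. indicat_real ?S \<xi> * mu \<alpha> \<xi>) U) z" for z
    proof (cases z)
      case (Pair \<xi> y)
      show ?thesis
      proof (cases "\<bar>\<xi>\<bar> \<le> real (Suc n)")
        case True
        then show ?thesis by (simp add: Pair \<theta>_def xi_mult_def tensor_def i_def diffusive_def)
      next
        case False
        then have "\<xi> \<noteq> 0" by auto
        then have "\<xi>\<^sup>2 + \<eta> > 0" using \<eta> by (simp add: add_pos_nonneg)
        then have nz: "\<xi>\<^sup>2 + \<eta> \<noteq> 0" by simp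
        have "complex_of_real (\<xi>\<^sup>2 + \<eta>) * of_real (mu \<alpha> \<xi> / (\<xi>\<^sup>2 + \<eta>)) = of_real (mu \<alpha> \<xi>)"
          unfolding of_real_mult[symmetric] using nz by simp
        then have "- of_real (\<xi>\<^sup>2 + \<eta>) * (of_real (mu \<alpha> \<xi> / (\<xi>\<^sup>2 + \<eta>)) * U y) + of_real (mu \<alpha> \<xi>) * U y = 0"
          by (simp only: mult.assoc[symmetric] mult_minus_left left_minus)
        moreover have "case_prod (diffusive \<alpha> \<eta> (\<theta> n) U) z
            = - of_real (\<xi>\<^sup>2 + \<eta>) * (of_real (mu \<alpha> \<xi> / (\<xi>\<^sup>2 + \<eta>)) * U y) + of_real (mu \<alpha> \<xi>) * U y"
          using False by (simp only: Pair prod.case diffusive_def \<theta>_def if_False)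
        ultimately show ?thesis using False by (simp only: Pair xi_mult_def tensor_def i_def plus_fun_apply) simp
      qed
    qed
    ultimately show ?thesis by (simp only: L2L2_l2 fun_eq_iff[symmetric]) (metis (no_types, lifting) ext)
  qed
  \<comment> \<open>A majorant independent of \<open>n\<close> for both branches of the
    approximation.\<close>
  define g where "g = (\<lambda>z. complex_of_real (cmod (case_prod \<phi> z) + 2 * cmod (tensor (mu_weight \<alpha>) U z)))"
  have gl: "g \<in> l2 Z"
  proof -
    have n: "(\<lambda>z. complex_of_real (cmod (f z))) \<in> l2 Z" if "f \<in> l2 Z" for f
      by (rule l2_bounded_by[OF _ that]) (use l2_measurable[OF that] in auto)
    have "(\<lambda>z. complex_of_real (cmod (case_prod \<phi> z)) + 2 * complex_of_real (cmod (tensor (mu_weight \<alpha>) U z))) \<in> l2 Z"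
      by (intro l2_add l2_cmult n \<phi> tensor_mu_weight_l2 U)
    then show ?thesis by (simp add: g_def)
  qed
  have "(\<lambda>n. nrm Z (\<lambda>z. case_prod \<phi> z - case_prod (\<theta> n) z)) \<longlonglongrightarrow> 0"
  proof (rule nrm_dominated_convergence[OF l2_measurable[OF \<phi>] gl l2_measurable[OF \<theta>l]])
    have "cmod (case_prod (\<theta> n) z) \<le> cmod (g z)" for n z
    proof (cases z)
      case (Pair \<xi> y)
      have "cmod (tensor (b n) U z) \<le> 2 * cmod (tensor (mu_weight \<alpha>) U z)"
        using mult_right_mono[OF b_le[of n \<xi>] norm_ge_zero[of "U y"]] by (simp add: Pair tensor_def norm_mult)
      moreover have "cmod (xi_mult (i n) (case_prod \<phi>) z) \<le> cmod (case_prod \<phi> z)"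
        by (simp add: Pair xi_mult_def i_def indicator_def)
      moreover have "cmod (case_prod (\<theta> n) z) \<le> cmod (xi_mult (i n) (case_prod \<phi>) z) + cmod (tensor (b n) U z)"
        unfolding \<theta>_eq by (simp add: norm_triangle_ineq)
      moreover have "cmod (g z) = cmod (case_prod \<phi> z) + 2 * cmod (tensor (mu_weight \<alpha>) U z)"
        unfolding g_def norm_of_real by (rule abs_of_nonneg) simp
      ultimately show ?thesis by linarith
    qed
    then show "AE z in Z. cmod (case_prod (\<theta> n) z) \<le> cmod (g z)" for n by simp
    have "(\<lambda>n. case_prod (\<theta> n) z) \<longlonglongrightarrow> case_prod \<phi> z" for z
    proof (cases z)
      case (Pair \<xi> y)
      obtain N :: nat where N: "\<bar>\<xi>\<bar> \<le> real N" using real_arch_simple by blast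
      have "\<forall>\<^sub>F n in sequentially. case_prod (\<theta> n) z = case_prod \<phi> z"
        using eventually_ge_at_top[of N]
      proof eventually_elim
        case (elim n)
        then have "\<bar>\<xi>\<bar> \<le> real (Suc n)" using N by simp
        then show ?case by (simp add: Pair \<theta>_def)
      qed
      then show ?thesis by (rule tendsto_eventually)
    qed
    then show "AE z in Z. (\<lambda>n. case_prod (\<theta> n) z) \<longlonglongrightarrow> case_prod \<phi> z" by simp
  qed
  then have "\<forall>\<^sub>F n in sequentially. nrm Z (\<lambda>z. case_prod \<phi> z - case_prod (\<theta> n) z) < e"
    using e by (rule order_tendstoD(2))
  then obtain n where "nrm Z (\<lambda>z. case_prod \<phi> z - case_prod (\<theta> n) z) < e"
    by (auto dest!: eventually_happens'[OF sequentially_bot])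
  then have "nrm Z (case_prod \<phi> - case_prod (\<theta> n)) < e" by (simp only: fun_diff_def)
  then show thesis by (rule that[OF \<theta>l x\<theta> d\<theta>])
qed

end

context mixture
begin

text \<open>The constant adds up the coefficients of the energy: \<open>4 * \<alpha>\<close> because
  \<open>u - v\<close> has norm at most \<open>2 * d\<close>, and \<open>2 * \<bar>a12\<bar>\<close>
  for the two mixed gradient terms.\<close>

lemma N_small:
  assumes P: "P \<in> X" and d: "nrm M (st_u P) \<le> d" "nrm M (st_v P) \<le> d" "grad.N (st_u P) \<le> d" "grad.N (st_v P) \<le> d"
    "nrm M (st_U P) \<le> d" "nrm M (st_V P) \<le> d" "nrm Z (case_prod (st_p P)) \<le> d" "nrm Z (case_prod (st_q P)) \<le> d"
  shows "(ph.N P)\<^sup>2 \<le> (\<rho>1 + \<rho>2 + a11 + a22 + 2 * \<bar>a12\<bar> + 4 * \<alpha> + 2 * C) * d\<^sup>2"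
proof -
  have H: "st_u P \<in> H1 \<Omega>" "st_v P \<in> H1 \<Omega>" "st_u P \<in> l2 M" "st_v P \<in> l2 M" using P by (auto simp: X_iff)
  have d0: "d \<ge> 0" using d(1) nrm_nonneg[of M "st_u P"] by linarith
  have sq: "(nrm m f)\<^sup>2 \<le> d\<^sup>2" if "nrm m f \<le> d" for m :: "'a measure" and f using that by (intro power_mono) auto
  have "\<bar>grad_ip (st_u P) (st_v P)\<bar> \<le> d * d"
    using H d d0 by (intro order_trans[OF grad.B_Cauchy_Schwarz] mult_mono) auto
  then have "\<bar>a12\<bar> * \<bar>grad_ip (st_u P) (st_v P)\<bar> \<le> \<bar>a12\<bar> * d\<^sup>2"
    by (intro mult_left_mono) (auto simp: power2_eq_square)
  then have g12: "a12 * grad_ip (st_u P) (st_v P) \<le> \<bar>a12\<bar> * d\<^sup>2"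
    unfolding abs_mult[symmetric] by (rule order_trans[OF abs_ge_self])
  have guu: "a11 * grad_ip (st_u P) (st_u P) \<le> a11 * d\<^sup>2" "a22 * grad_ip (st_v P) (st_v P) \<le> a22 * d\<^sup>2"
    using a11 a22 H d by (simp_all add: grad.N_sq[symmetric] power_mono)
  have "nrm M (st_u P - st_v P) \<le> nrm M (st_u P) + nrm M (- st_v P)"
    using l2.N_triangle[of "st_u P" M "- st_v P"] H subspace_neg[OF l2.subspace, of "st_v P" M] by simp
  then have "nrm M (st_u P - st_v P) \<le> 2 * d" using d H by (simp add: l2.N_minus)
  then have "(nrm M (st_u P - st_v P))\<^sup>2 \<le> (2 * d)\<^sup>2" by (intro power_mono) auto
  then have uv: "\<alpha> * ip M (st_u P - st_v P) (st_u P - st_v P) \<le> \<alpha> * (4 * d\<^sup>2)"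
    using \<alpha> by (intro mult_left_mono) (auto simp: nrm_sq power_mult_distrib)
  have "pot P P \<le> (a11 + a22 + 2 * \<bar>a12\<bar> + 4 * \<alpha>) * d\<^sup>2"
    unfolding pot_def grad_ip_sym[of "st_v P" "st_u P"] using g12 guu uv by (simp add: algebra_simps)
  moreover have "\<rho>1 * (nrm M (st_U P))\<^sup>2 \<le> \<rho>1 * d\<^sup>2" "\<rho>2 * (nrm M (st_V P))\<^sup>2 \<le> \<rho>2 * d\<^sup>2"
    using \<rho> d by (auto intro!: mult_left_mono power_mono)
  moreover have "C * (nrm Z (case_prod (st_p P)))\<^sup>2 \<le> C * d\<^sup>2" "C * (nrm Z (case_prod (st_q P)))\<^sup>2 \<le> C * d\<^sup>2"
    using C_pos d by (auto intro!: mult_left_mono power_mono)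
  ultimately show ?thesis unfolding N_sq_eq[OF P] distrib_right by linarith
qed

text \<open>All four fields are replaced by test functions. The diffusive variables come after the
  velocities, because the domain couples each of them to its velocity through
  \<open>diffusive\<close>.\<close>

lemma domain_dense:
  assumes P: "P \<in> X" and e: "e > 0"
  shows "\<exists>Q\<in>Dom. ph.N (P - Q) < e"
proof -
  define k where "k = \<rho>1 + \<rho>2 + a11 + a22 + 2 * \<bar>a12\<bar> + 4 * \<alpha> + 2 * C"
  have k: "k > 0" using \<rho> a11 a22 \<alpha> C_pos by (simp add: k_def add_pos_nonneg add_pos_pos)
  \<comment> \<open>Turns the constant of \<open>N_small\<close> into \<open>e\<^sup>2 / 4\<close>,
    leaving room for the strict inequality.\<close>
  define d where "d = e / (2 * sqrt k)"
  have d: "d > 0" using k e by (simp add: d_def)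
  note X = P[unfolded X_iff]
  obtain u where u: "u \<in> test" "nrm M (st_u P - u) < d" "grad.N (st_u P - u) < d"
    using X by (elim conjE) (rule H10_approx[OF _ d])
  obtain v where v: "v \<in> test" "nrm M (st_v P - v) < d" "grad.N (st_v P - v) < d"
    using X by (elim conjE) (rule H10_approx[OF _ d])
  obtain U where U: "U \<in> test" "nrm M (st_U P - U) < d"
    using X by (elim conjE) (rule test_closureE[OF test_functions_dense[OF open_domain emeasure_domain] d])
  obtain V where V: "V \<in> test" "nrm M (st_V P - V) < d"
    using X by (elim conjE) (rule test_closureE[OF test_functions_dense[OF open_domain emeasure_domain] d])
  obtain p where p: "case_prod p \<in> l2 Z" "(\<lambda>\<xi> x. of_real \<xi> * p \<xi> x) \<in> L2L2 \<Omega>"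
    "diffusive \<alpha> \<eta> p U \<in> L2L2 \<Omega>" "nrm Z (case_prod (st_p P) - case_prod p) < d"
    using X U by (elim conjE) (rule diffusive_approximation[OF _ test_in_l2 d])
  obtain q where q: "case_prod q \<in> l2 Z" "(\<lambda>\<xi> x. of_real \<xi> * q \<xi> x) \<in> L2L2 \<Omega>"
    "diffusive \<alpha> \<eta> q V \<in> L2L2 \<Omega>" "nrm Z (case_prod (st_q P) - case_prod q) < d"
    using X V by (elim conjE) (rule diffusive_approximation[OF _ test_in_l2 d])
  define Q :: state where "Q = (u, v, U, V, p, q)"
  have QX: "Q \<in> X" unfolding X_iff using u v U V p q by (simp add: Q_def)
  have w: "weighted p \<in> l2 Z" "weighted q \<in> l2 Z" using p q by (auto intro: weighted_l2 simp: L2L2_l2)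
  have comb: "(\<lambda>x. of_real b * u x + of_real c * v x) \<in> H2 \<Omega>" for b c
    by (intro test_H2 test_add test_cmult u v)
  have QD: "Q \<in> Dom"
    unfolding domain_iff using QX u v U V p q w comb
    by (auto simp: Q_def intro: stress_of_test)
  have c: "case_prod (st_p (P - Q)) = case_prod (st_p P) - case_prod p" "case_prod (st_q (P - Q)) = case_prod (st_q P) - case_prod q"
    by (auto simp: Q_def fun_eq_iff)
  have "(ph.N (P - Q))\<^sup>2 \<le> k * d\<^sup>2"
    unfolding k_def
  proof (rule N_small)
    show "P - Q \<in> X" using P QX by simp
  qed (use u v U V p q c in \<open>auto simp: Q_def\<close>)
  also have "\<dots> = e\<^sup>2 / 4" using k by (simp add: d_def power_divide power_mult_distrib)
  also have "\<dots> < e\<^sup>2" using e by simp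
  finally have "ph.N (P - Q) < e" by (rule power2_less_imp_less) (use e in simp)
  with QD show ?thesis by blast
qed

lemma phase_norm_eq: "phase_norm \<Omega> \<rho>1 \<rho>2 \<alpha> a11 a12 a22 = ph.N"
  by (simp add: fun_eq_iff phase_norm_def ph.N_def B_def)

lemma dissipative:
  assumes T: "contraction_semigroup X ph.N T" and gen: "generates X ph.N Dom Op T"
  shows "dissipative_semigroup X B T Dom Op"
proof -
  note sg = T[unfolded contraction_semigroup_def C0_semigroup_def state_add_eq state_diff_eq]
  note sg_in = sg[THEN conjunct1, THEN conjunct1]
  note sg_add = sg[THEN conjunct1, THEN conjunct2, THEN conjunct1]
  note sg_scale = sg[THEN conjunct1, THEN conjunct2, THEN conjunct2, THEN conjunct1]
  note sg_0 = sg[THEN conjunct1, THEN conjunct2, THEN conjunct2, THEN conjunct2, THEN conjunct2, THEN conjunct1]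
  note sg_plus = sg[THEN conjunct1, THEN conjunct2, THEN conjunct2, THEN conjunct2, THEN conjunct2, THEN conjunct2, THEN conjunct1]
  note sg_cont = sg[THEN conjunct1, THEN conjunct2, THEN conjunct2, THEN conjunct2, THEN conjunct2, THEN conjunct2, THEN conjunct2]
  note sg_contr = sg[THEN conjunct2]
  show ?thesis
  proof
    show "T t P \<in> X" if "t \<ge> 0" "P \<in> X" for t P by (rule sg_in[rule_format, OF that])
    show "ph.N (T t (P + Q) - (T t P + T t Q)) = 0" if "t \<ge> 0" "P \<in> X" "Q \<in> X" for t P Q
      by (rule sg_add[rule_format, OF that])
    show "ph.N (T t (r *\<^sub>R P) - r *\<^sub>R T t P) = 0" if "t \<ge> 0" "P \<in> X" for t r P
      \<comment> \<open>Complex homogeneity is restricted to real scalars, the only ones in the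
        abstract theory.\<close>
      using sg_scale[rule_format, OF that, of "of_real r"] by (simp only: state_scale_eq)
    show "ph.N (T 0 P - P) = 0" if "P \<in> X" for P by (rule sg_0[rule_format, OF that])
    show "ph.N (T (s + t) P - T s (T t P)) = 0" if "s \<ge> 0" "t \<ge> 0" "P \<in> X" for s t P
      by (rule sg_plus[rule_format, OF that])
    show "((\<lambda>t. ph.N (T t P - P)) \<longlongrightarrow> 0) (at_right 0)" if "P \<in> X" for P
      by (rule sg_cont[rule_format, OF that])
    show "ph.N (T t P) \<le> ph.N P" if "t \<ge> 0" "P \<in> X" for t P by (rule sg_contr[rule_format, OF that])
    show "((\<lambda>h. ph.N ((1 / h) *\<^sub>R (T h P - P) - F)) \<longlongrightarrow> 0) (at_right 0) \<longleftrightarrow> P \<in> Dom \<and> ph.N (F - Op P) = 0"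
      if "P \<in> X" "F \<in> X" for P F
      by (rule gen[unfolded generates_def state_diff_eq state_scale_eq, rule_format, OF that])
    show "P \<in> X" "Op P \<in> X" if "P \<in> Dom" for P using that by (rule domain_X op_X)+
  qed
qed


end

section \<open>Decay along trajectories in the domain\<close>

lemma tendsto_0_of_square:
  fixes f g :: "real \<Rightarrow> real"
  assumes g: "(g \<longlongrightarrow> 0) at_top" and c: "c > 0" and le: "\<And>t. t \<ge> 0 \<Longrightarrow> c * (f t)\<^sup>2 \<le> g t" "\<And>t. f t \<ge> 0"
  shows "(f \<longlongrightarrow> 0) at_top"
proof (rule tendsto_sandwich[OF _ _ tendsto_const])
  have "((\<lambda>t. sqrt (g t / c)) \<longlongrightarrow> sqrt (0 / c)) at_top"
    using c by (intro tendsto_intros g) auto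
  then show "((\<lambda>t. sqrt (g t / c)) \<longlongrightarrow> 0) at_top" by simp
  show "\<forall>\<^sub>F t in at_top. f t \<le> sqrt (g t / c)"
    using eventually_ge_at_top[of 0]
  proof eventually_elim
    case (elim t)
    have "(f t)\<^sup>2 \<le> g t / c" using le(1)[OF elim] c by (simp add: field_simps)
    then show ?case by (rule real_le_rsqrt)
  qed
qed (use le(2) in auto)

locale mixture_flow = mixture +
  fixes T :: "real \<Rightarrow> state \<Rightarrow> state"
  assumes contraction: "contraction_semigroup X ph.N T" and generates: "generates X ph.N Dom Op T"
begin

sublocale mixture_semigroup \<Omega> \<alpha> \<rho>1 \<rho>2 \<eta> a11 a12 a22 T Dom Op
  by (intro mixture_semigroup.intro mixture_semigroup_axioms.intro mixture_axioms
      dissipative[OF contraction generates])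

text \<open>Barbalat with the energy itself as Lyapunov form; it converges because it is nonnegative
  and nonincreasing. The dissipation is no bounded form on the phase space, so it is bounded below
  by the form \<open>g\<close> built with \<open>damping\<close>.\<close>

lemma dissipation_limits:
  assumes P: "P \<in> Dom"
  shows "((\<lambda>t. nrm Z (xi_mult damping (case_prod (st_p (T t P))))) \<longlongrightarrow> 0) at_top"
    and "((\<lambda>t. nrm Z (xi_mult damping (case_prod (st_q (T t P))))) \<longlongrightarrow> 0) at_top"
proof -
  have bl: "blin Z (\<lambda>P. xi_mult damping (case_prod (st_p P)))" "blin Z (\<lambda>P. xi_mult damping (case_prod (st_q P)))"
    by (intro blin_xi_mult[of _ _ 1] blin_p blin_q damping_measurable; simp add: damping_le_1)+
  define g where "g P Q = C * ip Z (xi_mult damping (case_prod (st_p P))) (xi_mult damping (case_prod (st_p Q)))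
    + C * ip Z (xi_mult damping (case_prod (st_q P))) (xi_mult damping (case_prod (st_q Q)))" for P Q
  obtain l where l: "((\<lambda>t. B (T t P) (T t P)) \<longlongrightarrow> l) at_top"
    using ph.energy_convergent[OF domain_X[OF P]] by blast
  have g_sq: "g Q Q = C * (nrm Z (xi_mult damping (case_prod (st_p Q))))\<^sup>2 + C * (nrm Z (xi_mult damping (case_prod (st_q Q))))\<^sup>2" for Q
    by (simp add: g_def nrm_sq)
  have g_nonneg: "C * (nrm Z f)\<^sup>2 \<ge> 0" for f using C_pos by simp
  have lim: "((\<lambda>t. g (T t P) (T t P)) \<longlongrightarrow> 0) at_top"
  proof (rule ph.bform_barbalat[OF ph.bform_B _ P _ l tendsto_const, where q = g])
    show "ph.bform g" unfolding g_def[abs_def] by (intro ph.bform_add ph.bform_cmult bform_ip bl)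
    show "g Q Q \<ge> 0" for Q unfolding g_sq using g_nonneg by (intro add_nonneg_nonneg)
    fix t :: real assume "t > 0"
    define y where "y = T t P"
    have y: "y \<in> Dom" using ph.T_domain(1)[OF P, of t] \<open>t > 0\<close> by (simp add: y_def)
    note yX = domain_X[OF y]
    have l: "case_prod (st_p y) \<in> l2 Z" "case_prod (st_q y) \<in> l2 Z" using yX by (auto simp: X_iff)
    have "B (Op y) y + B y (Op y) = 2 * B (Op y) y" using ph.B_sym[OF yX op_X[OF y]] by simp
    also have "\<dots> = - (2 * (C * (dissipation (st_p y) + dissipation (st_q y))))" by (simp add: energy_identity[OF y])
    finally have eq: "B (Op y) y + B y (Op y) = - (2 * (C * (dissipation (st_p y) + dissipation (st_q y))))" .
    have "g y y = C * ((nrm Z (xi_mult damping (case_prod (st_p y))))\<^sup>2 + (nrm Z (xi_mult damping (case_prod (st_q y))))\<^sup>2)"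
      by (simp add: g_sq distrib_left)
    also have "\<dots> \<le> C * (dissipation (st_p y) + dissipation (st_q y))"
      using C_pos dissipation_lower(1)[OF domain_weighted(1)[OF y] l(1)] dissipation_lower(1)[OF domain_weighted(2)[OF y] l(2)]
      by (intro mult_left_mono add_mono) auto
    finally have "g y y \<le> C * (dissipation (st_p y) + dissipation (st_q y))" .
    moreover have "g y y \<ge> 0" unfolding g_sq using g_nonneg by (intro add_nonneg_nonneg)
    ultimately show "B (Op (T t P)) (T t P) + B (T t P) (Op (T t P)) \<le> 0 - g (T t P) (T t P)"
      using eq unfolding y_def by linarith
  qed
  have le: "C * (nrm Z (xi_mult damping (case_prod (st_p Q))))\<^sup>2 \<le> g Q Q" "C * (nrm Z (xi_mult damping (case_prod (st_q Q))))\<^sup>2 \<le> g Q Q" for Q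
    unfolding g_sq using g_nonneg by auto
  show "((\<lambda>t. nrm Z (xi_mult damping (case_prod (st_p (T t P))))) \<longlongrightarrow> 0) at_top"
    by (rule tendsto_0_of_square[OF lim C_pos le(1)]) simp
  show "((\<lambda>t. nrm Z (xi_mult damping (case_prod (st_q (T t P))))) \<longlongrightarrow> 0) at_top"
    by (rule tendsto_0_of_square[OF lim C_pos le(2)]) simp
qed

text \<open>The energy identity read backwards: the dissipation at time \<open>t\<close> equals, up
  to the factor \<open>C\<close>, a pairing of the state with its image under \<open>Op\<close>, and
  both stay bounded along the trajectory.\<close>

lemma weighted_bounded:
  assumes P: "P \<in> Dom"
  shows "\<exists>K. \<forall>t\<ge>0. nrm Z (weighted (st_p (T t P))) \<le> K \<and> nrm Z (weighted (st_q (T t P))) \<le> K"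
proof (intro exI allI impI)
  fix t :: real assume t: "t \<ge> 0"
  define y where "y = T t P"
  have y: "y \<in> Dom" using ph.T_domain(1)[OF P t] by (simp add: y_def)
  note yX = domain_X[OF y]
  have l: "case_prod (st_p y) \<in> l2 Z" "case_prod (st_q y) \<in> l2 Z" using yX by (auto simp: X_iff)
  define R where "R = ph.N (Op P) * ph.N P + (ph.N P)\<^sup>2"
  have "C * (dissipation (st_p y) + dissipation (st_q y)) = - B (Op y) y" by (simp add: energy_identity[OF y])
  also have "\<dots> \<le> ph.N (Op y) * ph.N y" using ph.B_Cauchy_Schwarz[OF op_X[OF y] yX] by linarith
  also have "\<dots> \<le> ph.N (Op P) * ph.N P"
    using ph.N_A_T_le[OF P t] ph.T_contr[OF t domain_X[OF P]] yX op_X[OF P] unfolding y_def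
    by (intro mult_mono) auto
  finally have diss: "C * (dissipation (st_p y) + dissipation (st_q y)) \<le> ph.N (Op P) * ph.N P" .
  have "(ph.N y)\<^sup>2 \<le> (ph.N P)\<^sup>2" using ph.T_contr[OF t domain_X[OF P]] yX unfolding y_def by (intro power_mono) auto
  then have N: "C * (nrm Z (case_prod (st_p y)))\<^sup>2 + C * (nrm Z (case_prod (st_q y)))\<^sup>2 \<le> (ph.N P)\<^sup>2"
    using N_sq_eq[OF yX] N_terms_nonneg[OF yX] by linarith
  have dl: "C * (nrm Z (weighted (st_p y)))\<^sup>2 \<le> C * (dissipation (st_p y) + (nrm Z (case_prod (st_p y)))\<^sup>2)"
    "C * (nrm Z (weighted (st_q y)))\<^sup>2 \<le> C * (dissipation (st_q y) + (nrm Z (case_prod (st_q y)))\<^sup>2)"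
    using C_pos dissipation_lower(2)[OF domain_weighted(1)[OF y] l(1)] dissipation_lower(2)[OF domain_weighted(2)[OF y] l(2)]
    by (auto intro: mult_left_mono)
  have "C * (nrm Z (weighted (st_p y)))\<^sup>2 + C * (nrm Z (weighted (st_q y)))\<^sup>2 \<le> R"
    using dl diss N unfolding R_def distrib_left by linarith
  moreover have "C * (nrm Z f)\<^sup>2 \<ge> 0" for f using C_pos by simp
  ultimately have "C * (nrm Z (weighted (st_p y)))\<^sup>2 \<le> R" "C * (nrm Z (weighted (st_q y)))\<^sup>2 \<le> R"
    by (smt (verit))+
  then have "(nrm Z (weighted (st_p y)))\<^sup>2 \<le> R / C" "(nrm Z (weighted (st_q y)))\<^sup>2 \<le> R / C"
    using C_pos by (simp_all add: field_simps)
  then show "nrm Z (weighted (st_p (T t P))) \<le> sqrt (R / C) \<and> nrm Z (weighted (st_q (T t P))) \<le> sqrt (R / C)"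
    unfolding y_def by (auto intro: real_le_rsqrt)
qed

text \<open>Velocities and couplings have already been shown to decay, so the pairing of velocity
  with displacement has derivative minus the potential energy plus a vanishing term. Together with
  the two diffusive limits, every term of \<open>N_sq_eq\<close> tends to 0.\<close>

lemma domain_stable:
  assumes P: "P \<in> Dom"
  shows "((\<lambda>t. ph.N (T t P)) \<longlongrightarrow> 0) at_top"
proof -
  obtain K0 where K0: "\<forall>t\<ge>0. nrm Z (weighted (st_p (T t P))) \<le> K0 \<and> nrm Z (weighted (st_q (T t P))) \<le> K0"
    using weighted_bounded[OF P] by (rule exE)
  have K1: "\<exists>K. \<forall>t\<ge>0. nrm Z (weighted (st_p (T t P))) \<le> K" "\<exists>K. \<forall>t\<ge>0. nrm Z (weighted (st_q (T t P))) \<le> K"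
    using K0 by (auto intro: exI[of _ K0])
  interpret c1: channel \<Omega> \<alpha> \<rho>1 \<rho>2 \<eta> a11 a12 a22 T Dom Op st_u st_U st_p P
    by unfold_locales
      (use P blin_uv blin_U blin_p op_components domain_weighted dissipation_limits[OF P] K1 in \<open>simp_all\<close>)
  interpret c2: channel \<Omega> \<alpha> \<rho>1 \<rho>2 \<eta> a11 a12 a22 T Dom Op st_v st_V st_q P
    by unfold_locales
      (use P blin_uv blin_V blin_q op_components domain_weighted dissipation_limits[OF P] K1 in \<open>simp_all\<close>)
  \<comment> \<open>The equipartition multiplier: it tends to 0 because the velocities do and the
    displacements are bounded.\<close>
  define k where "k P Q = \<rho>1 * ip M (st_U P) (st_u Q) + \<rho>2 * ip M (st_V P) (st_v Q)" for P Q
  define r where "r t = \<rho>1 * (nrm M (st_U (T t P)))\<^sup>2 + \<rho>2 * (nrm M (st_V (T t P)))\<^sup>2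
    - C * coupling (st_p (T t P)) (st_u (T t P)) - C * coupling (st_q (T t P)) (st_v (T t P))" for t
  have r: "(r \<longlongrightarrow> 0) at_top"
  proof -
    have "(r \<longlongrightarrow> \<rho>1 * 0\<^sup>2 + \<rho>2 * 0\<^sup>2 - C * 0 - C * 0) at_top"
      unfolding r_def
      by (intro tendsto_intros c1.velocity_limit c2.velocity_limit c1.coupling_limit c2.coupling_limit)
    then show ?thesis by simp
  qed
  have kform: "ph.bform k"
    unfolding k_def[abs_def] by (intro ph.bform_add ph.bform_cmult bform_ip blin_U blin_V blin_uv)
  have klim: "((\<lambda>t. k (T t P) (T t P)) \<longlongrightarrow> 0) at_top"
  proof -
    have vanish: "((\<lambda>t. ip M (f (T t P)) (g (T t P))) \<longlongrightarrow> 0) at_top"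
      if f: "((\<lambda>t. nrm M (f (T t P))) \<longlongrightarrow> 0) at_top" and bl: "blin M f" "blin M g" for f g
    proof -
      obtain K where K: "K \<ge> 0" "\<And>t. t \<ge> 0 \<Longrightarrow> nrm M (g (T t P)) \<le> K" "\<And>t. t \<ge> 0 \<Longrightarrow> nrm M (g (Op (T t P))) \<le> K"
        by (rule trajectory_bound[OF bl(2) P], rule that; blast)
      show ?thesis
      proof (rule Lim_null_comparison)
        show "((\<lambda>t. nrm M (f (T t P)) * K) \<longlongrightarrow> 0) at_top" by (rule tendsto_mult_left_zero[OF f])
        show "\<forall>\<^sub>F t in at_top. norm (ip M (f (T t P)) (g (T t P))) \<le> nrm M (f (T t P)) * K"
          using eventually_ge_at_top[of 0]
        proof eventually_elim
          case (elim t)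
          have X: "T t P \<in> X" using elim domain_X[OF P] by simp
          have "\<bar>ip M (f (T t P)) (g (T t P))\<bar> \<le> nrm M (f (T t P)) * nrm M (g (T t P))"
            by (rule l2.B_Cauchy_Schwarz[OF blin_l2[OF bl(1) X] blin_l2[OF bl(2) X]])
          also have "\<dots> \<le> nrm M (f (T t P)) * K" using K(2)[OF elim] by (intro mult_left_mono) auto
          finally show ?case by simp
        qed
      qed
    qed
    have "((\<lambda>t. k (T t P) (T t P)) \<longlongrightarrow> \<rho>1 * 0 + \<rho>2 * 0) at_top"
      unfolding k_def
      by (intro tendsto_intros vanish c1.velocity_limit c2.velocity_limit blin_U blin_V blin_uv)
    then show ?thesis by simp
  qed
  have pot_lim: "((\<lambda>t. pot (T t P) (T t P)) \<longlongrightarrow> 0) at_top"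
  proof (rule ph.bform_barbalat[OF kform bform_pot P _ klim r pot_nonneg])
    fix t :: real assume "t > 0"
    define y where "y = T t P"
    have y: "y \<in> Dom" using ph.T_domain(1)[OF P, of t] \<open>t > 0\<close> by (simp add: y_def)
    have H: "st_u y \<in> H10 \<Omega>" "st_v y \<in> H10 \<Omega>" "st_u y \<in> l2 M" "st_v y \<in> l2 M" "st_u y - st_v y \<in> l2 M"
      using domain_X[OF y] by (auto simp: X_iff)
    have uv: "ip M (st_u y - st_v y) (st_u y - st_v y) = ip M (st_u y - st_v y) (st_u y) - ip M (st_u y - st_v y) (st_v y)"
      using l2.B_diff[OF H(3,4,5)] ip_sym[of M "st_u y" "st_u y - st_v y"] ip_sym[of M "st_v y" "st_u y - st_v y"]
      by linarith
    have kk: "k (Op y) y + k y (Op y) = \<rho>1 * ip M (st_U (Op y)) (st_u y) + \<rho>2 * ip M (st_V (Op y)) (st_v y)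
        + (\<rho>1 * (nrm M (st_U y))\<^sup>2 + \<rho>2 * (nrm M (st_V y))\<^sup>2)"
      unfolding k_def op_components(1,2) nrm_sq by (rule refl)
    have pp: "pot y y = a11 * grad_ip (st_u y) (st_u y) + a22 * grad_ip (st_v y) (st_v y)
        + (a12 * grad_ip (st_u y) (st_v y) + a12 * grad_ip (st_v y) (st_u y))
        + (\<alpha> * ip M (st_u y - st_v y) (st_u y) - \<alpha> * ip M (st_u y - st_v y) (st_v y))"
      unfolding pot_def uv distrib_left right_diff_distrib by (rule refl)
    \<comment> \<open>Testing the momentum equations with the displacements reproduces exactly the
      potential form, including the terms with \<open>a12\<close> and
      \<open>\<alpha>\<close>.\<close>
    have "k (Op y) y + k y (Op y) = - pot y y + (\<rho>1 * (nrm M (st_U y))\<^sup>2 + \<rho>2 * (nrm M (st_V y))\<^sup>2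
      - C * coupling (st_p y) (st_u y) - C * coupling (st_q y) (st_v y))"
      unfolding kk pp using op_U_weak[OF y H(1)] op_V_weak[OF y H(2)] by linarith
    then show "k (Op (T t P)) (T t P) + k (T t P) (Op (T t P)) \<le> r t - pot (T t P) (T t P)"
      unfolding r_def y_def by linarith
  qed auto
  define E where "E t = \<rho>1 * (nrm M (st_U (T t P)))\<^sup>2 + \<rho>2 * (nrm M (st_V (T t P)))\<^sup>2 + pot (T t P) (T t P)
     + C * (nrm Z (case_prod (st_p (T t P))))\<^sup>2 + C * (nrm Z (case_prod (st_q (T t P))))\<^sup>2" for t
  have "(E \<longlongrightarrow> \<rho>1 * 0\<^sup>2 + \<rho>2 * 0\<^sup>2 + 0 + C * 0\<^sup>2 + C * 0\<^sup>2) at_top"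
    unfolding E_def
    by (intro tendsto_intros c1.velocity_limit c2.velocity_limit pot_lim c1.diffusive_limit c2.diffusive_limit)
  then have E: "(E \<longlongrightarrow> 0) at_top" by simp
  have "((\<lambda>t. sqrt (E t)) \<longlongrightarrow> sqrt 0) at_top" by (intro tendsto_real_sqrt E)
  then have "((\<lambda>t. sqrt (E t)) \<longlongrightarrow> 0) at_top" by simp
  moreover have "\<forall>\<^sub>F t in at_top. sqrt (E t) = ph.N (T t P)"
    using eventually_ge_at_top[of 0]
  proof eventually_elim
    case (elim t)
    then have X: "T t P \<in> X" using domain_X[OF P] by simp
    show ?case unfolding E_def N_sq_eq[OF X, symmetric] using X by simp
  qed
  ultimately show ?thesis using tendsto_cong by fast
qed

lemma stable: "strongly_stable X ph.N T"
  unfolding strongly_stable_def using ph.stable_of_dense[OF domain_dense domain_stable] by blast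

end

theorem theorem4p7:
  fixes \<Omega> :: "(real ^ 3) set"
    and \<rho>1 \<rho>2 \<alpha> \<eta> a11 a12 a22 :: real
    and T :: "real \<Rightarrow> state \<Rightarrow> state"
  assumes "open \<Omega>" and "connected \<Omega>" and "\<Omega> \<noteq> {}" and "bounded \<Omega>"
    and "simply_connected \<Omega>" and "smooth_boundary \<Omega>"
    and "\<rho>1 > 0" and "\<rho>2 > 0"
    and "0 < \<alpha>" and "\<alpha> < 1" and "\<eta> \<ge> 0"
    and "a11 > 0" and "a11 * a22 - a12\<^sup>2 > 0"
    and "contraction_semigroup (phase_space \<Omega>) (phase_norm \<Omega> \<rho>1 \<rho>2 \<alpha> a11 a12 a22) T"
    and "generates (phase_space \<Omega>) (phase_norm \<Omega> \<rho>1 \<rho>2 \<alpha> a11 a12 a22)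
           (mixture_domain \<Omega> \<alpha> \<eta> a11 a12 a22) (mixture_op \<Omega> \<rho>1 \<rho>2 \<alpha> \<eta> a11 a12 a22) T"
  shows "strongly_stable (phase_space \<Omega>) (phase_norm \<Omega> \<rho>1 \<rho>2 \<alpha> a11 a12 a22) T"
proof -
  interpret mixture \<Omega> \<alpha> \<rho>1 \<rho>2 \<eta> a11 a12 a22
    by unfold_locales (use assms in auto)
  interpret mixture_flow \<Omega> \<alpha> \<rho>1 \<rho>2 \<eta> a11 a12 a22 T
    by unfold_locales (use assms in \<open>simp_all add: X_def phase_norm_eq\<close>)
  show ?thesis using stable by (simp add: X_def phase_norm_eq)
qed

end
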